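(* Let $x\ge 1$ be a real number, and let $\mathfrak{n}$ and $\mathfrak{m}$ be nonzero ideals chosen independently and uniformly at random from the (finite) set of nonzero ideals of $\mathbb{Z}[i]$ with norm $x$ or less. Let $\mathfrak{K}$ be a nonzero ideal of $\mathbb{Z}[i]$. Then the probability that $(\mathfrak{n},\mathfrak{m})=\mathfrak{K}$ is $$\frac{1}{\zeta_{\mathbb{Q}(i)}(2)\,N(\mathfrak{K})^2} + O\left(\frac{1}{x^{2/3}N(\mathfrak{K})^{4/3}}\right),$$ where the implied constant is absolute (independent of $x$ and $\mathfrak{K}$).
   Context: For a Gaussian integer $\alpha=a+bi$ with $a,b\in\mathbb{Z}$, the norm is $N(\alpha)=a^2+b^2$. Every ideal $\mathfrak{n}$ of $\mathbb{Z}[i]$ is principal, $\mathfrak{n}=(\eta)$, and its norm is $N(\mathfrak{n})=N(\eta)$. The greatest common divisor $(\mathfrak{n},\mathfrak{m})$ of two ideals is the smallest ideal containing both, i.e. the ideal $\mathfrak{K}$ with $\mathfrak{n}\subset\mathfrak{K}$, $\mathfrak{m}\subset\mathfrak{K}$, and such that $\mathfrak{K}\subset\mathfrak{a}$ for every ideal $\mathfrak{a}$ containing both $\mathfrak{n}$ and $\mathfrak{m}$. The Dedekind zeta function of $\mathbb{Q}(i)$ is, for $\mathrm{Re}(s)>1$, $\zeta_{\mathbb{Q}(i)}(s)=\sum_{\mathfrak{a}} N(\mathfrak{a})^{-s}$, summed over nonzero ideals $\mathfrak{a}$ of $\mathbb{Z}[i]$; equivalently $\frac14\sum_{(a,b)\in\mathbb{Z}^2\setminus\{(0,0)\}}(a^2+b^2)^{-s}$.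 *)

theory Defs
  imports
    "HOL-Algebra.Ideal"
    "HOL-Analysis.Infinite_Sum"
    "HOL-Probability.Probability_Mass_Function"
begin

definition gauss_ring :: "complex ring" where
  "gauss_ring = \<lparr>carrier = {z. Re z \<in> \<int> \<and> Im z \<in> \<int>}, monoid.mult = (*), one = 1, zero = 0, add = (+)\<rparr>"

definition gauss_norm :: "complex \<Rightarrow> real" where
  "gauss_norm z = (Re z)^2 + (Im z)^2"

(* The norm of an ideal is the norm of any generator; lemmas gauss_ideal_principal and
   ideal_norm_PIdl below show that a generator exists and that its choice is immaterial. *)
definition ideal_norm :: "complex set \<Rightarrow> real" where
  "ideal_norm I = gauss_norm (SOME g. g \<in> carrier gauss_ring \<and> I = PIdl\<^bsub>gauss_ring\<^esub> g)"

definition nonzero_ideals :: "complex set set" where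
  "nonzero_ideals = {I. ideal I gauss_ring \<and> I \<noteq> {0}}"

definition nonzero_ideals_upto :: "real \<Rightarrow> complex set set" where
  "nonzero_ideals_upto x = {I \<in> nonzero_ideals. ideal_norm I \<le> x}"

definition ideal_gcd :: "complex set \<Rightarrow> complex set \<Rightarrow> complex set" where
  "ideal_gcd I J = Idl\<^bsub>gauss_ring\<^esub> (I \<union> J)"

(* Only meaningful for Re s > 1, where the family is summable. *)
definition zeta_Qi :: "complex \<Rightarrow> complex" where
  "zeta_Qi s = (\<Sum>\<^sub>\<infinity>I\<in>nonzero_ideals. complex_of_real (ideal_norm I) powr (- s))"

(* pmf_of_set is the uniform distribution only on a finite nonempty set;
   see finite_nonzero_ideals_upto and nonzero_ideals_upto_nonempty. *)
definition random_ideal_pair :: "real \<Rightarrow> (complex set \<times> complex set) pmf" where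
  "random_ideal_pair x =
     pair_pmf (pmf_of_set (nonzero_ideals_upto x)) (pmf_of_set (nonzero_ideals_upto x))"

lemma gauss_ring_simps [simp]:
  "z \<in> carrier gauss_ring \<longleftrightarrow> Re z \<in> \<int> \<and> Im z \<in> \<int>"
  "monoid.mult gauss_ring = (*)" "one gauss_ring = 1" "zero gauss_ring = 0" "add gauss_ring = (+)"
  by (simp_all add: gauss_ring_def)

lemma cring_gauss_ring: "cring gauss_ring"
proof (rule cringI)
  show "abelian_group gauss_ring"
  proof (rule abelian_groupI)
    fix x assume "x \<in> carrier gauss_ring"
    then have "- x \<in> carrier gauss_ring \<and> - x + x = 0" by simp
    then show "\<exists>y\<in>carrier gauss_ring. y \<oplus>\<^bsub>gauss_ring\<^esub> x = \<zero>\<^bsub>gauss_ring\<^esub>"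
      unfolding gauss_ring_simps(4,5) by blast
  qed (auto simp: algebra_simps)
  show "Group.comm_monoid gauss_ring"
    by (rule comm_monoidI) (auto simp: algebra_simps)
qed (auto simp: algebra_simps)

lemma gauss_norm_cmod: "gauss_norm z = (cmod z)^2"
  by (simp add: gauss_norm_def cmod_power2)

lemma gauss_norm_mult: "gauss_norm (a * b) = gauss_norm a * gauss_norm b"
  by (simp add: gauss_norm_cmod norm_mult power_mult_distrib)

lemma gauss_norm_eq_0 [simp]: "gauss_norm z = 0 \<longleftrightarrow> z = 0"
  by (simp add: gauss_norm_cmod)

lemma gauss_norm_nat: "z \<in> carrier gauss_ring \<Longrightarrow> \<exists>n::nat. gauss_norm z = real n"
proof -
  assume "z \<in> carrier gauss_ring"
  then obtain a b :: int where "Re z = of_int a" "Im z = of_int b"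
    by (auto elim!: Ints_cases)
  then have "gauss_norm z = real (nat (a^2 + b^2))"
    by (simp add: gauss_norm_def)
  then show ?thesis by blast
qed

lemma gauss_norm_ge_1:
  assumes "z \<in> carrier gauss_ring" "z \<noteq> 0" shows "gauss_norm z \<ge> 1"
proof -
  obtain n :: nat where n: "gauss_norm z = real n" using gauss_norm_nat assms(1) by blast
  then have "n \<noteq> 0" using assms(2) gauss_norm_eq_0[of z] by auto
  then show ?thesis using n by simp
qed

lemma PIdl_gauss: "PIdl\<^bsub>gauss_ring\<^esub> g = {z * g | z. z \<in> carrier gauss_ring}"
  by (simp add: cgenideal_def)

lemma gauss_norm_le_of_mem_PIdl:
  assumes "h \<in> PIdl\<^bsub>gauss_ring\<^esub> g" "h \<noteq> 0"
  shows "gauss_norm g \<le> gauss_norm h"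
proof -
  obtain z where z: "z \<in> carrier gauss_ring" "h = z * g"
    using assms(1) unfolding PIdl_gauss by blast
  then have "gauss_norm z \<ge> 1" using assms(2) gauss_norm_ge_1 by auto
  moreover have "gauss_norm g \<ge> 0" by (simp add: gauss_norm_cmod)
  ultimately show ?thesis using mult_right_mono[of 1 "gauss_norm z" "gauss_norm g"]
    by (simp add: z gauss_norm_mult)
qed

lemma gauss_self_mem_PIdl: "g \<in> PIdl\<^bsub>gauss_ring\<^esub> g"
proof -
  have "g = 1 * g" "(1::complex) \<in> carrier gauss_ring" by simp_all
  then show ?thesis unfolding PIdl_gauss by blast
qed

lemma ideal_norm_PIdl:
  assumes "g \<in> carrier gauss_ring"
  shows "ideal_norm (PIdl\<^bsub>gauss_ring\<^esub> g) = gauss_norm g"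
proof -
  define h where "h = (SOME h. h \<in> carrier gauss_ring \<and> PIdl\<^bsub>gauss_ring\<^esub> g = PIdl\<^bsub>gauss_ring\<^esub> h)"
  have "h \<in> carrier gauss_ring \<and> PIdl\<^bsub>gauss_ring\<^esub> g = PIdl\<^bsub>gauss_ring\<^esub> h"
    unfolding h_def by (rule someI[of _ g]) (use assms in simp)
  then have eq: "PIdl\<^bsub>gauss_ring\<^esub> g = PIdl\<^bsub>gauss_ring\<^esub> h" by blast
  have gh: "g \<in> PIdl\<^bsub>gauss_ring\<^esub> h" and hg: "h \<in> PIdl\<^bsub>gauss_ring\<^esub> g"
    using gauss_self_mem_PIdl eq by auto
  have "gauss_norm g = gauss_norm h"
  proof (cases "g = 0 \<or> h = 0")
    case True
    then have "g = h" using gh hg by (auto simp: PIdl_gauss)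
    then show ?thesis by simp
  next
    case False
    then show ?thesis using gauss_norm_le_of_mem_PIdl[OF gh] gauss_norm_le_of_mem_PIdl[OF hg] by simp
  qed
  then show ?thesis unfolding ideal_norm_def h_def by simp
qed

lemma gauss_ideal_principal:
  assumes "ideal I gauss_ring"
  shows "\<exists>g \<in> carrier gauss_ring. I = PIdl\<^bsub>gauss_ring\<^esub> g"
proof (cases "I = {0}")
  case True
  have "PIdl\<^bsub>gauss_ring\<^esub> 0 = {0}"
    unfolding PIdl_gauss by (auto intro: exI[of _ 0])
  with True show ?thesis by (intro bexI[of _ 0]) auto
next
  case False
  interpret ideal I gauss_ring by fact
  have zero: "0 \<in> I" using additive_subgroup.zero_closed[OF is_additive_subgroup] by simp
  define m where "m z = nat \<lfloor>gauss_norm z\<rfloor>" for z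
  obtain g0 where "g0 \<in> I \<and> g0 \<noteq> 0" using False zero by blast
  then obtain g where g: "g \<in> I" "g \<noteq> 0" and min: "\<And>y. y \<in> I \<and> y \<noteq> 0 \<Longrightarrow> m g \<le> m y"
    using ex_has_least_nat[of "\<lambda>z. z \<in> I \<and> z \<noteq> 0" g0 m] by auto
  have gc: "g \<in> carrier gauss_ring" using g a_Hcarr by blast
  have "h \<in> PIdl\<^bsub>gauss_ring\<^esub> g" if h: "h \<in> I" for h
  proof (rule ccontr)
    assume nh: "h \<notin> PIdl\<^bsub>gauss_ring\<^esub> g"
    define w where "w = h / g"
    define q where "q = Complex (of_int (round (Re w))) (of_int (round (Im w)))"
    have qc: "q \<in> carrier gauss_ring" by (simp add: q_def)
    have "- q \<in> carrier gauss_ring" using qc by simp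
    then have "(- q) * g \<in> I" using I_l_closed[OF g(1), of "- q"] unfolding gauss_ring_simps(2) by blast
    then have r: "h + (- q) * g \<in> I"
      using additive_subgroup.a_closed[OF is_additive_subgroup h] unfolding gauss_ring_simps(5) by blast
    have rne: "h + (- q) * g \<noteq> 0"
    proof
      assume "h + (- q) * g = 0"
      then have "h = q * g" by (simp add: algebra_simps)
      then show False using nh qc unfolding PIdl_gauss by blast
    qed
    have a: "\<bar>Re w - of_int (round (Re w))\<bar> \<le> 1/2" "\<bar>Im w - of_int (round (Im w))\<bar> \<le> 1/2"
      using of_int_round_abs_le[of "Re w"] of_int_round_abs_le[of "Im w"]
      by (simp_all add: abs_minus_commute)
    have "(Re w - of_int (round (Re w)))^2 \<le> (1/2)^2" "(Im w - of_int (round (Im w)))^2 \<le> (1/2)^2"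
      using power_mono[OF a(1), of 2] power_mono[OF a(2), of 2] by simp_all
    then have "gauss_norm (w - q) \<le> 1/2"
      by (simp add: gauss_norm_def q_def power2_eq_square)
    moreover have "h + (- q) * g = (w - q) * g" using g by (simp add: w_def field_simps)
    then have "gauss_norm (h + (- q) * g) = gauss_norm (w - q) * gauss_norm g"
      by (metis gauss_norm_mult)
    moreover have "gauss_norm g \<ge> 1" using gauss_norm_ge_1 gc g by blast
    ultimately have lt: "gauss_norm (h + (- q) * g) < gauss_norm g"
      using mult_right_mono[of "gauss_norm (w - q)" "1/2" "gauss_norm g"] by simp
    obtain k l :: nat where "gauss_norm (h + (- q) * g) = real k" "gauss_norm g = real l"
      using gauss_norm_nat gc a_Hcarr[OF r] by meson
    then have "m (h + (- q) * g) < m g" using lt by (simp add: m_def)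
    then show False using min r rne by (meson leD)
  qed
  moreover have "PIdl\<^bsub>gauss_ring\<^esub> g \<subseteq> I"
    unfolding PIdl_gauss using I_l_closed[OF g(1)] by auto
  ultimately show ?thesis using gc by blast
qed

lemma finite_nonzero_ideals_upto: "finite (nonzero_ideals_upto x)"
proof -
  let ?B = "{-\<lceil>\<bar>x\<bar>\<rceil>..\<lceil>\<bar>x\<bar>\<rceil>}"
  let ?f = "\<lambda>(a, b). PIdl\<^bsub>gauss_ring\<^esub> (Complex (of_int a) (of_int b))"
  have bound: "a \<in> ?B" if "(real_of_int a)^2 \<le> x" for a
  proof -
    have "\<bar>a\<bar> \<le> a^2"
    proof (cases "a = 0")
      case False
      then have "1 * \<bar>a\<bar> \<le> \<bar>a\<bar> * \<bar>a\<bar>" by (intro mult_right_mono) auto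
      then show ?thesis by (simp add: power2_eq_square)
    qed simp
    then have "real_of_int \<bar>a\<bar> \<le> real_of_int (a^2)" by linarith
    then have "real_of_int \<bar>a\<bar> \<le> \<bar>x\<bar>" using that by simp
    then have "\<bar>a\<bar> \<le> \<lceil>\<bar>x\<bar>\<rceil>" by linarith
    then show ?thesis by auto
  qed
  have "nonzero_ideals_upto x \<subseteq> ?f ` (?B \<times> ?B)"
  proof
    fix I assume I: "I \<in> nonzero_ideals_upto x"
    then have "ideal I gauss_ring" by (simp add: nonzero_ideals_upto_def nonzero_ideals_def)
    then obtain g where g: "g \<in> carrier gauss_ring" "I = PIdl\<^bsub>gauss_ring\<^esub> g"
      using gauss_ideal_principal by blast
    then have n: "gauss_norm g \<le> x" using I ideal_norm_PIdl by (simp add: nonzero_ideals_upto_def)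
    obtain a b :: int where ab: "Re g = of_int a" "Im g = of_int b"
      using g(1) by (auto elim!: Ints_cases)
    have "(real_of_int a)^2 + (real_of_int b)^2 \<le> x" using n by (simp add: gauss_norm_def ab)
    then have "(real_of_int a)^2 \<le> x" "(real_of_int b)^2 \<le> x"
      by (smt (verit) zero_le_power2)+
    then have "(a, b) \<in> ?B \<times> ?B" using bound by blast
    moreover have "g = Complex (of_int a) (of_int b)" using ab by (simp add: complex_eq_iff)
    ultimately show "I \<in> ?f ` (?B \<times> ?B)" using g(2) by force
  qed
  then show ?thesis by (rule finite_subset) simp
qed

lemma nonzero_ideals_upto_nonempty:
  assumes "x \<ge> 1" shows "nonzero_ideals_upto x \<noteq> {}"
proof -
  interpret cring gauss_ring by (rule cring_gauss_ring)
  have 1: "(1::complex) \<in> carrier gauss_ring" by simp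
  have "ideal (PIdl\<^bsub>gauss_ring\<^esub> 1) gauss_ring" using cgenideal_ideal[OF 1] .
  moreover have "PIdl\<^bsub>gauss_ring\<^esub> 1 \<noteq> {0}"
    using gauss_self_mem_PIdl[of 1] by (metis singletonD zero_neq_one)
  moreover have "ideal_norm (PIdl\<^bsub>gauss_ring\<^esub> 1) \<le> x"
    using ideal_norm_PIdl[OF 1] assms by (simp add: gauss_norm_def)
  ultimately show ?thesis by (auto simp: nonzero_ideals_upto_def nonzero_ideals_def)
qed

lemma ideal_gcd_eq_iff:
  assumes "ideal I gauss_ring" "ideal J gauss_ring"
  shows "ideal_gcd I J = K \<longleftrightarrow>
    ideal K gauss_ring \<and> I \<subseteq> K \<and> J \<subseteq> K \<and>
    (\<forall>A. ideal A gauss_ring \<and> I \<subseteq> A \<and> J \<subseteq> A \<longrightarrow> K \<subseteq> A)"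
proof -
  interpret cring gauss_ring by (rule cring_gauss_ring)
  have sub: "I \<union> J \<subseteq> carrier gauss_ring"
    using ideal.Icarr[OF assms(1)] ideal.Icarr[OF assms(2)] by auto
  have 1: "ideal (ideal_gcd I J) gauss_ring" "I \<subseteq> ideal_gcd I J" "J \<subseteq> ideal_gcd I J"
    unfolding ideal_gcd_def using genideal_ideal[OF sub] genideal_self[OF sub] by auto
  have 2: "ideal_gcd I J \<subseteq> A" if "ideal A gauss_ring" "I \<subseteq> A" "J \<subseteq> A" for A
    unfolding ideal_gcd_def using genideal_minimal[OF that(1)] that by simp
  show ?thesis
  proof
    assume "ideal_gcd I J = K"
    then show "ideal K gauss_ring \<and> I \<subseteq> K \<and> J \<subseteq> K \<and>
        (\<forall>A. ideal A gauss_ring \<and> I \<subseteq> A \<and> J \<subseteq> A \<longrightarrow> K \<subseteq> A)"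
      using 1 2 by metis
  next
    assume K: "ideal K gauss_ring \<and> I \<subseteq> K \<and> J \<subseteq> K \<and>
        (\<forall>A. ideal A gauss_ring \<and> I \<subseteq> A \<and> J \<subseteq> A \<longrightarrow> K \<subseteq> A)"
    show "ideal_gcd I J = K"
    proof (rule subset_antisym)
      show "ideal_gcd I J \<subseteq> K" using K 2 by metis
      show "K \<subseteq> ideal_gcd I J" using K 1 by metis
    qed
  qed
qed

end

theory Submission
  imports Defs "HOL-Analysis.Analysis"
begin

text \<open>
  With a Moebius function \<open>\<mu>\<close> on ideals and \<open>H\<close> the ideal counting function, the number of coprime
  pairs of norm at most \<open>y\<close> is \<open>\<Sum>D. \<mu>(D) H(y / N(D))\<^sup>2\<close>, and pairs with gcd \<open>K\<close> and norm at most \<open>x\<close>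
  correspond to coprime pairs of norm at most \<open>x / N(K)\<close>. The claimed error term is exactly what
  \<open>H(x) = c x + O(x powr (1/3))\<close> yields, since \<open>\<Sum>I. N(I) powr (-4/3)\<close> converges.
  That estimate is the classical \<open>1/3\<close> bound in the Gauss circle problem. It is obtained by van der
  Corput's method: the number of lattice points is, up to a smooth main term, a sum of the sawtooth
  function over \<open>sqrt (x - n\<^sup>2)\<close>; the sawtooth is squeezed between difference quotients of its
  periodic primitive, whose Fourier series converges absolutely, and the resulting exponential sums
  are bounded by the second difference test, which follows from the Kusmin--Landau inequality.
\<close>

section \<open>Exponential sums\<close>

text \<open>The arc \<open>sqrt (x - t\<^sup>2)\<close> is used only for
  \<open>t \<le> sqrt (x / 2)\<close>: there its second derivative has order 1 / sqrt x, while near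
  sqrt x it is unbounded. Symmetry in the diagonal supplies the rest. With rho = x^(1/6) there are
  at most rho^3 terms with second differences of order rho^(-3); a difference quotient of step about
  1 / rho costs rho^2 = x^(1/3), and the exponential sums stay within that order. Such an error is
  visible only if everything of order sqrt x cancels, so the end terms of the trapezoid rule and the
  fractional part of \<open>sqrt (x / 2)\<close> are carried exactly. The counting estimates are
  stated for all positive arguments, also below 1 where no ideal exists. Hence Moebius sums may run
  over all nonzero ideals and be compared term by term with the series for 1 / zeta(2), without
  truncation, and N(K) > x needs no separate case.\<close>

lemma sin_pi_ge:
  assumes "0 \<le> w" "w \<le> (1::real)"
  shows "sin (pi * w) \<ge> 2 * min w (1 - w)"
proof -
  have *: "sin (pi * v) \<ge> 2 * v" if "0 \<le> v" "v \<le> 1/2" for v :: real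
  proof -
    have "concave_on {0..1/2} (\<lambda>v. sin (pi * v))"
    proof (rule f''_le0_imp_concave)
      fix v :: real assume v: "v \<in> {0..1/2}"
      show "((\<lambda>v. sin (pi * v)) has_real_derivative pi * cos (pi * v)) (at v)"
        by (auto intro!: derivative_eq_intros)
      show "((\<lambda>v. pi * cos (pi * v)) has_real_derivative - (pi\<^sup>2 * sin (pi * v))) (at v)"
        by (auto intro!: derivative_eq_intros simp: power2_eq_square)
      have "pi * v \<le> pi * 1" using v by (intro mult_left_mono) auto
      then show "- (pi\<^sup>2 * sin (pi * v)) \<le> 0" using v by (auto intro!: mult_nonneg_nonneg sin_ge_zero)
    qed auto
    \<comment> \<open>The convex combination of 0 and 1/2 with weight \<open>2 * v\<close> is
      \<open>v\<close>, and the chord has height \<open>2 * v\<close> there: this is Jordan's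
      inequality.\<close>
    from concave_onD[OF this, of "2 * v" 0 "1/2"] show ?thesis using that by simp
  qed
  show ?thesis
  proof (cases "w \<le> 1/2")
    case True then show ?thesis using *[of w] assms by simp
  next
    case False
    have "sin (pi * w) = sin (pi * (1 - w))"
      by (simp add: right_diff_distrib)
    then show ?thesis using *[of "1 - w"] assms False by simp
  qed
qed

text \<open>Half-angle formulas give 1 - exp(2ia) = -2i sin a exp(ia). The reciprocal therefore has
  constant real part 1/2, and all variation of the coefficients in a summation by parts sits in a
  cotangent.\<close>

lemma inverse_one_minus_cis:
  assumes "sin (pi * w) \<noteq> 0"
  shows "1 / (1 - cis (2 * pi * w)) = (1 + \<i> * of_real (cot (pi * w))) / 2"
    and "1 - cis (2 * pi * w) \<noteq> 0"
    and "cmod (1 / (1 - cis (2 * pi * w))) = 1 / (2 * \<bar>sin (pi * w)\<bar>)"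
proof -
  define s c where "s = sin (pi * w)" and "c = cos (pi * w)"
  have sc: "s\<^sup>2 + c\<^sup>2 = 1" by (simp add: s_def c_def)
  have s: "s \<noteq> 0" using assms by (simp add: s_def)
  have sin2: "sin (2 * pi * w) = 2 * s * c" "cos (2 * pi * w) = 1 - 2 * s\<^sup>2"
    using sin_double[of "pi * w"] cos_double_sin[of "pi * w"] by (simp_all add: s_def c_def mult.assoc)
  have eq: "1 - cis (2 * pi * w) = Complex (2 * s\<^sup>2) (- 2 * s * c)"
    by (simp add: complex_eq_iff sin2)
  show ne: "1 - cis (2 * pi * w) \<noteq> 0" unfolding eq using s by (simp add: complex_eq_iff)
  have one: "(1 + \<i> * of_real (cot (pi * w))) / 2 * (1 - cis (2 * pi * w)) = 1"
  proof -
    have "cot (pi * w) * s = c" using s by (simp add: cot_def s_def c_def)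
    moreover from this have "cot (pi * w) * (s * c) = c\<^sup>2"
      by (metis mult.assoc power2_eq_square)
    moreover have "cot (pi * w) * s\<^sup>2 = s * c"
      using \<open>cot (pi * w) * s = c\<close> by (metis mult.assoc mult.commute power2_eq_square)
    ultimately show ?thesis
      unfolding eq using sc by (simp add: complex_eq_iff)
  qed
  then show e: "1 / (1 - cis (2 * pi * w)) = (1 + \<i> * of_real (cot (pi * w))) / 2"
    using nonzero_eq_divide_eq[OF ne] by metis
  have "cmod (1 - cis (2 * pi * w)) = sqrt ((2 * s\<^sup>2)\<^sup>2 + (2 * s * c)\<^sup>2)"
    unfolding eq by (simp add: cmod_def)
  also have "(2 * s\<^sup>2)\<^sup>2 + (2 * s * c)\<^sup>2 = (2 * s)\<^sup>2 * (s\<^sup>2 + c\<^sup>2)"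
    by (simp add: power2_eq_square algebra_simps)
  finally have "cmod (1 - cis (2 * pi * w)) = 2 * \<bar>s\<bar>"
    using sc by (simp add: real_sqrt_mult)
  then show "cmod (1 / (1 - cis (2 * pi * w))) = 1 / (2 * \<bar>sin (pi * w)\<bar>)"
    by (simp add: norm_divide s_def)
qed

lemma cot_antimono:
  assumes "0 < a" "a \<le> b" "b < pi"
  shows "cot b \<le> cot a"
proof -
  have s: "sin a > 0" "sin b > 0" using assms by (auto intro: sin_gt_zero)
  have "cot a - cot b = sin (b - a) / (sin a * sin b)"
    using s by (simp add: cot_def sin_diff field_simps)
  moreover have "sin (b - a) \<ge> 0" using assms by (intro sin_ge_zero) auto
  ultimately show ?thesis using s by (smt (verit) divide_nonneg_pos mult_pos_pos)
qed

lemma cis_minus_int: "cis (2 * pi * (t - of_int k)) = cis (2 * pi * t)"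
  by (simp add: right_diff_distrib cis_divide[symmetric] cis_multiple_2pi)

text \<open>With \<open>c n = 1 / (1 - cis (2 * pi * (u (Suc n) - u n)))\<close> each summand \<open>e n\<close> equals
  \<open>c n * (e n - e (Suc n))\<close>. Summation by parts leaves the total variation of \<open>c\<close>, which is that of
  a monotone sequence of cotangents.\<close>

lemma kusmin_landau:
  fixes u :: "nat \<Rightarrow> real"
  assumes "\<delta> > 0"
    and bd: "\<And>n. p \<le> n \<Longrightarrow> n < q \<Longrightarrow> of_int k + \<delta> \<le> u (Suc n) - u n \<and> u (Suc n) - u n \<le> of_int k + 1 - \<delta>"
    and dec: "\<And>n. p \<le> n \<Longrightarrow> Suc n < q \<Longrightarrow> u (Suc (Suc n)) - u (Suc n) \<le> u (Suc n) - u n"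
  shows "cmod (\<Sum>n\<in>{p..<q}. cis (2 * pi * u n)) \<le> 1 / \<delta>"
proof (cases "p < q")
  case False then show ?thesis using assms(1) by simp
next
  case True
  define w where "w n = u (Suc n) - u n - of_int k" for n
  define c where "c n = 1 / (1 - cis (2 * pi * w n))" for n
  define T where "T n = cot (pi * w n)" for n
  let ?e = "\<lambda>n. cis (2 * pi * u n)"
  have w: "\<delta> \<le> w n" "w n \<le> 1 - \<delta>" if "p \<le> n" "n < q" for n
    using bd[OF that] by (auto simp: w_def)
  have sw: "sin (pi * w n) \<ge> 2 * \<delta>" if "p \<le> n" "n < q" for n
    using sin_pi_ge[of "w n"] w[OF that] assms(1) by (simp add: min_def split: if_splits)
  have c1: "cmod (c n) \<le> 1 / (4 * \<delta>)" if "p \<le> n" "n < q" for n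
    unfolding c_def using sw[OF that] assms(1)
    by (subst inverse_one_minus_cis(3)) (auto intro!: divide_left_mono)
  have T1: "\<bar>T n\<bar> \<le> 1 / (2 * \<delta>)" if "p \<le> n" "n < q" for n
  proof -
    have "\<bar>T n\<bar> = \<bar>cos (pi * w n)\<bar> / sin (pi * w n)"
      using sw[OF that] assms(1) by (simp add: T_def cot_def abs_divide)
    also have "\<dots> \<le> 1 / (2 * \<delta>)"
      using sw[OF that] assms(1) by (intro frac_le) auto
    finally show ?thesis .
  qed
  have e_step: "?e n = c n * (?e n - ?e (Suc n))" if "p \<le> n" "n < q" for n
  proof -
    have "cis (2 * pi * w n) = cis (2 * pi * (u (Suc n) - u n))"
      unfolding w_def by (rule cis_minus_int)
    then have "?e (Suc n) = ?e n * cis (2 * pi * w n)"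
      by (simp add: cis_mult algebra_simps)
    moreover have "1 - cis (2 * pi * w n) \<noteq> 0"
      using inverse_one_minus_cis(2)[of "w n"] sw[OF that] assms(1) by auto
    ultimately show ?thesis by (simp add: c_def field_simps)
  qed
  \<comment> \<open>The boundary term \<open>c m * ?e (Suc m)\<close> stays with the partial sum.
    Each step then adds only \<open>(c (Suc m) - c m) * ?e (Suc m)\<close>, whose modulus is half
    the increase of \<open>T\<close>, so the bounds telescope.\<close>
  have main: "cmod ((\<Sum>n\<in>{p..<Suc m}. ?e n) + c m * ?e (Suc m)) \<le> 1 / (4 * \<delta>) + (T m - T p) / 2"
    if "p \<le> m" "m < q" for m
    using that
  proof (induction m rule: dec_induct)
    case base
    have "(\<Sum>n\<in>{p..<Suc p}. ?e n) + c p * ?e (Suc p) = c p * ?e p"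
      using e_step[of p] base by (simp add: algebra_simps)
    then show ?case using c1[of p] base by (simp add: norm_mult)
  next
    case (step m)
    have m: "p \<le> m" "m < q" "p \<le> Suc m" "Suc m < q" using step by auto
    have "(\<Sum>n\<in>{p..<Suc (Suc m)}. ?e n) + c (Suc m) * ?e (Suc (Suc m))
        = ((\<Sum>n\<in>{p..<Suc m}. ?e n) + c m * ?e (Suc m)) + (c (Suc m) - c m) * ?e (Suc m)"
      using e_step[OF m(3,4)] m by (simp add: algebra_simps)
    also have "cmod \<dots> \<le> (1 / (4 * \<delta>) + (T m - T p) / 2) + cmod (c (Suc m) - c m)"
      using step.IH m norm_triangle_ineq[of "(\<Sum>n\<in>{p..<Suc m}. ?e n) + c m * ?e (Suc m)" "(c (Suc m) - c m) * ?e (Suc m)"]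
      by (simp add: norm_mult del: sum.op_ivl_Suc)
    also have "c (Suc m) - c m = \<i> * of_real ((T (Suc m) - T m) / 2)"
    proof -
      have "sin (pi * w m) \<noteq> 0" "sin (pi * w (Suc m)) \<noteq> 0"
        using sw[OF m(1,2)] sw[OF m(3,4)] assms(1) by linarith+
      then show ?thesis unfolding c_def T_def
        by (simp add: inverse_one_minus_cis(1) diff_divide_distrib[symmetric] right_diff_distrib)
    qed
    also have "cmod \<dots> = (T (Suc m) - T m) / 2"
    proof -
      have "w (Suc m) \<le> w m" using dec[of m] m by (simp add: w_def)
      then have "T m \<le> T (Suc m)" unfolding T_def
        using w[OF m(1,2)] w[OF m(3,4)] assms(1) by (intro cot_antimono) auto
      then show ?thesis by (simp add: norm_mult del: of_real_divide of_real_diff)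
    qed
    finally show ?case by (simp add: field_simps)
  qed
  obtain m where m: "q = Suc m" "p \<le> m" using True by (metis Suc_le_D less_eq_Suc_le less_Suc_eq_le)
  have "cmod (\<Sum>n\<in>{p..<q}. ?e n) \<le> cmod ((\<Sum>n\<in>{p..<Suc m}. ?e n) + c m * ?e (Suc m)) + cmod (c m * ?e (Suc m))"
    using norm_triangle_ineq4[of "(\<Sum>n\<in>{p..<Suc m}. ?e n) + c m * ?e (Suc m)" "c m * ?e (Suc m)"] m by simp
  also have "\<dots> \<le> (1 / (4 * \<delta>) + (T m - T p) / 2) + 1 / (4 * \<delta>)"
    using main[of m] c1[of m] m by (intro add_mono) (auto simp: norm_mult)
  also have "(T m - T p) / 2 \<le> (1 / (2 * \<delta>) + 1 / (2 * \<delta>)) / 2"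
    using T1[of m] T1[of p] m by (simp add: abs_le_iff)
  finally show ?thesis by (simp add: field_simps)
qed

text \<open>For a monotone sequence the indices with values in a given range have no gaps. This
  brings them into the form \<open>{p..<q}\<close> required by \<open>kusmin_landau\<close>.\<close>

lemma convex_nat_set_eq_interval:
  fixes S :: "nat set"
  assumes "finite S" "\<And>i j l. i \<in> S \<Longrightarrow> l \<in> S \<Longrightarrow> i \<le> j \<Longrightarrow> j \<le> l \<Longrightarrow> j \<in> S"
  obtains p q where "S = {p..<q}"
proof (cases "S = {}")
  case True then show ?thesis using that[of 0 0] by simp
next
  case False
  have "S = {Min S..<Suc (Max S)}"
  proof (intro equalityI subsetI)
    fix j assume "j \<in> S" then show "j \<in> {Min S..<Suc (Max S)}" using assms(1) by (simp add: less_Suc_eq_le)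
  next
    fix j assume "j \<in> {Min S..<Suc (Max S)}"
    then show "j \<in> S" using assms(2)[of "Min S" "Max S" j] False assms(1) by simp
  qed
  then show ?thesis using that by blast
qed

text \<open>The indices are grouped by \<open>\<lfloor>u (Suc n) - u n\<rfloor>\<close>. In each group the Kusmin--Landau inequality is
  applied to the indices whose difference has distance at least \<open>sqrt \<kappa>\<close> from the integers; the
  others are few, because the differences are \<open>\<kappa>\<close>-spaced.\<close>

lemma second_difference_test:
  fixes u :: "nat \<Rightarrow> real"
  assumes lam: "\<kappa> > 0" and A: "A \<ge> 1"
    and lb: "\<And>n. Suc n < N \<Longrightarrow> \<kappa> \<le> (u (Suc n) - u n) - (u (Suc (Suc n)) - u (Suc n))"
    and ub: "\<And>n. Suc n < N \<Longrightarrow> (u (Suc n) - u n) - (u (Suc (Suc n)) - u (Suc n)) \<le> A * \<kappa>"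
  shows "cmod (\<Sum>n<N. cis (2 * pi * u n)) \<le> 5 * A * N * sqrt \<kappa> + 10 / sqrt \<kappa>"
\<comment> \<open>For \<open>\<kappa> > 1\<close> the trivial bound \<open>N\<close> suffices
  because \<open>A * sqrt \<kappa> \<ge> 1\<close>.\<close>
proof (cases "\<kappa> > 1 \<or> N = 0")
  case True
  have "cmod (\<Sum>n<N. cis (2 * pi * u n)) \<le> (\<Sum>n<N. 1)"
    by (rule order.trans[OF norm_sum]) simp
  also have "\<dots> \<le> 5 * A * N * sqrt \<kappa>"
  proof (cases "N = 0")
    case False
    then have "1 * 1 \<le> A * sqrt \<kappa>" using True A by (intro mult_mono) auto
    then have "real N * 1 \<le> real N * (5 * (A * sqrt \<kappa>))" by (intro mult_left_mono) auto
    then show ?thesis by (simp add: mult_ac)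
  qed simp
  also have "\<dots> \<le> 5 * A * N * sqrt \<kappa> + 10 / sqrt \<kappa>" using lam by simp
  finally show ?thesis .
next
  case False
  then have lam1: "\<kappa> \<le> 1" and N: "N > 0" by auto
  define g where "g n = u (Suc n) - u n" for n
  have gap: "real (j - i) * \<kappa> \<le> g i - g j \<and> g i - g j \<le> real (j - i) * (A * \<kappa>)"
    if "i \<le> j" "j < N" for i j
    using that
  proof (induction j rule: dec_induct)
    case (step j)
    then show ?case using lb[of j] ub[of j] by (simp add: Suc_diff_le algebra_simps g_def)
  qed simp
  have mono: "g j \<le> g i" if "i \<le> j" "j < N" for i j
    using gap[OF that] lam by (smt (verit) mult_nonneg_nonneg of_nat_0_le_iff)
  have card_le: "real (card {n. n < N \<and> a \<le> g n \<and> g n \<le> b}) \<le> (b - a) / \<kappa> + 1" if "a \<le> b" for a b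
  proof -
    let ?S = "{n. n < N \<and> a \<le> g n \<and> g n \<le> b}"
    obtain p q where pq: "?S = {p..<q}"
      by (rule convex_nat_set_eq_interval[of ?S]) (auto, (meson mono order_trans order_le_less_trans)+)
    show ?thesis
    proof (cases "p < q")
      case True
      then have "p \<in> ?S" "q - 1 \<in> ?S" unfolding pq by auto
      moreover have "p \<le> q - 1" using True by simp
      ultimately have "real (q - 1 - p) * \<kappa> \<le> g p - g (q - 1)" "g p \<le> b" "a \<le> g (q - 1)"
        using gap[of p "q - 1"] by blast+
      then have "real (q - 1 - p) * \<kappa> \<le> b - a" by linarith
      then have "real (q - 1 - p) \<le> (b - a) / \<kappa>" using lam by (simp add: field_simps)
      then show ?thesis unfolding pq using True by simp
    next
      case False
      then show ?thesis unfolding pq using that lam by simp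
    qed
  qed
  \<comment> \<open>In each group the indices near an integer number about \<delta> / \<kappa> on
    either side, and the others contribute at most 1 / \<delta>. This choice makes the two
    equal.\<close>
  define \<delta> where "\<delta> = sqrt \<kappa>"
  have d: "\<delta> > 0" "\<delta> \<le> 1" "\<delta> * \<delta> = \<kappa>" using lam lam1 by (auto simp: \<delta>_def)
  let ?e = "\<lambda>n. cis (2 * pi * u n)"
  have block: "cmod (\<Sum>n\<in>{n \<in> {..<N}. \<lfloor>g n\<rfloor> = k}. ?e n) \<le> 5 / \<delta>" for k
  proof -
    let ?S = "{n \<in> {..<N}. \<lfloor>g n\<rfloor> = k}"
    let ?M = "{n. n < N \<and> of_int k + \<delta> \<le> g n \<and> g n \<le> of_int k + 1 - \<delta>}"
    let ?L = "{n. n < N \<and> of_int k \<le> g n \<and> g n \<le> of_int k + \<delta>}"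
    let ?R = "{n. n < N \<and> of_int k + 1 - \<delta> \<le> g n \<and> g n \<le> of_int k + 1}"
    have M: "?M \<subseteq> ?S"  using d
      by (auto simp: floor_eq_iff)
    have "?S - ?M \<subseteq> ?L \<union> ?R" by (auto simp: floor_eq_iff)
    then have "card (?S - ?M) \<le> card (?L \<union> ?R)" by (intro card_mono) auto
    also have "\<dots> \<le> card ?L + card ?R" by (rule card_Un_le)
    finally have "real (card (?S - ?M)) \<le> real (card ?L) + real (card ?R)" by linarith
    also have "\<dots> \<le> (\<delta> / \<kappa> + 1) + (\<delta> / \<kappa> + 1)"
      using card_le[of "of_int k" "of_int k + \<delta>"] card_le[of "of_int k + 1 - \<delta>" "of_int k + 1"] d
      by (intro add_mono) auto
    also have "\<delta> / \<kappa> = 1 / \<delta>" using d by (auto simp: field_simps)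
    finally have cd: "real (card (?S - ?M)) \<le> 2 / \<delta> + 2" by simp
    obtain p q where pq: "?M = {p..<q}"
      by (rule convex_nat_set_eq_interval[of ?M]) (auto, (meson mono order_trans order_le_less_trans)+)
    have "cmod (\<Sum>n\<in>{p..<q}. ?e n) \<le> 1 / \<delta>"
    proof (rule kusmin_landau[OF d(1)])
      fix n assume "p \<le> n" "n < q"
      then have "n \<in> ?M" unfolding pq by simp
      then show "of_int k + \<delta> \<le> u (Suc n) - u n \<and> u (Suc n) - u n \<le> of_int k + 1 - \<delta>"
        by (simp add: g_def)
    next
      fix n assume "p \<le> n" "Suc n < q"
      then have "Suc n \<in> ?M" unfolding pq by simp
      then show "u (Suc (Suc n)) - u (Suc n) \<le> u (Suc n) - u n"
        using mono[of n "Suc n"] by (simp add: g_def)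
    qed
    then have M1: "cmod (\<Sum>n\<in>?M. ?e n) \<le> 1 / \<delta>" unfolding pq .
    have "(\<Sum>n\<in>?S. ?e n) = (\<Sum>n\<in>?S - ?M. ?e n) + (\<Sum>n\<in>?M. ?e n)"
      using M by (intro sum.subset_diff) auto
    moreover have "cmod (\<Sum>n\<in>?S - ?M. ?e n) \<le> real (card (?S - ?M))"
      by (rule order.trans[OF norm_sum]) simp
    ultimately have "cmod (\<Sum>n\<in>?S. ?e n) \<le> real (card (?S - ?M)) + 1 / \<delta>"
      using M1 norm_triangle_ineq by (smt (verit))
    also have "\<dots> \<le> 3 / \<delta> + 2" using cd by simp
    also have "2 \<le> 2 / \<delta>" using d by (simp add: field_simps)
    finally show ?thesis by simp
  qed
  \<comment> \<open>The differences decrease, so the number of groups is at most their total drop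
    plus 2. The drop yields the term with \<open>N\<close> in the bound, the 2 yields
    \<open>10 / sqrt \<kappa>\<close>.\<close>
  define I where "I = (\<lambda>n. \<lfloor>g n\<rfloor>) ` {..<N}"
  have fI: "finite I" by (simp add: I_def)
  have "I \<subseteq> {\<lfloor>g (N - 1)\<rfloor>..\<lfloor>g 0\<rfloor>}"
    unfolding I_def using mono[of _ "N - 1"] mono[of 0] N by (auto intro!: floor_mono)
  then have "card I \<le> card {\<lfloor>g (N - 1)\<rfloor>..\<lfloor>g 0\<rfloor>}" by (intro card_mono) auto
  moreover have "\<lfloor>g (N - 1)\<rfloor> \<le> \<lfloor>g 0\<rfloor>" using mono[of 0 "N-1"] N by (auto intro!: floor_mono)
  ultimately have "real (card I) \<le> of_int (\<lfloor>g 0\<rfloor> - \<lfloor>g (N - 1)\<rfloor> + 1)" by simp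
  also have "\<dots> \<le> g 0 - g (N - 1) + 2" by linarith
  also have "\<dots> \<le> real (N - 1) * (A * \<kappa>) + 2" using gap[of 0 "N - 1"] N by simp
  also have "real (N - 1) * (A * \<kappa>) \<le> N * (A * \<kappa>)"
    using A lam by (intro mult_right_mono) auto
  finally have cI: "real (card I) \<le> N * (A * \<kappa>) + 2" by simp
  have "(\<Sum>n<N. ?e n) = (\<Sum>k\<in>I. \<Sum>n\<in>{n \<in> {..<N}. \<lfloor>g n\<rfloor> = k}. ?e n)"
    unfolding I_def by (rule sum.image_gen) simp
  also have "cmod \<dots> \<le> (\<Sum>k\<in>I. 5 / \<delta>)"
    by (rule order.trans[OF norm_sum]) (intro sum_mono block)
  also have "\<dots> = real (card I) * (5 / \<delta>)" by simp
  also have "\<dots> \<le> (N * (A * \<kappa>) + 2) * (5 / \<delta>)"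
    using cI d by (intro mult_right_mono) auto
  also have "\<dots> = 5 * A * N * \<delta> + 10 / \<delta>"
    using d by (simp add: field_simps d(3)[symmetric])
  finally show ?thesis by (simp add: \<delta>_def)
qed

section \<open>Sums of the sawtooth function\<close>

text \<open>The term for \<open>n = 0\<close> is \<open>1 / 0 = 0\<close>.\<close>

definition dilog_series :: "complex \<Rightarrow> complex" where
  "dilog_series z = (\<Sum>n. z ^ n / of_nat n ^ 2)"

lemma summable_inverse_squares: "summable (\<lambda>n. 1 / real n ^ 2)"
  using inverse_power_summable[of 2, where 'a = real] by (simp add: divide_inverse)

lemma norm_dilog_term: "cmod z \<le> 1 \<Longrightarrow> norm (z ^ n / of_nat n ^ 2) \<le> 1 / real n ^ 2"
  by (simp add: norm_divide norm_power power_le_one divide_right_mono)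

lemma dilog_sums: "cmod z \<le> 1 \<Longrightarrow> (\<lambda>n. z ^ n / of_nat n ^ 2) sums dilog_series z"
  unfolding dilog_series_def
  by (intro summable_sums summable_comparison_test'[OF summable_inverse_squares, of 0] norm_dilog_term)

text \<open>Convergence is uniform on the closed disc by comparison with the inverse squares.
  Continuity up to the boundary is what carries identities from the open disc to the unit
  circle.\<close>

lemma continuous_on_dilog: "continuous_on (cball 0 1) dilog_series"
proof (rule uniform_limit_theorem)
  show "uniform_limit (cball 0 1) (\<lambda>n z. \<Sum>i<n. z ^ i / of_nat i ^ 2) dilog_series sequentially"
    unfolding dilog_series_def
    by (rule Weierstrass_m_test[OF _ summable_inverse_squares]) (auto intro: norm_dilog_term)
  show "\<forall>\<^sub>F n in sequentially. continuous_on (cball 0 1) (\<lambda>z. \<Sum>i<n. z ^ i / (of_nat i :: complex) ^ 2)"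
  proof (intro always_eventually allI continuous_on_sum)
    fix n i :: nat
    show "continuous_on (cball 0 1) (\<lambda>z. z ^ i / (of_nat i :: complex) ^ 2)"
      unfolding divide_inverse by (intro continuous_intros)
  qed
qed auto

text \<open>Termwise differentiation leaves the series of z^(n-1) / n. Multiplying by
  \<open>z\<close> turns it into the logarithm series and avoids a special value at 0;
  differentiating along a circle produces exactly this factor \<open>z\<close>.\<close>

lemma dilog_deriv:
  assumes "cmod z < 1"
  obtains D where "(dilog_series has_field_derivative D) (at z)" "z * D = - Ln (1 - z)"
proof -
  define c :: "nat \<Rightarrow> complex" where "c n = 1 / of_nat n ^ 2" for n
  have F: "dilog_series = (\<lambda>z. \<Sum>n. c n * z ^ n)"
    by (auto simp: dilog_series_def c_def)
  have sm: "summable (\<lambda>n. c n * w ^ n)" if "norm w < 1" for w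
    using dilog_sums[of w] that by (auto simp: c_def sums_iff mult_ac)
  have d: "(dilog_series has_field_derivative (\<Sum>n. diffs c n * z ^ n)) (at z)"
    unfolding F using assms
    by (intro termdiffs_strong_converges_everywhere termdiffs_strong'[of 1] sm) auto
  have "(\<lambda>n. of_nat n * c n * z ^ (n - Suc 0)) sums (\<Sum>n. diffs c n * z ^ n)"
    by (intro diffs_equiv termdiff_converges[of _ 1] sm) (use assms in auto)
  then have "(\<lambda>n. z * (of_nat n * c n * z ^ (n - Suc 0))) sums (z * (\<Sum>n. diffs c n * z ^ n))"
    by (rule sums_mult)
  moreover have "z * (of_nat n * c n * z ^ (n - Suc 0)) = z ^ n / of_nat n" for n
    by (cases n) (auto simp: c_def power2_eq_square field_simps simp del: of_nat_Suc)
  ultimately have "(\<lambda>n. z ^ n / of_nat n) sums (z * (\<Sum>n. diffs c n * z ^ n))" by simp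
  moreover have "(\<lambda>n. z ^ n / of_nat n) sums (- Ln (1 - z))"
    using sums_minus[OF Ln_series'[of "- z"]] assms by simp
  ultimately have "z * (\<Sum>n. diffs c n * z ^ n) = - Ln (1 - z)" by (rule sums_unique2)
  with d show ?thesis using that by blast
qed

text \<open>In polar form the argument is 2 sin(pi t) at angle pi t - pi/2, which lies in the
  principal range for 0 < t < 1. This is where the sawtooth enters.\<close>

lemma Im_Ln_one_minus_cis:
  assumes "0 < t" "t < 1"
  shows "Im (Ln (1 - cis (2 * pi * t))) = pi * t - pi / 2"
proof -
  define s c where "s = sin (pi * t)" and "c = cos (pi * t)"
  have s: "s > 0" unfolding s_def using assms by (intro sin_gt_zero) auto
  have "sin (2 * pi * t) = 2 * s * c" "cos (2 * pi * t) = 1 - 2 * s\<^sup>2"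
    using sin_double[of "pi * t"] cos_double_sin[of "pi * t"] by (simp_all add: s_def c_def mult.assoc)
  then have eq: "1 - cis (2 * pi * t) = Complex (2 * s\<^sup>2) (- 2 * s * c)"
    by (simp add: complex_eq_iff)
  have "exp (Complex (ln (2 * s)) (pi * t - pi / 2)) = 1 - cis (2 * pi * t)"
    unfolding eq using s
    by (simp add: complex_eq_iff exp_eq_polar Re_exp Im_exp cos_diff sin_diff s_def[symmetric] c_def[symmetric] power2_eq_square)
  moreover have "pi * t < pi * 1" "pi * t > 0" using assms by (intro mult_strict_left_mono mult_pos_pos; simp)+
  then have "- pi < pi * t - pi / 2" "pi * t - pi / 2 \<le> pi" using pi_gt_zero by linarith+
  ultimately have "Ln (1 - cis (2 * pi * t)) = Complex (ln (2 * s)) (pi * t - pi / 2)"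
    by (intro Ln_unique) auto
  then show ?thesis by simp
qed

text \<open>The real part \<open>1 - r * cos \<theta>\<close> is positive, so the point avoids the
  branch cut and \<open>Ln\<close> is continuous there.\<close>

lemma one_minus_cis_not_nonpos:
  assumes "0 \<le> r" "r \<le> 1" "cos \<theta> < 1"
  shows "1 - of_real r * cis \<theta> \<notin> \<real>\<^sub>\<le>\<^sub>0"
proof -
  have "r * cos \<theta> < 1"
  proof (cases "cos \<theta> \<le> 0")
    case True
    then show ?thesis using assms by (smt (verit) mult_nonneg_nonpos)
  next
    case False
    then have "r * cos \<theta> \<le> 1 * cos \<theta>" using assms by (intro mult_right_mono) auto
    then show ?thesis using assms by simp
  qed
  then show ?thesis by (simp add: complex_nonpos_Reals_iff)
qed

text \<open>Inside the disc the derivative along a circle of radius \<open>r\<close> is explicit in terms of \<open>Ln\<close>; dominated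
  convergence lets \<open>r\<close> tend to 1.\<close>

lemma dilog_cis_diff_interior:
  assumes "0 < a" "a \<le> b" "b < 1"
  shows "Re (dilog_series (cis (2 * pi * b))) - pi\<^sup>2 * (b\<^sup>2 - b) = Re (dilog_series (cis (2 * pi * a))) - pi\<^sup>2 * (a\<^sup>2 - a)"
proof -
  define r where "r k = real (Suc k) / real (Suc (Suc k))" for k
  have r: "0 < r k" "r k < 1" for k by (auto simp: r_def)
  have rlim: "r \<longlonglongrightarrow> 1" unfolding r_def using LIMSEQ_n_over_Suc_n by (rule LIMSEQ_Suc)
  \<comment> \<open>The parabola has derivative 2 pi (pi t - pi/2), the limit of the derivative of
    the dilogarithm part as \<rho> tends to 1. Hence the derivative \<open>G'\<close> tends to 0
    pointwise.\<close>
  define G where "G \<rho> t = Re (dilog_series (of_real \<rho> * cis (2 * pi * t))) - pi\<^sup>2 * (t\<^sup>2 - t)" for \<rho> t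
  define G' where "G' k t = 2 * pi * (Im (Ln (1 - of_real (r k) * cis (2 * pi * t))) - (pi * t - pi / 2))" for k t
  have der: "((\<lambda>t. G (r k) t) has_vector_derivative G' k t) (at t within {a..b})" for k t
  proof -
    let ?z = "of_real (r k) * cis (2 * pi * t)"
    have n: "cmod ?z < 1" using r[of k] by (simp add: norm_mult)
    obtain D where D: "(dilog_series has_field_derivative D) (at ?z)" "?z * D = - Ln (1 - ?z)"
      using dilog_deriv[OF n] by blast
    have cisd: "((\<lambda>t. of_real (r k) * cis (2 * pi * t)) has_vector_derivative (?z * (2 * pi * \<i>))) (at t)"
    proof -
      have "((\<lambda>w. of_real (r k) * exp (\<i> * (2 * of_real pi * w))) has_field_derivative (?z * (2 * pi * \<i>))) (at (of_real t))"
      proof -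
        have "((\<lambda>w. of_real (r k) * exp (\<i> * (2 * of_real pi * w))) has_field_derivative
            of_real (r k) * (exp (\<i> * (2 * of_real pi * of_real t)) * (\<i> * (2 * of_real pi * 1)))) (at (of_real t))"
          by (intro DERIV_cmult DERIV_fun_exp DERIV_ident)
        then show ?thesis by (simp add: cis_conv_exp mult_ac)
      qed
      from has_vector_derivative_real_field[OF this] show ?thesis
        by (simp add: cis_conv_exp)
    qed
    have "((dilog_series \<circ> (\<lambda>t. of_real (r k) * cis (2 * pi * t))) has_vector_derivative (?z * (2 * pi * \<i>) * D)) (at t)"
      by (rule field_vector_diff_chain_at[OF cisd D(1)])
    moreover have "?z * (2 * pi * \<i>) * D = - Ln (1 - ?z) * (2 * pi * \<i>)"
    proof -
      have "?z * (2 * pi * \<i>) * D = (?z * D) * (2 * pi * \<i>)" by (simp only: mult_ac)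
      then show ?thesis by (simp only: D(2))
    qed
    ultimately have "((\<lambda>t. dilog_series (of_real (r k) * cis (2 * pi * t))) has_vector_derivative (- Ln (1 - ?z) * (2 * pi * \<i>))) (at t)"
      by (simp only: o_def)
    then have "((\<lambda>t. Re (dilog_series (of_real (r k) * cis (2 * pi * t)))) has_vector_derivative Re (- Ln (1 - ?z) * (2 * pi * \<i>))) (at t)"
      by (intro bounded_linear.has_vector_derivative[OF bounded_linear_Re])
    moreover have "((\<lambda>t. pi\<^sup>2 * (t\<^sup>2 - t)) has_vector_derivative pi\<^sup>2 * (2 * t - 1)) (at t)"
      unfolding has_real_derivative_iff_has_vector_derivative[symmetric]
      by (auto intro!: derivative_eq_intros)
    ultimately have "((\<lambda>t. G (r k) t) has_vector_derivative Re (- Ln (1 - ?z) * (2 * pi * \<i>)) - pi\<^sup>2 * (2 * t - 1)) (at t)"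
      unfolding G_def by (rule has_vector_derivative_diff)
    moreover have "Re (- Ln (1 - ?z) * (2 * pi * \<i>)) - pi\<^sup>2 * (2 * t - 1) = G' k t"
      by (simp add: G'_def power2_eq_square algebra_simps)
    ultimately show ?thesis by (simp add: has_vector_derivative_at_within)
  qed
  have int: "(G' k has_integral (G (r k) b - G (r k) a)) {a..b}" for k
    by (rule fundamental_theorem_of_calculus[OF assms(2)]) (rule der)
  have "(\<lambda>k. integral {a..b} (G' k)) \<longlonglongrightarrow> integral {a..b} (\<lambda>t. 0)"
  proof (rule dominated_convergence(2))
    show "G' k integrable_on {a..b}" for k using int by blast
    show "(\<lambda>t. 2 * pi * (3 * pi)) integrable_on {a..b}" by (intro integrable_continuous_interval continuous_intros)
    fix t assume t: "t \<in> {a..b}"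
    then have t01: "0 < t" "t < 1" using assms by auto
    have "pi * t < pi * 1" "pi * t > 0" using t01 by (intro mult_strict_left_mono mult_pos_pos; simp)+
    moreover have *: "\<bar>Im (Ln (1 - of_real (r k) * cis (2 * pi * t)))\<bar> \<le> pi" for k
    proof -
      have "cmod (of_real (r k) * cis (2 * pi * t)) < 1" using r[of k] by (simp add: norm_mult)
      then have "1 - of_real (r k) * cis (2 * pi * t) \<noteq> 0" by (metis eq_iff_diff_eq_0 norm_one order_less_irrefl)
      from Im_Ln_le_pi[OF this] mpi_less_Im_Ln[OF this] show ?thesis by linarith
    qed
    ultimately have "\<bar>Im (Ln (1 - of_real (r k) * cis (2 * pi * t))) - (pi * t - pi / 2)\<bar> \<le> 3 * pi" for k
      using *[of k] pi_gt_zero by linarith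
    then show "norm (G' k t) \<le> 2 * pi * (3 * pi)" for k
      by (simp add: G'_def abs_mult)
    have "cos (2 * pi * t) < 1"
    proof -
      have "sin (pi * t) > 0" using t01 by (intro sin_gt_zero) auto
      then show ?thesis using cos_double_sin[of "pi * t"] by (simp add: mult.assoc)
    qed
    then have "1 - of_real 1 * cis (2 * pi * t) \<notin> \<real>\<^sub>\<le>\<^sub>0" by (intro one_minus_cis_not_nonpos) auto
    then have "(\<lambda>k. G' k t) \<longlonglongrightarrow> 2 * pi * (Im (Ln (1 - of_real 1 * cis (2 * pi * t))) - (pi * t - pi / 2))"
      unfolding G'_def by (intro tendsto_intros rlim)
    then show "(\<lambda>k. G' k t) \<longlonglongrightarrow> 0" using Im_Ln_one_minus_cis[OF t01] by simp
  qed
  then have "(\<lambda>k. G (r k) b - G (r k) a) \<longlonglongrightarrow> 0"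
    by (simp add: integral_unique[OF int])
  moreover have "(\<lambda>k. G (r k) t) \<longlonglongrightarrow> G 1 t" for t
  proof -
    have "(\<lambda>k. dilog_series (of_real (r k) * cis (2 * pi * t))) \<longlonglongrightarrow> dilog_series (of_real 1 * cis (2 * pi * t))"
    proof (rule continuous_on_tendsto_compose[OF continuous_on_dilog])
      show "(\<lambda>k. of_real (r k) * cis (2 * pi * t)) \<longlonglongrightarrow> of_real 1 * cis (2 * pi * t)"
        by (intro tendsto_intros rlim)
    qed (use r in \<open>auto simp: norm_mult less_imp_le\<close>)
    then show ?thesis unfolding G_def by (intro tendsto_intros)
  qed
  then have "(\<lambda>k. G (r k) b - G (r k) a) \<longlonglongrightarrow> G 1 b - G 1 a" by (intro tendsto_intros)
  ultimately have "G 1 b - G 1 a = 0" by (metis LIMSEQ_unique)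
  then show ?thesis by (simp add: G_def)
qed

text \<open>At \<open>t = 0\<close> and \<open>t = 1\<close> the logarithm is singular. The
  endpoints are reached by continuity: a continuous function constant on an open interval is
  constant on its closure.\<close>

lemma dilog_cis_diff:
  assumes "0 \<le> a" "a \<le> 1" "0 \<le> b" "b \<le> 1"
  shows "Re (dilog_series (cis (2 * pi * b))) - pi\<^sup>2 * (b\<^sup>2 - b) = Re (dilog_series (cis (2 * pi * a))) - pi\<^sup>2 * (a\<^sup>2 - a)"
proof -
  let ?g = "\<lambda>t. Re (dilog_series (cis (2 * pi * t))) - pi\<^sup>2 * (t\<^sup>2 - t)"
  have cont: "continuous_on UNIV ?g"
    by (intro continuous_intros continuous_on_compose2[OF continuous_on_dilog]) auto
  have "?g t = ?g (1/2)" if "t \<in> {0<..<1}" for t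
    using that dilog_cis_diff_interior[of t "1/2"] dilog_cis_diff_interior[of "1/2" t] by (cases "t \<le> 1/2") auto
  then have *: "?g t = ?g (1/2)" if "t \<in> {0..1}" for t
    using continuous_constant_on_closure[of "{0<..<1}" ?g "?g (1/2)" t] that
      continuous_on_subset[OF cont] by auto
  show ?thesis using *[of a] *[of b] assms by simp
qed

text \<open>Up to an additive constant this is half the periodised second Bernoulli polynomial,
  an antiderivative of the sawtooth \<open>frac t - 1/2\<close>.\<close>

definition sawtooth_primitive :: "real \<Rightarrow> real" where
  "sawtooth_primitive t = ((frac t)\<^sup>2 - frac t) / 2"

lemma cis_frac: "cis (2 * pi * frac t) = cis (2 * pi * t)"
  unfolding frac_def by (rule cis_minus_int)

text \<open>Stating the expansion for a difference of two values cancels the constant Fourier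
  coefficient, so the sum of the inverse squares never has to be evaluated.\<close>

lemma sawtooth_primitive_fourier:
  "(\<lambda>h. Re (cis (2 * pi * (real h * s)) - cis (2 * pi * (real h * t))) / (real h)\<^sup>2)
     sums (2 * pi\<^sup>2 * (sawtooth_primitive s - sawtooth_primitive t))"
proof -
  have *: "(\<lambda>h. Re (cis (2 * pi * (real h * t))) / (real h)\<^sup>2) sums Re (dilog_series (cis (2 * pi * t)))" for t
  proof -
    have "(\<lambda>n. Re (cis (2 * pi * t) ^ n / of_nat n ^ 2)) sums Re (dilog_series (cis (2 * pi * t)))"
      by (intro sums_Re dilog_sums) simp
    moreover have "Re (cis (2 * pi * t) ^ n / of_nat n ^ 2) = Re (cis (2 * pi * (real n * t))) / (real n)\<^sup>2" for n
    proof -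
      have "Re (cis (2 * pi * t) ^ n / of_nat n ^ 2) = Re (cis (2 * pi * t) ^ n / of_real ((real n)^2))" by simp
      also have "\<dots> = Re (cis (2 * pi * t) ^ n) / (real n)\<^sup>2" by (rule Re_divide_of_real)
      finally show ?thesis by (simp add: Complex.DeMoivre mult_ac)
    qed
    ultimately show ?thesis by simp
  qed
  have "Re (dilog_series (cis (2 * pi * s))) - Re (dilog_series (cis (2 * pi * t)))
      = 2 * pi\<^sup>2 * (sawtooth_primitive s - sawtooth_primitive t)"
  proof -
    have "frac t \<le> 1" "frac s \<le> 1" using frac_lt_1 less_imp_le by blast+
    from dilog_cis_diff[OF frac_ge_0 this(1) frac_ge_0 this(2), unfolded cis_frac] show ?thesis
      by (simp add: sawtooth_primitive_def right_diff_distrib diff_divide_distrib)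
  qed
  then show ?thesis using sums_diff[OF *[of s] *[of t]] by (simp add: diff_divide_distrib)
qed

text \<open>Between integers the primitive is a parabola with second derivative 1, so its mean slope
  over a step \<open>v\<close> differs from \<open>frac t - 1/2\<close> by v/2. If the step crosses
  an integer, the downward jump of the sawtooth changes the difference in the favourable direction
  of each one-sided bound.\<close>

lemma sawtooth_primitive_diff_le:
  assumes "0 \<le> v" "v \<le> 1"
  shows "sawtooth_primitive (t + v) - sawtooth_primitive t \<le> v * (frac t - 1/2 + v)"
    and "v * (frac t - 1/2 - v) \<le> sawtooth_primitive t - sawtooth_primitive (t - v)"
proof -
  define s where "s = frac t"
  have s: "0 \<le> s" "s < 1" unfolding s_def by (simp_all add: frac_lt_1)
  have "frac (t + v) = s + v \<or> frac (t + v) = s + v - 1 \<and> s + v \<ge> 1"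
  \<comment> \<open>At \<open>v = 1\<close> the value of \<open>frac v\<close> is 0 and not
    \<open>v\<close>, so this case is separate.\<close>
  proof (cases "v = 1")
    case False
    then have "frac v = v" using assms by (simp add: frac_eq)
    then show ?thesis using frac_add[of t v] by (auto simp: s_def)
  next
    case True
    then have "frac (t + v) = s" unfolding s_def by (metis frac_1_eq)
    then show ?thesis using True s by simp
  qed
  then show "sawtooth_primitive (t + v) - sawtooth_primitive t \<le> v * (frac t - 1/2 + v)"
  proof (elim disjE conjE)
    assume e: "frac (t + v) = s + v"
    show ?thesis unfolding sawtooth_primitive_def e s_def[symmetric]
      by (simp add: power2_eq_square field_simps)
  next
    assume e: "frac (t + v) = s + v - 1" and ge: "s + v \<ge> 1"
    have "((s + v - 1)\<^sup>2 - (s + v - 1)) / 2 - (s\<^sup>2 - s) / 2 = v * (s - 1/2 + v) - v * v / 2 - (s + v - 1)"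
      by (simp add: power2_eq_square field_simps)
    then show ?thesis unfolding sawtooth_primitive_def e s_def[symmetric]
      using ge zero_le_square[of v] by linarith
  qed
  have "frac (t - v) = s - v \<or> frac (t - v) = s - v + 1 \<and> s - v \<le> 0"
  proof (cases "v \<le> s")
    case True
    then have "frac (t - v) = s - v" unfolding s_def using assms s frac_unique_iff[of "t - v" "frac t - v"]
      by (auto simp: frac_def s_def)
    then show ?thesis by simp
  next
    case False
    moreover have "t - v - (s - v + 1) \<in> \<int>" by (simp add: s_def frac_def)
    ultimately have "frac (t - v) = s - v + 1" using assms s
      by (subst frac_unique_iff) auto
    then show ?thesis using False by simp
  qed
  then show "v * (frac t - 1/2 - v) \<le> sawtooth_primitive t - sawtooth_primitive (t - v)"
  proof (elim disjE conjE)
    assume e: "frac (t - v) = s - v"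
    show ?thesis unfolding sawtooth_primitive_def e s_def[symmetric]
      by (simp add: power2_eq_square field_simps)
  next
    assume e: "frac (t - v) = s - v + 1" and ge: "s - v \<le> 0"
    have "(s\<^sup>2 - s) / 2 - ((s - v + 1)\<^sup>2 - (s - v + 1)) / 2 = v * (s - 1/2 - v) + v * v / 2 - (s - v)"
      by (simp add: power2_eq_square field_simps)
    then show ?thesis unfolding sawtooth_primitive_def e s_def[symmetric]
      using ge zero_le_square[of v] by linarith
  qed
qed

section \<open>From exponential sums to sawtooth sums\<close>

lemma cmod_cis_minus_one_le: "cmod (cis t - 1) \<le> \<bar>t\<bar>"
  using dist_exp_i_1[of t] abs_sin_x_le_abs_x[of "t / 2"] by (simp add: cis_conv_exp dist_norm)

text \<open>Telescoping forms of the integral comparisons for h^(-1/2) and h^(-3/2). Both rest on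
  \<open>(b - a) * (b + a) = 1\<close> for consecutive square roots.\<close>

lemma inverse_sqrt_steps:
  shows "1 / sqrt (real (Suc n)) \<le> 2 * sqrt (real (Suc n)) - 2 * sqrt (real n)"
    and "n \<ge> 1 \<Longrightarrow> 1 / (real (Suc n) * sqrt (real (Suc n))) \<le> 2 / sqrt (real n) - 2 / sqrt (real (Suc n))"
proof -
  define a b where "a = sqrt (real n)" and "b = sqrt (real (Suc n))"
  have ab: "a \<ge> 0" "a \<le> b" "b > 0" "b * b - a * a = 1" "real (Suc n) = b * b"
    by (auto simp: a_def b_def)
  have d: "(b - a) * (b + a) = 1" using ab by (simp add: algebra_simps)
  have "1 \<le> (b - a) * (2 * b)" unfolding d[symmetric] using ab by (intro mult_left_mono) auto
  then have *: "1 / b \<le> 2 * (b - a)" using ab by (simp add: field_simps)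
  then show "1 / sqrt (real (Suc n)) \<le> 2 * sqrt (real (Suc n)) - 2 * sqrt (real n)"
    by (simp add: a_def b_def)
  assume "n \<ge> 1"
  then have a: "a > 0" by (simp add: a_def)
  have "1 / (b * b * b) = 1 / b / (b * b)" by simp
  also have "\<dots> \<le> 2 * (b - a) / (b * b)" using * by (intro divide_right_mono) auto
  also have "\<dots> \<le> 2 * (b - a) / (a * b)" using a ab by (intro divide_left_mono mult_right_mono mult_pos_pos) auto
  also have "\<dots> = 2 / a - 2 / b" using a ab by (simp add: field_simps)
  finally show "1 / (real (Suc n) * sqrt (real (Suc n))) \<le> 2 / sqrt (real n) - 2 / sqrt (real (Suc n))"
    unfolding ab(5) by (simp add: a_def b_def)
qed

text \<open>The sum is split at \<open>L\<close>. Up to \<open>L\<close> the weight h / L leaves a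
  sum of h^(-1/2), at most 2 / sqrt L after division by \<open>L\<close>; beyond \<open>L\<close>
  the tail of h^(-3/2) is again at most 2 / sqrt L.\<close>

lemma sum_min_powr_3_2:
  assumes "L \<ge> 1"
  shows "(\<Sum>h=1..H. min 1 (real h / real L) * (1 / (real h * sqrt (real h)))) \<le> 4 / sqrt (real L)"
proof -
  let ?f = "\<lambda>h. min 1 (real h / real L) * (1 / (real h * sqrt (real h)))"
  have small: "(\<Sum>h=1..H. ?f h) \<le> 2 * sqrt H / L" for H
  proof (induction H)
    case (Suc H)
    have "?f (Suc H) \<le> real (Suc H) / L * (1 / (real (Suc H) * sqrt (real (Suc H))))"
      by (intro mult_right_mono) auto
    also have "\<dots> = 1 / sqrt (real (Suc H)) / L" by (simp del: of_nat_Suc)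
    also have "\<dots> \<le> (2 * sqrt (real (Suc H)) - 2 * sqrt (real H)) / L"
      by (intro divide_right_mono inverse_sqrt_steps) auto
    finally have "?f (Suc H) \<le> 2 * sqrt (real (Suc H)) / L - 2 * sqrt (real H) / L"
      by (simp only: diff_divide_distrib)
    then show ?case using Suc by simp
  qed simp
  have sL: "2 * sqrt L / L = 2 / sqrt L" using assms by (simp add: field_simps)
  have large: "(\<Sum>h=1..H. ?f h) \<le> 4 / sqrt L - 2 / sqrt H" if "H \<ge> L" for H
    using that
  proof (induction H rule: dec_induct)
    case base
    show ?case using small[of L] sL by simp
  next
    case (step H)
    have "?f (Suc H) \<le> 1 * (1 / (real (Suc H) * sqrt (real (Suc H))))"
      by (intro mult_right_mono) auto
    also have "\<dots> \<le> 2 / sqrt (real H) - 2 / sqrt (real (Suc H))"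
      using inverse_sqrt_steps(2)[of H] step assms by simp
    finally show ?case using step.IH by simp
  qed
  show ?thesis
  proof (cases "H \<ge> L")
    case True
    have "0 \<le> 2 / sqrt (real H)" by simp
    then show ?thesis using large[OF True] by linarith
  next
    case False
    then have "2 * sqrt H / L \<le> 2 * sqrt L / L" by (intro divide_right_mono) auto
    then have "(\<Sum>h=1..H. ?f h) \<le> 2 / sqrt L" using small[of H] sL by linarith
    also have "\<dots> \<le> 4 / sqrt L" by (intro divide_right_mono) auto
    finally show ?thesis .
  qed
qed

lemma sum_inverse_3_2: "(\<Sum>h=1..H. 1 / (real h * sqrt (real h))) \<le> 3"
proof (cases "H \<ge> 1")
  case True
  then have "(\<Sum>h=1..H. 1 / (real h * sqrt (real h))) \<le> 3 - 2 / sqrt H"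
  proof (induction H rule: dec_induct)
    case (step H)
    then show ?case using inverse_sqrt_steps(2)[of H] by simp
  qed simp
  also have "\<dots> \<le> 3" by simp
  finally show ?thesis .
qed simp

text \<open>In the Fourier series, shifting by \<open>v\<close> multiplies the \<open>h\<close>-th
  exponential sum by \<open>cis (2 * pi * (h * v)) - 1\<close>, of order min(1, h / L). This factor
  against the coefficient h^(-2) makes the sum over \<open>h\<close> converge and saves a power of
  \<open>L\<close>.\<close>

lemma sum_sawtooth_primitive_diff:
  fixes u :: "nat \<Rightarrow> real"
  assumes E: "\<And>h. h \<ge> 1 \<Longrightarrow> cmod (\<Sum>n<N. cis (2 * pi * (real h * u n))) \<le> P * sqrt h + Q / sqrt h"
    and PQ: "P \<ge> 0" "Q \<ge> 0" and L: "L \<ge> 1" and v: "\<bar>v\<bar> = 1 / real L"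
  shows "\<bar>\<Sum>n<N. sawtooth_primitive (u n + v) - sawtooth_primitive (u n)\<bar> \<le> (2 * P * sqrt L + Q) / L"
proof -
  let ?S = "\<lambda>h. \<Sum>n<N. cis (2 * pi * (real h * u n))"
  let ?t = "\<lambda>h. \<Sum>n<N. Re (cis (2 * pi * (real h * (u n + v))) - cis (2 * pi * (real h * u n))) / (real h)\<^sup>2"
  have sums: "?t sums (\<Sum>n<N. 2 * pi\<^sup>2 * (sawtooth_primitive (u n + v) - sawtooth_primitive (u n)))"
    by (intro sums_sum sawtooth_primitive_fourier)
  have tb: "\<bar>?t h\<bar> \<le> 2 * pi * (P * (min 1 (real h / real L) * (1 / (real h * sqrt (real h)))) + Q / L * (1 / (real h * sqrt (real h))))"
    if h: "h \<ge> 1" for h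
  proof -
    have "?t h = Re (\<Sum>n<N. (cis (2 * pi * (real h * (u n + v))) - cis (2 * pi * (real h * u n)))) / (real h)\<^sup>2"
      by (simp add: sum_divide_distrib)
    also have "(\<Sum>n<N. (cis (2 * pi * (real h * (u n + v))) - cis (2 * pi * (real h * u n)))) = (cis (2 * pi * (h * v)) - 1) * ?S h"
      by (simp add: sum_distrib_left algebra_simps cis_mult)
    finally have "\<bar>?t h\<bar> = \<bar>Re ((cis (2 * pi * (h * v)) - 1) * ?S h)\<bar> / (real h)\<^sup>2"
      by (simp only: abs_divide abs_power2)
    also have "\<dots> \<le> cmod ((cis (2 * pi * (h * v)) - 1) * ?S h) / (real h)\<^sup>2"
      by (intro divide_right_mono abs_Re_le_cmod) auto
    also have "\<dots> = cmod (cis (2 * pi * (h * v)) - 1) * cmod (?S h) / (real h)\<^sup>2"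
      by (simp add: norm_mult)
    also have "\<dots> \<le> (2 * pi * min 1 (h / L)) * (P * sqrt h + Q / sqrt h) / (real h)\<^sup>2"
    proof (intro divide_right_mono mult_mono E h)
      have "cmod (cis (2 * pi * (h * v)) - 1) \<le> \<bar>2 * pi * (h * v)\<bar>"
        by (rule cmod_cis_minus_one_le)
      moreover have "\<bar>2 * pi * (h * v)\<bar> = 2 * pi * (h / L)" using v by (simp add: abs_mult)
      moreover have "cmod (cis (2 * pi * (h * v)) - 1) \<le> 2"
        using norm_triangle_ineq4[of "cis (2 * pi * (h * v))" 1] by simp
      moreover have "2 \<le> 2 * pi * 1" using pi_ge_two by simp
      ultimately show "cmod (cis (2 * pi * (h * v)) - 1) \<le> 2 * pi * min 1 (h / L)"
        by (auto simp: min_def)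
    qed (use PQ in auto)
    also have "\<dots> = 2 * pi * (P * (min 1 (h / L) * (1 / (real h * sqrt (real h)))) + Q * (min 1 (h / L) * (1 / ((real h)\<^sup>2 * sqrt (real h)))))"
    proof -
      have "sqrt h / (real h)\<^sup>2 = 1 / (real h * sqrt (real h))"
      proof -
        have "sqrt h / (real h)\<^sup>2 = sqrt h / (real h * (sqrt h * sqrt h))" by (simp add: power2_eq_square)
        also have "\<dots> = 1 / (real h * sqrt (real h))" using h by (simp del: real_sqrt_mult_self)
        finally show ?thesis .
      qed
      moreover have "(P * sqrt h + Q / sqrt h) / (real h)\<^sup>2 = P * (sqrt h / (real h)\<^sup>2) + Q * (1 / ((real h)\<^sup>2 * sqrt (real h)))"
        using h by (simp add: add_divide_distrib mult_ac)
      moreover have "(2 * pi * min 1 (h / L)) * (P * sqrt h + Q / sqrt h) / (real h)\<^sup>2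
          = 2 * pi * min 1 (h / L) * ((P * sqrt h + Q / sqrt h) / (real h)\<^sup>2)" by simp
      ultimately show ?thesis by (simp only: distrib_left mult_ac)
    qed
    \<comment> \<open>For the part with \<open>Q\<close> the bound h / L on the minimum is enough:
      it cancels one factor h and leaves the convergent sum of h^(-3/2).\<close>
    also have "\<dots> \<le> 2 * pi * (P * (min 1 (h / L) * (1 / (real h * sqrt (real h)))) + Q * (1 / L * (1 / (real h * sqrt (real h)))))"
    proof -
      have "min 1 (h / L) * (1 / ((real h)\<^sup>2 * sqrt (real h))) \<le> (h / L) * (1 / ((real h)\<^sup>2 * sqrt (real h)))"
        by (intro mult_right_mono) auto
      also have "\<dots> = 1 / L * (1 / (real h * sqrt (real h)))" using h by (simp add: power2_eq_square)
      finally show ?thesis using PQ by (intro mult_left_mono add_mono order.refl) auto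
    qed
    finally show ?thesis by simp
  qed
  have partial: "\<bar>\<Sum>h<H. ?t h\<bar> \<le> 2 * pi * (P * (4 / sqrt L) + Q / L * 3)" for H
  proof -
    have "\<bar>\<Sum>h<H. ?t h\<bar> \<le> (\<Sum>h<H. \<bar>?t h\<bar>)" by (rule sum_abs)
    also have "\<dots> \<le> (\<Sum>h\<in>{1..H}. \<bar>?t h\<bar>)"
    proof -
      have "(\<Sum>h<H. \<bar>?t h\<bar>) = (\<Sum>h\<in>{..<H} - {0}. \<bar>?t h\<bar>)"
        by (intro sum.mono_neutral_right) auto
      also have "\<dots> \<le> (\<Sum>h\<in>{1..H}. \<bar>?t h\<bar>)" by (intro sum_mono2) auto
      finally show ?thesis .
    qed
    also have "\<dots> \<le> (\<Sum>h\<in>{1..H}. 2 * pi * (P * (min 1 (real h / real L) * (1 / (real h * sqrt (real h)))) + Q / L * (1 / (real h * sqrt (real h)))))"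
      by (intro sum_mono tb) auto
    also have "\<dots> = 2 * pi * (P * (\<Sum>h=1..H. min 1 (real h / real L) * (1 / (real h * sqrt (real h)))) + Q / L * (\<Sum>h=1..H. 1 / (real h * sqrt (real h))))"
      by (simp only: sum.distrib sum_distrib_left[symmetric])
    also have "\<dots> \<le> 2 * pi * (P * (4 / sqrt L) + Q / L * 3)"
      using PQ by (intro mult_left_mono add_mono sum_min_powr_3_2 sum_inverse_3_2 L) auto
    finally show ?thesis .
  qed
  have "\<bar>\<Sum>n<N. 2 * pi\<^sup>2 * (sawtooth_primitive (u n + v) - sawtooth_primitive (u n))\<bar> \<le> 2 * pi * (P * (4 / sqrt L) + Q / L * 3)"
    using sums partial unfolding sums_def
    by (intro LIMSEQ_le_const2[OF tendsto_rabs]) auto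
  moreover have "(\<Sum>n<N. 2 * pi\<^sup>2 * (sawtooth_primitive (u n + v) - sawtooth_primitive (u n)))
      = (2 * pi) * (pi * (\<Sum>n<N. sawtooth_primitive (u n + v) - sawtooth_primitive (u n)))"
    by (simp only: sum_distrib_left power2_eq_square mult.assoc)
  ultimately have "2 * pi * (pi * \<bar>\<Sum>n<N. sawtooth_primitive (u n + v) - sawtooth_primitive (u n)\<bar>) \<le> 2 * pi * (P * (4 / sqrt L) + Q / L * 3)"
    by (simp only: abs_mult)
  then have "pi * \<bar>\<Sum>n<N. sawtooth_primitive (u n + v) - sawtooth_primitive (u n)\<bar> \<le> P * (4 / sqrt L) + Q / L * 3"
    by (subst (asm) mult_le_cancel_left_pos) auto
  \<comment> \<open>The bounds \<open>pi \<ge> 2\<close> and \<open>pi > 3\<close> absorb the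
    numerical constants 4 and 3.\<close>
  also have "\<dots> \<le> pi * (2 * (P / sqrt L) + Q / L)"
  proof -
    have "P * (4 / sqrt L) = 2 * (2 * (P / sqrt L))" by simp
    also have "\<dots> \<le> pi * (2 * (P / sqrt L))"
      using PQ pi_ge_two by (intro mult_right_mono) auto
    finally have 1: "P * (4 / sqrt L) \<le> pi * (2 * (P / sqrt L))" .
    have "Q / L * 3 = 3 * (Q / L)" by simp
    also have "\<dots> \<le> pi * (Q / L)" using PQ pi_gt3 by (intro mult_right_mono) auto
    finally show ?thesis using 1 by (simp add: distrib_left)
  qed
  finally have "\<bar>\<Sum>n<N. sawtooth_primitive (u n + v) - sawtooth_primitive (u n)\<bar> \<le> 2 * (P / sqrt L) + Q / L"
    by (subst (asm) mult_le_cancel_left_pos) auto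
  also have "P / sqrt L = P * sqrt L / L" using L by (simp add: field_simps)
  finally show ?thesis by (simp add: add_divide_distrib)
qed

text \<open>Difference quotients of the primitive with step 1 / L bracket the sawtooth up to 1 / L
  in each of the \<open>N\<close> terms. Dividing by the step cancels the denominator
  \<open>L\<close> of the preceding bound; \<open>L\<close> remains free for optimisation.\<close>

lemma sum_sawtooth_le:
  fixes u :: "nat \<Rightarrow> real" and L :: nat
  assumes E: "\<And>h. h \<ge> 1 \<Longrightarrow> cmod (\<Sum>n<N. cis (2 * pi * (real h * u n))) \<le> P * sqrt h + Q / sqrt h"
    and PQ: "P \<ge> 0" "Q \<ge> 0" and L: "L \<ge> 1"
  shows "\<bar>\<Sum>n<N. frac (u n) - 1/2\<bar> \<le> N / L + 2 * P * sqrt L + Q"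
proof -
  define v where "v = 1 / real L"
  have v: "v > 0" "v \<le> 1" "\<bar>v\<bar> = 1 / L" "\<bar>-v\<bar> = 1 / L" using L by (auto simp: v_def)
  define Y where "Y = (\<Sum>n<N. frac (u n) - 1/2)"
  define W where "W = (2 * P * sqrt L + Q) / L"
  have "- W \<le> (\<Sum>n<N. sawtooth_primitive (u n + v) - sawtooth_primitive (u n))"
    using sum_sawtooth_primitive_diff[OF E PQ L v(3)] by (simp add: W_def abs_le_iff)
  also have "\<dots> \<le> (\<Sum>n<N. v * (frac (u n) - 1/2 + v))"
    using v by (intro sum_mono sawtooth_primitive_diff_le) auto
  also have "\<dots> = v * (Y + N * v)"
    by (simp add: sum_distrib_left[symmetric] sum.distrib Y_def sum_subtractf algebra_simps)
  finally have 1: "- W \<le> v * (Y + N * v)" .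
  have "v * (Y - N * v) = (\<Sum>n<N. v * (frac (u n) - 1/2 - v))"
    by (simp add: sum_distrib_left[symmetric] sum.distrib Y_def sum_subtractf algebra_simps)
  also have "\<dots> \<le> (\<Sum>n<N. sawtooth_primitive (u n) - sawtooth_primitive (u n - v))"
    using v by (intro sum_mono sawtooth_primitive_diff_le) auto
  also have "\<dots> = - (\<Sum>n<N. sawtooth_primitive (u n + - v) - sawtooth_primitive (u n))"
    by (simp add: sum_negf[symmetric] del: sum_subtractf)
  also have "\<dots> \<le> W"
    using sum_sawtooth_primitive_diff[OF E PQ L v(4)] unfolding W_def by (simp only: abs_le_iff)
  finally have 2: "v * (Y - N * v) \<le> W" .
  have W: "W = v * (2 * P * sqrt L + Q)" by (simp add: W_def v_def)
  have "v * (- (2 * P * sqrt L + Q)) \<le> v * (Y + N * v)" "v * (Y - N * v) \<le> v * (2 * P * sqrt L + Q)"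
    using 1 2 unfolding W by (simp_all only: mult_minus_right)
  then have "- (2 * P * sqrt L + Q) \<le> Y + N * v" "Y - N * v \<le> 2 * P * sqrt L + Q"
    using v(1) by (simp_all only: mult_le_cancel_left_pos)
  then show ?thesis unfolding Y_def[symmetric] v_def by (simp add: abs_le_iff)
qed

text \<open>The second difference test with \<kappa> = h / \<rho>^3 gives P of order A N
  \<rho>^(-3/2) and Q of order \<rho>^(3/2). Taking \<open>L\<close> as \<rho> rounded up makes N /
  L and P sqrt L both of order N / \<rho>, up to the factor \<open>A\<close>. The constant is 21 = 1
  + 20.\<close>

theorem van_der_corput_sawtooth:
  fixes u :: "nat \<Rightarrow> real"
  assumes rho: "\<rho> \<ge> 1" and A: "A \<ge> 1"
    and lb: "\<And>n. Suc n < N \<Longrightarrow> 1 / \<rho> ^ 3 \<le> (u (Suc n) - u n) - (u (Suc (Suc n)) - u (Suc n))"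
    and ub: "\<And>n. Suc n < N \<Longrightarrow> (u (Suc n) - u n) - (u (Suc (Suc n)) - u (Suc n)) \<le> A / \<rho> ^ 3"
  shows "\<bar>\<Sum>n<N. frac (u n) - 1/2\<bar> \<le> 21 * A * N / \<rho> + 10 * \<rho>\<^sup>2"
proof -
  define s where "s = sqrt (\<rho> ^ 3)"
  have s: "s > 0" "sqrt (1 / \<rho> ^ 3) = 1 / s" using rho by (auto simp: s_def real_sqrt_divide)
  have E: "cmod (\<Sum>n<N. cis (2 * pi * (real h * u n))) \<le> (5 * A * N / s) * sqrt h + 10 * s / sqrt h" if h: "h \<ge> 1" for h :: nat
  proof -
    have "cmod (\<Sum>n<N. cis (2 * pi * (real h * u n))) \<le> 5 * A * N * sqrt (h * (1 / \<rho> ^ 3)) + 10 / sqrt (h * (1 / \<rho> ^ 3))"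
    proof (rule second_difference_test[OF _ A])
      show "0 < h * (1 / \<rho> ^ 3)" using h rho by auto
      fix n assume n: "Suc n < N"
      have e: "real h * u (Suc n) - real h * u n - (real h * u (Suc (Suc n)) - real h * u (Suc n)) =
         real h * ((u (Suc n) - u n) - (u (Suc (Suc n)) - u (Suc n)))" by (simp add: algebra_simps)
      show "h * (1 / \<rho> ^ 3) \<le> real h * u (Suc n) - real h * u n - (real h * u (Suc (Suc n)) - real h * u (Suc n))"
        unfolding e by (intro mult_left_mono lb n) auto
      have "real h * ((u (Suc n) - u n) - (u (Suc (Suc n)) - u (Suc n))) \<le> real h * (A / \<rho> ^ 3)"
        by (intro mult_left_mono ub n) auto
      then show "real h * u (Suc n) - real h * u n - (real h * u (Suc (Suc n)) - real h * u (Suc n)) \<le> A * (h * (1 / \<rho> ^ 3))"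
        unfolding e by (simp add: mult_ac)
    qed
    also have "sqrt (h * (1 / \<rho> ^ 3)) = sqrt h / s" unfolding real_sqrt_mult s(2) by simp
    finally show ?thesis by simp
  qed
  define L where "L = nat \<lceil>\<rho>\<rceil>"
  have L: "L \<ge> 1" "real L \<ge> \<rho>" "real L \<le> 2 * \<rho>" using rho unfolding L_def by linarith+
  have "\<bar>\<Sum>n<N. frac (u n) - 1/2\<bar> \<le> N / L + 2 * (5 * A * N / s) * sqrt L + 10 * s"
    using sum_sawtooth_le[OF E _ _ L(1)] A s by simp
  also have "N / L \<le> N / \<rho>" using L rho by (intro divide_left_mono) auto
  also have "2 * (5 * A * N / s) * sqrt L \<le> 2 * (5 * A * N / s) * (2 * sqrt \<rho>)"
  proof (intro mult_left_mono)
    have "sqrt L \<le> sqrt (4 * \<rho>)" using L rho by (intro real_sqrt_le_mono) linarith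
    then show "sqrt L \<le> 2 * sqrt \<rho>" by (simp add: real_sqrt_mult)
  qed (use A s in auto)
  also have "s = \<rho> * sqrt \<rho>" using rho by (simp add: s_def power3_eq_cube real_sqrt_mult)
  also have "2 * (5 * A * N / (\<rho> * sqrt \<rho>)) * (2 * sqrt \<rho>) = 20 * A * N / \<rho>"
    using rho by simp
  also have "10 * (\<rho> * sqrt \<rho>) \<le> 10 * \<rho>\<^sup>2"
    using rho sqrt_le_D[of \<rho> \<rho>] by (simp add: power2_eq_square real_le_lsqrt)
  also have "N / \<rho> \<le> A * N / \<rho>" using A rho by (intro divide_right_mono) (auto simp: mult_le_cancel_right1)
  finally show ?thesis by simp
qed

section \<open>Lattice points in a quarter disc\<close>

text \<open>As a function of the step length \<open>s\<close> the error has derivative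
  \<open>(f (a + s) - f a - s * g (a + s)) / 2\<close>. The mean value theorem, applied to the error
  and then to \<open>f\<close>, reduces it to a difference of two values of \<open>g\<close>. The
  bound by the drop of \<open>g\<close> telescopes over consecutive unit steps.\<close>

lemma trapezoid_rule_concave:
  fixes \<Phi> f g :: "real \<Rightarrow> real"
  assumes \<Phi>: "\<And>t. a \<le> t \<Longrightarrow> t \<le> a + 1 \<Longrightarrow> (\<Phi> has_real_derivative f t) (at t)"
    and f: "\<And>t. a \<le> t \<Longrightarrow> t \<le> a + 1 \<Longrightarrow> (f has_real_derivative g t) (at t)"
    and g: "\<And>s t. a \<le> s \<Longrightarrow> s \<le> t \<Longrightarrow> t \<le> a + 1 \<Longrightarrow> g t \<le> g s"
  shows "0 \<le> \<Phi> (a + 1) - \<Phi> a - (f a + f (a + 1)) / 2"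
    and "\<Phi> (a + 1) - \<Phi> a - (f a + f (a + 1)) / 2 \<le> (g a - g (a + 1)) / 2"
proof -
  define \<phi> where "\<phi> s = \<Phi> (a + s) - s * (f a + f (a + s)) / 2" for s
  have der: "(\<phi> has_real_derivative (f (a + s) - f a - s * g (a + s)) / 2) (at s)" if "0 \<le> s" "s \<le> 1" for s
  proof -
    have 1: "((\<lambda>s. \<Phi> (a + s)) has_real_derivative f (a + s)) (at s)"
      using DERIV_shift[of \<Phi> "f (a + s)" s a] \<Phi>[of "a + s"] that by (simp add: add.commute)
    have 2: "((\<lambda>s. f (a + s)) has_real_derivative g (a + s)) (at s)"
      using DERIV_shift[of f "g (a + s)" s a] f[of "a + s"] that by (simp add: add.commute)
    show ?thesis unfolding \<phi>_def
      by (rule derivative_eq_intros 1 2 refl | simp add: field_simps)+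
  qed
  have "\<exists>z. 0 < z \<and> z < 1 \<and> \<phi> 1 - \<phi> 0 = (1 - 0) * ((f (a + z) - f a - z * g (a + z)) / 2)"
    by (rule MVT2) (use der in auto)
  then obtain s where s: "0 < s" "s < 1" "\<phi> 1 - \<phi> 0 = (f (a + s) - f a - s * g (a + s)) / 2" by auto
  have "\<exists>z. a < z \<and> z < a + s \<and> f (a + s) - f a = (a + s - a) * g z"
    by (rule MVT2) (use f s in auto)
  then obtain z where z: "a < z" "z < a + s" "f (a + s) - f a = s * g z" by auto
  have e: "\<Phi> (a + 1) - \<Phi> a - (f a + f (a + 1)) / 2 = s * (g z - g (a + s)) / 2"
    using s(3) z(3) by (simp add: \<phi>_def algebra_simps)
  have "g (a + s) \<le> g z" "g z \<le> g a" "g (a + 1) \<le> g (a + s)"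
    using z s by (auto intro!: g)
  then have "0 \<le> s * (g z - g (a + s))" "s * (g z - g (a + s)) \<le> 1 * (g a - g (a + 1))"
    using s by (simp, intro mult_mono) auto
  then show "0 \<le> \<Phi> (a + 1) - \<Phi> a - (f a + f (a + 1)) / 2"
    and "\<Phi> (a + 1) - \<Phi> a - (f a + f (a + 1)) / 2 \<le> (g a - g (a + 1)) / 2"
    unfolding e by auto
qed

text \<open>The third function is the area under the arc from 0 to \<open>t\<close>, a triangle plus
  a circular sector.\<close>

lemma circle_arc_derivs:
  assumes "\<bar>t\<bar> < sqrt x"
  shows "((\<lambda>t. sqrt (x - t\<^sup>2)) has_real_derivative - t / sqrt (x - t\<^sup>2)) (at t)"
    and "((\<lambda>t. - t / sqrt (x - t\<^sup>2)) has_real_derivative - x / sqrt (x - t\<^sup>2) ^ 3) (at t)"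
    and "((\<lambda>t. (t * sqrt (x - t\<^sup>2) + x * arcsin (t / sqrt x)) / 2) has_real_derivative sqrt (x - t\<^sup>2)) (at t)"
proof -
  have x: "x > 0" using assms by (metis abs_ge_zero le_less_trans real_sqrt_gt_0_iff)
  have tx: "t\<^sup>2 < x"
    using assms by (metis abs_le_square_iff not_le real_sqrt_abs real_sqrt_le_iff real_sqrt_less_iff)
  define F where "F = sqrt (x - t\<^sup>2)"
  have F: "F > 0" "F\<^sup>2 = x - t\<^sup>2" using tx by (auto simp: F_def)
  show 1: "((\<lambda>t. sqrt (x - t\<^sup>2)) has_real_derivative - t / sqrt (x - t\<^sup>2)) (at t)"
    using tx by (auto intro!: derivative_eq_intros simp: field_simps)
  show "((\<lambda>t. - t / sqrt (x - t\<^sup>2)) has_real_derivative - x / sqrt (x - t\<^sup>2) ^ 3) (at t)"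
  proof -
    have "((\<lambda>t. - t / sqrt (x - t\<^sup>2)) has_real_derivative (-1 * F - (- t) * (- t / F)) / (F * F)) (at t)"
      unfolding F_def by (rule DERIV_divide[OF _ 1]) (use F in \<open>auto intro!: derivative_eq_intros simp: F_def\<close>)
    moreover have "(-1 * F - (- t) * (- t / F)) / (F * F) = - (F\<^sup>2 + t\<^sup>2) / F ^ 3"
      using F(1) by (simp add: field_simps power2_eq_square power3_eq_cube)
    ultimately show ?thesis using F(2) by (simp add: F_def)
  qed
  have ts: "-1 < t / sqrt x" "t / sqrt x < 1" using assms x by (auto simp: field_simps)
  have "((\<lambda>t. arcsin (t / sqrt x)) has_real_derivative inverse (sqrt (1 - (t / sqrt x)\<^sup>2)) * (1 / sqrt x)) (at t)"
    by (rule DERIV_chain2[where f = arcsin and g = "\<lambda>t. t / sqrt x" and x = t, OF DERIV_arcsin[OF ts]]) (rule DERIV_cdivide[OF DERIV_ident])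
  moreover have "inverse (sqrt (1 - (t / sqrt x)\<^sup>2)) * (1 / sqrt x) = 1 / F"
  proof -
    have "F = sqrt (x * (1 - (t / sqrt x)\<^sup>2))" unfolding F_def using x by (simp add: power_divide field_simps)
    then have "F = sqrt x * sqrt (1 - (t / sqrt x)\<^sup>2)" by (simp only: real_sqrt_mult)
    then show ?thesis by (simp add: field_simps)
  qed
  ultimately have 2: "((\<lambda>t. arcsin (t / sqrt x)) has_real_derivative 1 / F) (at t)" by simp
  have "((\<lambda>t. (t * sqrt (x - t\<^sup>2) + x * arcsin (t / sqrt x)) / 2) has_real_derivative
      (1 * F + (- t / F) * t + x * (1 / F)) / 2) (at t)"
    unfolding F_def by (intro DERIV_cdivide DERIV_add DERIV_mult DERIV_ident DERIV_cmult 1 2[unfolded F_def])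
  moreover have "(1 * F + (- t / F) * t + x * (1 / F)) / 2 = F"
  proof -
    have "x = F * F + t * t" using F(2) by (simp add: power2_eq_square)
    then show ?thesis using F(1) by (simp add: field_simps)
  qed
  ultimately show "((\<lambda>t. (t * sqrt (x - t\<^sup>2) + x * arcsin (t / sqrt x)) / 2) has_real_derivative sqrt (x - t\<^sup>2)) (at t)"
    by (simp only: F_def)
qed

text \<open>The mean value theorem for \<open>f (t + 1) - f t\<close>, and then for
  \<open>g\<close>, turns the second difference into \<open>- h\<close> at one intermediate
  point.\<close>

lemma second_difference_bounds:
  fixes f g h :: "real \<Rightarrow> real"
  assumes f: "\<And>t. a \<le> t \<Longrightarrow> t \<le> a + 2 \<Longrightarrow> (f has_real_derivative g t) (at t)"
    and g: "\<And>t. a \<le> t \<Longrightarrow> t \<le> a + 2 \<Longrightarrow> (g has_real_derivative h t) (at t)"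
    and h: "\<And>t. a \<le> t \<Longrightarrow> t \<le> a + 2 \<Longrightarrow> - h t \<in> {l..b}"
  shows "(f (a + 1) - f a) - (f (a + 2) - f (a + 1)) \<in> {l..b}"
proof -
  have "((\<lambda>t. f (t + 1) - f t) has_real_derivative (g (t + 1) - g t)) (at t)" if "a \<le> t" "t \<le> a + 1" for t
    using that f by (auto intro!: DERIV_diff simp flip: DERIV_shift)
  then have "\<exists>z. a < z \<and> z < a + 1 \<and> (f (a + 1 + 1) - f (a + 1)) - (f (a + 1) - f a) = (a + 1 - a) * (g (z + 1) - g z)"
    by (intro MVT2) auto
  then obtain z where z: "a < z" "z < a + 1" "(f (a + 1 + 1) - f (a + 1)) - (f (a + 1) - f a) = g (z + 1) - g z" by auto
  have "\<exists>y. z < y \<and> y < z + 1 \<and> g (z + 1) - g z = (z + 1 - z) * h y"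
    using z by (intro MVT2 g) auto
  then obtain y where y: "z < y" "y < z + 1" "g (z + 1) - g z = h y" by auto
  then show ?thesis using z h[of y] by (auto simp: add.assoc)
qed

text \<open>The quadrant contains the positive real half-axis but not the imaginary one, so it holds
  exactly one of the four associates of each nonzero Gaussian integer.\<close>

definition quadrant_points :: "real \<Rightarrow> (nat \<times> nat) set" where
  "quadrant_points x = {(a, b). 1 \<le> a \<and> real a ^ 2 + real b ^ 2 \<le> x}"

lemma nat_sq_le_iff: "real b ^ 2 \<le> y \<longleftrightarrow> y \<ge> 0 \<and> b \<le> nat \<lfloor>sqrt y\<rfloor>"
proof -
  have "real b ^ 2 \<le> y \<longleftrightarrow> y \<ge> 0 \<and> real b \<le> sqrt y"
    by (smt (verit) of_nat_0_le_iff real_le_rsqrt real_sqrt_pow2_iff power_mono zero_le_power2)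
  then show ?thesis by (auto simp: le_nat_floor le_nat_iff le_floor_iff)
qed

text \<open>Off the axis, two coordinates above \<open>M\<close> would both have squares above x /
  2. So the points with first coordinate at most \<open>M\<close> and their mirror images cover
  everything, overlapping in the square of side \<open>M\<close>; the axis contributes \<lfloor>sqrt
  x\<rfloor>.\<close>

lemma card_quadrant_points:
  assumes "x \<ge> 1"
  defines "M \<equiv> nat \<lfloor>sqrt (x / 2)\<rfloor>"
  shows "real (card (quadrant_points x)) = \<lfloor>sqrt x\<rfloor> + 2 * (\<Sum>n=1..M. real_of_int \<lfloor>sqrt (x - (real n)\<^sup>2)\<rfloor>) - (real M)\<^sup>2"
proof -
  let ?F = "\<lambda>a. nat \<lfloor>sqrt (x - (real a)\<^sup>2)\<rfloor>"
  define T0 where "T0 = (\<lambda>a::nat. (a, 0::nat)) ` {1..nat \<lfloor>sqrt x\<rfloor>}"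
  define T1 where "T1 = (SIGMA a:{1..M}. {1..?F a})"
  define T2 where "T2 = prod.swap ` T1"
  have M: "a \<le> M \<longleftrightarrow> real a ^ 2 \<le> x / 2" for a
    using nat_sq_le_iff[of a "x / 2"] assms by (simp add: M_def)
  have T1: "(a, b) \<in> T1 \<longleftrightarrow> 1 \<le> a \<and> a \<le> M \<and> 1 \<le> b \<and> real a ^ 2 + real b ^ 2 \<le> x" for a b
    using nat_sq_le_iff[of b "x - (real a)\<^sup>2"] M[of a] assms by (auto simp: T1_def algebra_simps)
  have T2: "(a, b) \<in> T2 \<longleftrightarrow> 1 \<le> a \<and> b \<le> M \<and> 1 \<le> b \<and> real a ^ 2 + real b ^ 2 \<le> x" for a b
  proof -
    have "(a, b) \<in> T2 \<longleftrightarrow> (b, a) \<in> T1" by (force simp: T2_def)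
    then show ?thesis using T1[of b a] by (auto simp: add.commute)
  qed
  have T0: "(a, b) \<in> T0 \<longleftrightarrow> 1 \<le> a \<and> b = 0 \<and> real a ^ 2 \<le> x" for a b
    using nat_sq_le_iff[of a x] assms by (auto simp: T0_def)
  have big: "a \<le> M \<or> b \<le> M" if "real a ^ 2 + real b ^ 2 \<le> x" for a b
    using that unfolding M by linarith
  have eq: "quadrant_points x = T0 \<union> (T1 \<union> T2)"
  proof -
    have "z \<in> quadrant_points x \<longleftrightarrow> z \<in> T0 \<union> (T1 \<union> T2)" for z
    proof (cases z)
      case (Pair a b)
      show ?thesis unfolding Pair
        using big[of a b] by (cases "b = 0") (auto simp: quadrant_points_def T0 T1 T2)
    qed
    then show ?thesis by blast
  qed
  have fin: "finite T0" "finite T1" "finite T2" by (auto simp: T0_def T1_def T2_def)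
  have int: "T1 \<inter> T2 = {1..M} \<times> {1..M}"
  proof -
    have "z \<in> T1 \<inter> T2 \<longleftrightarrow> z \<in> {1..M} \<times> {1..M}" for z
    proof (cases z)
      case (Pair a b)
      show ?thesis unfolding Pair using M[of a] M[of b] by (auto simp: T1 T2)
    qed
    then show ?thesis by blast
  qed
  have "T0 \<inter> (T1 \<union> T2) = {}" by (auto simp: T0 T1 T2)
  then have "card (quadrant_points x) = card T0 + card (T1 \<union> T2)"
    unfolding eq using fin by (intro card_Un_disjoint) auto
  moreover have "card T0 = nat \<lfloor>sqrt x\<rfloor>" unfolding T0_def by (subst card_image) (auto simp: inj_on_def)
  moreover have "card (T1 \<union> T2) + M * M = card T1 + card T1"
    using card_Un_Int[OF fin(2,3)] unfolding int by (simp add: T2_def card_image)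
  moreover have "card T1 = (\<Sum>n=1..M. ?F n)" by (simp add: T1_def)
  ultimately have "card (quadrant_points x) + M * M = nat \<lfloor>sqrt x\<rfloor> + 2 * (\<Sum>n=1..M. ?F n)"
    by simp
  then have "real (card (quadrant_points x) + M * M) = real (nat \<lfloor>sqrt x\<rfloor> + 2 * (\<Sum>n=1..M. ?F n))"
    by (simp only:)
  then have "real (card (quadrant_points x)) + real (M * M) = real (nat \<lfloor>sqrt x\<rfloor>) + 2 * (\<Sum>n=1..M. real (?F n))"
    by simp
  moreover have "real (?F n) = real_of_int \<lfloor>sqrt (x - (real n)\<^sup>2)\<rfloor>" if "n \<in> {1..M}" for n
    using that M[of n] assms by simp
  ultimately show "real (card (quadrant_points x)) = \<lfloor>sqrt x\<rfloor> + 2 * (\<Sum>n=1..M. real_of_int \<lfloor>sqrt (x - (real n)\<^sup>2)\<rfloor>) - (real M)\<^sup>2"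
    using assms by (simp add: power2_eq_square)
qed

text \<open>Here \<open>m\<close> is the abscissa where the arc meets the diagonal, so the arc has
  height \<open>m\<close> there. The term \<open>(m - M) * m\<close> accounts for stopping at the
  integer \<open>M\<close>; it may be of order sqrt x and is kept. Errors of at most 1/2 from the
  trapezoid rule, 1 from the strip between \<open>M\<close> and \<open>m\<close>, and 1/2 from the
  end value fit into 2.\<close>

lemma sum_circle_arc:
  assumes "x \<ge> 1"
  defines "m \<equiv> sqrt (x / 2)" and "M \<equiv> nat \<lfloor>sqrt (x / 2)\<rfloor>"
  shows "\<bar>(\<Sum>n=1..M. sqrt (x - (real n)\<^sup>2)) - (x / 4 + x * arcsin (sqrt (1/2)) / 2 - (m - M) * m - sqrt x / 2 + m / 2)\<bar> \<le> 2"
proof -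
  define F where "F t = sqrt (x - t\<^sup>2)" for t
  define G where "G t = - t / F t" for t
  define \<Phi> where "\<Phi> t = (t * F t + x * arcsin (t / sqrt x)) / 2" for t
  have m: "m > 0" "m * m = x / 2" using assms by (auto simp: m_def)
  have mx: "m < sqrt x" using assms by (simp add: m_def)
  have Mm: "real M \<le> m" "m < M + 1"
  proof -
    have "real M = real_of_int \<lfloor>m\<rfloor>" using assms by (simp add: M_def m_def)
    then show "real M \<le> m" "m < M + 1" by linarith+
  qed
  have dF: "(F has_real_derivative G t) (at t)" and d\<Phi>: "(\<Phi> has_real_derivative F t) (at t)" if "0 \<le> t" "t \<le> m" for t
    using circle_arc_derivs(1,3)[of t x] that mx unfolding F_def G_def \<Phi>_def by auto
  have Fm: "F m = m" using m by (simp add: F_def power2_eq_square m_def)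
  have Fmono: "F t \<le> F s" "F s \<ge> m" "F t \<ge> m" if "0 \<le> s" "s \<le> t" "t \<le> m" for s t
  proof -
    have *: "F t \<le> F s" if "0 \<le> s" "s \<le> t" for s t
      using that by (simp add: F_def power_mono)
    show "F t \<le> F s" "F s \<ge> m" "F t \<ge> m" using *[of s t] *[of s m] *[of t m] Fm that by auto
  qed
  have Gmono: "G t \<le> G s" if "0 \<le> s" "s \<le> t" "t \<le> m" for s t
  proof -
    have "s / F s \<le> t / F t" using Fmono[OF that] that m by (intro frac_le) auto
    then show ?thesis by (simp add: G_def)
  qed
  have Gb: "- 1 \<le> G t" "G t \<le> 0" if "0 \<le> t" "t \<le> m" for t
  proof -
    have "t / F t \<le> t / m" using Fmono[of t t] that m by (intro divide_left_mono) auto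
    also have "\<dots> \<le> 1" using that m by simp
    finally show "- 1 \<le> G t" by (simp add: G_def)
    show "G t \<le> 0" using Fmono[of t t] that m by (simp add: G_def)
  qed
  have \<Phi>0: "\<Phi> 0 = 0" by (simp add: \<Phi>_def)
  define S where "S = (\<Sum>n<M. (F n + F (real n + 1)) / 2)"
  have trap: "0 \<le> \<Phi> (real n + 1) - \<Phi> n - (F n + F (real n + 1)) / 2"
    "\<Phi> (real n + 1) - \<Phi> n - (F n + F (real n + 1)) / 2 \<le> (G n - G (real n + 1)) / 2" if "n < M" for n
  proof -
    have "real n + 1 \<le> M" using that by linarith
    then have n: "real n + 1 \<le> m" using Mm by linarith
    show "0 \<le> \<Phi> (real n + 1) - \<Phi> n - (F n + F (real n + 1)) / 2"
      "\<Phi> (real n + 1) - \<Phi> n - (F n + F (real n + 1)) / 2 \<le> (G n - G (real n + 1)) / 2"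
      using trapezoid_rule_concave[of "real n" \<Phi> F G] dF d\<Phi> Gmono n by auto
  qed
  have tel: "(\<Sum>n<M. \<Phi> (real n + 1) - \<Phi> n) = \<Phi> M - \<Phi> 0" "(\<Sum>n<M. G n - G (real n + 1)) = G 0 - G M"
    using sum_lessThan_telescope[of "\<lambda>n. \<Phi> (real n)" M] sum_lessThan_telescope'[of "\<lambda>n. G (real n)" M]
    by (simp_all add: add.commute)
  have "0 \<le> (\<Sum>n<M. \<Phi> (real n + 1) - \<Phi> n - (F n + F (real n + 1)) / 2)"
    using trap by (intro sum_nonneg) auto
  then have lo: "S \<le> \<Phi> M" using tel(1) by (simp add: sum_subtractf S_def \<Phi>0)
  have "(\<Sum>n<M. \<Phi> (real n + 1) - \<Phi> n - (F n + F (real n + 1)) / 2) \<le> (\<Sum>n<M. (G n - G (real n + 1)) / 2)"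
    using trap by (intro sum_mono) auto
  also have "\<dots> = (G 0 - G M) / 2" using tel(2) by (simp flip: sum_divide_distrib)
  also have "\<dots> \<le> 1 / 2" using Gb[of M] Gb[of 0] Mm m by (simp add: G_def)
  finally have hi: "\<Phi> M - S \<le> 1 / 2" using tel(1) by (simp add: sum_subtractf S_def \<Phi>0)
  have sumF: "(\<Sum>n=1..M. F (real n)) = S - F 0 / 2 + F M / 2"
  proof -
    have "(\<Sum>n=1..k. F (real n)) = (\<Sum>n<k. (F n + F (real n + 1)) / 2) - F 0 / 2 + F k / 2" for k
      by (induction k) (auto simp: add.commute add_divide_distrib)
    then show ?thesis by (simp add: S_def)
  qed
  have Flip: "0 \<le> F t - m" "F t - m \<le> m - t" if "0 \<le> t" "t \<le> m" for t
  proof -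
    show "0 \<le> F t - m" using Fmono[of t t] that by simp
    show "F t - m \<le> m - t"
    proof (cases "t = m")
      case False
      then have "\<exists>z. t < z \<and> z < m \<and> F m - F t = (m - t) * G z" using that by (intro MVT2 dF) auto
      then obtain z where z: "t < z" "z < m" "F m - F t = (m - t) * G z" by blast
      have "(m - t) * G z \<ge> (m - t) * (-1)" using Gb[of z] z that by (intro mult_left_mono) auto
      then show ?thesis using z Fm by simp
    qed (use Fm in simp)
  qed
  have tail: "0 \<le> \<Phi> m - \<Phi> M - (m - M) * m" "\<Phi> m - \<Phi> M - (m - M) * m \<le> 1"
  proof -
    have "0 \<le> \<Phi> m - \<Phi> M - (m - M) * m \<and> \<Phi> m - \<Phi> M - (m - M) * m \<le> 1"
    proof (cases "real M = m")
      case False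
      then have "\<exists>z. real M < z \<and> z < m \<and> \<Phi> m - \<Phi> M = (m - M) * F z" using Mm by (intro MVT2 d\<Phi>) auto
      then obtain z where z: "real M < z" "z < m" "\<Phi> m - \<Phi> M = (m - M) * F z" by blast
      have "0 \<le> F z - m" "F z - m \<le> m - z" using Flip[of z] z by auto
      then have "0 \<le> F z - m" "F z - m \<le> 1" using z Mm by auto
      then have "0 \<le> (m - M) * (F z - m)" "(m - M) * (F z - m) \<le> 1 * 1"
        using Mm by (simp, intro mult_mono) auto
      then show ?thesis using z by (simp add: algebra_simps)
    qed simp
    then show "0 \<le> \<Phi> m - \<Phi> M - (m - M) * m" "\<Phi> m - \<Phi> M - (m - M) * m \<le> 1" by auto
  qed
  have "m / sqrt x = sqrt (1/2)" using assms by (simp add: m_def real_sqrt_divide)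
  then have \<Phi>m: "\<Phi> m = x / 4 + x * arcsin (sqrt (1/2)) / 2" using m by (simp add: \<Phi>_def Fm)
  have F0: "F 0 = sqrt x" by (simp add: F_def)
  have FM: "0 \<le> F M - m" "F M - m \<le> 1" using Flip[of M] Mm by auto
  have sumF': "(\<Sum>n=1..M. sqrt (x - (real n)\<^sup>2)) = S - sqrt x / 2 + F M / 2"
    using sumF unfolding F0 by (simp add: F_def)
  show ?thesis unfolding sumF'
    using lo hi tail FM \<Phi>m by (simp add: abs_le_iff)
qed

lemma sum_frac_circle_arc:
  assumes "x \<ge> 1"
  defines "M \<equiv> nat \<lfloor>sqrt (x / 2)\<rfloor>"
  shows "\<bar>\<Sum>n=1..M. frac (sqrt (x - (real n)\<^sup>2)) - 1/2\<bar> \<le> 74 * x powr (1/3)"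
proof -
  \<comment> \<open>With this choice \<rho>^3 = sqrt x is both the scale of the inverse second
    differences and a bound for the number of terms, so N / \<rho> and \<rho>^2 are both at most
    x^(1/3).\<close>
  define \<rho> where "\<rho> = x powr (1/6)"
  have rho: "\<rho> \<ge> 1" using assms by (simp add: \<rho>_def ge_one_powr_ge_zero)
  have rho2: "\<rho>\<^sup>2 = x powr (1/3)" using assms by (simp add: \<rho>_def powr_power)
  have rho3: "\<rho> ^ 3 = sqrt x" using assms by (simp add: \<rho>_def powr_power powr_half_sqrt)
  define m where "m = sqrt (x / 2)"
  have Mm: "real M \<le> m" using assms by (auto simp: M_def m_def)
  have m: "m < sqrt x" using assms by (simp add: m_def)
  define u where "u n = sqrt (x - (real n)\<^sup>2)" for n
  have sd: "(u (Suc n) - u n) - (u (Suc (Suc n)) - u (Suc n)) \<in> {1 / \<rho> ^ 3..3 / \<rho> ^ 3}" if "Suc n < M" for n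
  proof -
    have "real n + 2 \<le> M" using that by linarith
    then have n: "real n + 2 \<le> m" using Mm by linarith
    have "sqrt (x - (real n + 1)\<^sup>2) - sqrt (x - (real n)\<^sup>2) - (sqrt (x - (real n + 2)\<^sup>2) - sqrt (x - (real n + 1)\<^sup>2)) \<in> {1 / \<rho> ^ 3..3 / \<rho> ^ 3}"
    proof (rule second_difference_bounds)
      fix t assume t: "real n \<le> t" "t \<le> real n + 2"
      then have t': "0 \<le> t" "t \<le> m" using n by auto
      then have ts: "\<bar>t\<bar> < sqrt x" using m by simp
      show "((\<lambda>t. sqrt (x - t\<^sup>2)) has_real_derivative - t / sqrt (x - t\<^sup>2)) (at t)"
        "((\<lambda>t. - t / sqrt (x - t\<^sup>2)) has_real_derivative - x / sqrt (x - t\<^sup>2) ^ 3) (at t)"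
        by (rule circle_arc_derivs[OF ts])+
      define F where "F = sqrt (x - t\<^sup>2)"
      have "t\<^sup>2 \<le> m\<^sup>2" using t' by (intro power_mono) auto
      then have F1: "F \<ge> m" unfolding F_def m_def using assms by (intro real_sqrt_le_mono) simp
      have F2: "F \<le> sqrt x" by (simp add: F_def)
      have mpos: "m > 0" using assms by (simp add: m_def)
      have "x / sqrt x ^ 3 \<le> x / F ^ 3"
        using F1 F2 mpos assms by (intro divide_left_mono power_mono) auto
      moreover have "x / sqrt x ^ 3 = 1 / sqrt x"
        using assms by (simp add: power3_eq_cube)
      moreover have "x / F ^ 3 \<le> x / m ^ 3"
        using F1 mpos assms by (intro divide_left_mono power_mono) auto
      \<comment> \<open>At the far end \<open>t = m\<close> the curvature is 2 sqrt 2 / sqrt x,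
        which explains the ratio 3 between the two bounds on the second difference.\<close>
      moreover have "x / m ^ 3 \<le> 3 / sqrt x"
      proof -
        have "m ^ 3 = x * m / 2" using assms by (simp add: m_def power3_eq_cube)
        then have "x / m ^ 3 = 2 / m" using assms mpos by (simp only: \<open>m ^ 3 = x * m / 2\<close>) (simp add: field_simps)
        also have "\<dots> = 2 * sqrt 2 / sqrt x" by (simp add: m_def real_sqrt_divide)
        also have "\<dots> \<le> 3 / sqrt x"
        proof (rule divide_right_mono)
          have "sqrt 2 \<le> 3 / 2" by (rule real_le_lsqrt) (auto simp: power2_eq_square)
          then show "2 * sqrt 2 \<le> 3" by simp
        qed (use assms in auto)
        finally show ?thesis .
      qed
      ultimately show "- (- x / sqrt (x - t\<^sup>2) ^ 3) \<in> {1 / \<rho> ^ 3..3 / \<rho> ^ 3}"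
        unfolding rho3 by (simp add: F_def)
    qed
    then show ?thesis by (simp add: u_def add.commute)
  qed
  let ?p = "\<lambda>n. frac (u n) - 1/2"
  have pb: "\<bar>?p n\<bar> \<le> 1/2" for n
    using frac_ge_0[of "u n"] frac_lt_1[of "u n"] by linarith
  have "\<bar>\<Sum>n<M. ?p n\<bar> \<le> 21 * 3 * real M / \<rho> + 10 * \<rho>\<^sup>2"
    by (rule van_der_corput_sawtooth[OF rho]) (use sd in auto)
  moreover have "21 * 3 * real M / \<rho> \<le> 63 * \<rho>\<^sup>2"
  proof -
    have "real M \<le> \<rho>\<^sup>2 * \<rho>" using Mm m rho3 by (simp add: power2_eq_square power3_eq_cube)
    then have "M / \<rho> \<le> \<rho>\<^sup>2" using rho by (simp add: field_simps)
    then show ?thesis by simp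
  qed
  \<comment> \<open>Replacing the index range \<open>{..<M}\<close> by \<open>{1..M}\<close>
    exchanges two end terms of modulus at most 1/2; hence 63 + 10 + 1 = 74.\<close>
  moreover have "(\<Sum>n=1..M. ?p n) = (\<Sum>n<M. ?p n) - ?p 0 + ?p M"
    by (induction M) auto
  ultimately have "\<bar>\<Sum>n=1..M. ?p n\<bar> \<le> 73 * \<rho>\<^sup>2 + 1"
    using pb[of 0] pb[of M] by linarith
  moreover have "1 \<le> \<rho>\<^sup>2" using rho by simp
  ultimately show ?thesis unfolding rho2 by (simp add: u_def)
qed

theorem quadrant_points_asymptotic:
  assumes "x \<ge> 1"
  shows "\<bar>real (card (quadrant_points x)) - arcsin (sqrt (1/2)) * x\<bar> \<le> 160 * x powr (1/3)"
proof -
  define m where "m = sqrt (x / 2)"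
  define M where "M = nat \<lfloor>sqrt (x / 2)\<rfloor>"
  define S where "S = (\<Sum>n=1..M. sqrt (x - (real n)\<^sup>2))"
  define P where "P = (\<Sum>n=1..M. frac (sqrt (x - (real n)\<^sup>2)) - 1/2)"
  have Mm: "real M \<le> m" "m < M + 1"
  proof -
    have "real M = real_of_int \<lfloor>m\<rfloor>" using assms by (simp add: M_def m_def)
    then show "real M \<le> m" "m < M + 1" by linarith+
  qed
  have fl: "(\<Sum>n=1..M. real_of_int \<lfloor>sqrt (x - (real n)\<^sup>2)\<rfloor>) = S - P - M / 2"
    by (simp add: S_def P_def frac_def sum_subtractf sum.distrib algebra_simps)
  have c: "real (card (quadrant_points x)) = \<lfloor>sqrt x\<rfloor> + 2 * (S - P - M / 2) - (real M)\<^sup>2"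
    using card_quadrant_points[OF assms] fl by (simp only: M_def)
  have S: "\<bar>S - (x / 4 + x * arcsin (sqrt (1/2)) / 2 - (m - M) * m - sqrt x / 2 + m / 2)\<bar> \<le> 2"
    using sum_circle_arc[OF assms] by (simp add: S_def m_def M_def)
  have P: "\<bar>P\<bar> \<le> 74 * x powr (1/3)"
    using sum_frac_circle_arc[OF assms] by (simp add: P_def M_def)
  have "m\<^sup>2 = x / 2" using assms by (simp add: m_def)
  \<comment> \<open>All contributions of order x and sqrt x other than the main term and sqrt x -
    \<lfloor>sqrt x\<rfloor> combine into this product, which lies in [0, 1] because
    \<open>m - M\<close> does.\<close>
  then have e: "x / 2 - 2 * ((m - M) * m) + m - M - (real M)\<^sup>2 = (m - M) * (1 - (m - M))"
    by (simp add: power2_eq_square algebra_simps)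
  have "0 \<le> (m - M) * (1 - (m - M))" "(m - M) * (1 - (m - M)) \<le> 1 * 1"
    using Mm by (simp, intro mult_mono) auto
  moreover have "real_of_int \<lfloor>sqrt x\<rfloor> \<le> sqrt x" "sqrt x - 1 < real_of_int \<lfloor>sqrt x\<rfloor>" by linarith+
  ultimately have "\<bar>real (card (quadrant_points x)) - arcsin (sqrt (1/2)) * x\<bar> \<le> 6 + 2 * \<bar>P\<bar>"
    using S e unfolding c by (simp add: mult.commute abs_le_iff) linarith
  moreover have "1 \<le> x powr (1/3)" using assms by (simp add: ge_one_powr_ge_zero)
  ultimately show ?thesis using P by linarith
qed

section \<open>Ideals of the Gaussian integers\<close>

abbreviation gauss_ints :: "complex set" where "gauss_ints \<equiv> carrier gauss_ring"

abbreviation gauss_principal :: "complex \<Rightarrow> complex set" where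
  "gauss_principal g \<equiv> PIdl\<^bsub>gauss_ring\<^esub> g"

lemma gauss_mult_closed: "a \<in> gauss_ints \<Longrightarrow> b \<in> gauss_ints \<Longrightarrow> a * b \<in> gauss_ints"
  by (auto simp: algebra_simps)

text \<open>This moves the record-based notion into plain complex arithmetic. Closure under negation
  is multiplication by -1.\<close>

lemma ideal_gauss_iff:
  "ideal I gauss_ring \<longleftrightarrow> I \<subseteq> gauss_ints \<and> 0 \<in> I \<and> (\<forall>a\<in>I. \<forall>b\<in>I. a + b \<in> I) \<and> (\<forall>a\<in>I. \<forall>z\<in>gauss_ints. z * a \<in> I)"
proof
  assume "ideal I gauss_ring"
  then interpret ideal I gauss_ring .
  show "I \<subseteq> gauss_ints \<and> 0 \<in> I \<and> (\<forall>a\<in>I. \<forall>b\<in>I. a + b \<in> I) \<and> (\<forall>a\<in>I. \<forall>z\<in>gauss_ints. z * a \<in> I)"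
    using a_subset additive_subgroup.zero_closed[OF is_additive_subgroup]
      additive_subgroup.a_closed[OF is_additive_subgroup] I_l_closed
    by auto
next
  assume I: "I \<subseteq> gauss_ints \<and> 0 \<in> I \<and> (\<forall>a\<in>I. \<forall>b\<in>I. a + b \<in> I) \<and> (\<forall>a\<in>I. \<forall>z\<in>gauss_ints. z * a \<in> I)"
  interpret cring gauss_ring by (rule cring_gauss_ring)
  have neg: "\<ominus>\<^bsub>gauss_ring\<^esub> a = - a" if "a \<in> gauss_ints" for a
    using that by (intro minus_equality) auto
  have mneg: "- a \<in> I" if "a \<in> I" for a
  proof -
    have "(-1::complex) \<in> gauss_ints" by simp
    then have "(-1) * a \<in> I" using I that by blast
    then show ?thesis by simp
  qed
  show "ideal I gauss_ring"
  proof (rule idealI)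
    show "ring gauss_ring" by (rule ring_axioms)
    show "subgroup I (add_monoid gauss_ring)"
    proof (rule add.subgroupI)
      show "I \<subseteq> gauss_ints" "I \<noteq> {}" using I by auto
      show "\<ominus>\<^bsub>gauss_ring\<^esub> a \<in> I" if "a \<in> I" for a
        using that neg[of a] mneg[of a] I by auto
      show "a \<oplus>\<^bsub>gauss_ring\<^esub> b \<in> I" if "a \<in> I" "b \<in> I" for a b
        using that I by auto
    qed
    fix a z assume "a \<in> I" "z \<in> gauss_ints"
    then show "z \<otimes>\<^bsub>gauss_ring\<^esub> a \<in> I" "a \<otimes>\<^bsub>gauss_ring\<^esub> z \<in> I"
      using I by (auto simp: mult.commute[of a z] simp del: gauss_ring_simps(1))
  qed
qed

lemma ideal_gauss_principal: "g \<in> gauss_ints \<Longrightarrow> ideal (gauss_principal g) gauss_ring"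
  by (rule cring.cgenideal_ideal[OF cring_gauss_ring])

lemma gauss_principal_mem_iff: "a \<in> gauss_principal g \<longleftrightarrow> (\<exists>z\<in>gauss_ints. a = z * g)"
  unfolding PIdl_gauss by blast

lemma nonzero_idealsE:
  assumes "I \<in> nonzero_ideals"
  obtains g where "g \<in> gauss_ints" "g \<noteq> 0" "I = gauss_principal g" "ideal_norm I = gauss_norm g"
proof -
  obtain g where g: "g \<in> gauss_ints" "I = gauss_principal g"
    using gauss_ideal_principal assms by (auto simp: nonzero_ideals_def simp del: gauss_ring_simps(1))
  moreover have "g \<noteq> 0"
  proof
    assume "g = 0"
    then have "I = {0}" using g gauss_principal_mem_iff[of _ g] gauss_self_mem_PIdl[of g] by auto
    then show False using assms by (simp add: nonzero_ideals_def)
  qed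
  ultimately show ?thesis using that ideal_norm_PIdl by metis
qed

lemma gauss_principal_nonzero: "g \<in> gauss_ints \<Longrightarrow> g \<noteq> 0 \<Longrightarrow> gauss_principal g \<in> nonzero_ideals"
  using ideal_gauss_principal gauss_self_mem_PIdl[of g] unfolding nonzero_ideals_def by fastforce

lemma nonzero_ideals_ideal: "I \<in> nonzero_ideals \<Longrightarrow> ideal I gauss_ring"
  by (simp add: nonzero_ideals_def)

lemma nonzero_ideals_mono:
  assumes "I \<in> nonzero_ideals" "ideal J gauss_ring" "I \<subseteq> J"
  shows "J \<in> nonzero_ideals"
proof -
  have "0 \<in> I" using assms(1) unfolding nonzero_ideals_def ideal_gauss_iff by blast
  then show ?thesis using assms unfolding nonzero_ideals_def by auto
qed

lemma gauss_ints_principal: "gauss_ints = gauss_principal 1"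
  unfolding PIdl_gauss by auto

lemma gauss_ints_nonzero_ideal: "gauss_ints \<in> nonzero_ideals"
  unfolding gauss_ints_principal by (rule gauss_principal_nonzero) auto

lemma ideal_norm_gauss_ints: "ideal_norm gauss_ints = 1"
  unfolding gauss_ints_principal by (subst ideal_norm_PIdl) (auto simp: gauss_norm_def)

lemma ideal_norm_ge_1: "I \<in> nonzero_ideals \<Longrightarrow> ideal_norm I \<ge> 1"
  by (metis nonzero_idealsE gauss_norm_ge_1)

lemma gauss_norm_eq_1_iff:
  assumes "z \<in> gauss_ints"
  shows "gauss_norm z = 1 \<longleftrightarrow> z \<in> {1, -1, \<i>, -\<i>}"
proof
  assume n: "gauss_norm z = 1"
  obtain a b :: int where ab: "Re z = of_int a" "Im z = of_int b"
    using assms by (auto elim!: Ints_cases)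
  have "real_of_int (a\<^sup>2 + b\<^sup>2) = 1" using n by (simp add: gauss_norm_def ab)
  then have e: "a\<^sup>2 + b\<^sup>2 = 1" by linarith
  have "a\<^sup>2 \<le> 1" "b\<^sup>2 \<le> 1" using e zero_le_power2[of a] zero_le_power2[of b] by linarith+
  then have "\<bar>a\<bar> \<le> 1" "\<bar>b\<bar> \<le> 1" by (simp_all add: abs_square_le_1)
  then have "a \<in> {-1,0,1}" "b \<in> {-1,0,1}" by auto
  then show "z \<in> {1, -1, \<i>, -\<i>}" using e ab by (auto simp: complex_eq_iff)
qed (auto simp: gauss_norm_def)

text \<open>A generator of the smaller ideal is \<open>z * h\<close> with \<open>h\<close> a
  generator of the larger one. The norm is multiplicative, and equal norms force \<open>z\<close> to
  be a unit.\<close>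

lemma ideal_subset_norm:
  assumes "I \<in> nonzero_ideals" "J \<in> nonzero_ideals" "I \<subseteq> J"
  shows "ideal_norm J \<le> ideal_norm I" "ideal_norm J = ideal_norm I \<Longrightarrow> I = J"
proof -
  obtain g where g: "g \<in> gauss_ints" "g \<noteq> 0" "I = gauss_principal g" "ideal_norm I = gauss_norm g"
    using nonzero_idealsE[OF assms(1)] .
  obtain h where h: "h \<in> gauss_ints" "h \<noteq> 0" "J = gauss_principal h" "ideal_norm J = gauss_norm h"
    using nonzero_idealsE[OF assms(2)] .
  have gJ: "g \<in> gauss_principal h" using assms(3) g(3) h(3) gauss_self_mem_PIdl by blast
  then show "ideal_norm J \<le> ideal_norm I" using gauss_norm_le_of_mem_PIdl g h by simp
  assume eq: "ideal_norm J = ideal_norm I"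
  obtain z where z: "z \<in> gauss_ints" "g = z * h" using gJ gauss_principal_mem_iff by blast
  have "gauss_norm h \<noteq> 0" using h by simp
  then have "gauss_norm z = 1" using eq g(4) h(4) z(2) by (simp add: gauss_norm_mult)
  then have "z \<in> {1, -1, \<i>, -\<i>}" using gauss_norm_eq_1_iff z by blast
  then obtain w where w: "w \<in> gauss_ints" "w * z = 1"
    by (auto intro: that[of 1] that[of "-1"] that[of "-\<i>"] that[of \<i>])
  have "h = w * g" using z w by (simp flip: mult.assoc)
  have "J \<subseteq> I"
  proof
    fix a assume "a \<in> J"
    then obtain v where "v \<in> gauss_ints" "a = v * h" using h(3) gauss_principal_mem_iff by blast
    then have "a = (v * w) * g" "v * w \<in> gauss_ints"
      using \<open>h = w * g\<close> w gauss_mult_closed by simp_all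
    then show "a \<in> I" using g(3) gauss_principal_mem_iff by blast
  qed
  then show "I = J" using assms(3) by simp
qed

lemma gauss_principal_scale: "(*) d ` gauss_principal g = gauss_principal (d * g)"
  unfolding PIdl_gauss by (auto simp: image_iff mult_ac)

text \<open>Scaling by a generator serves as ideal multiplication: it parametrises the multiples of
  an ideal and multiplies norms.\<close>

lemma scale_nonzero_ideals:
  assumes d: "d \<in> gauss_ints" "d \<noteq> 0"
  shows "bij_betw ((`) ((*) d)) nonzero_ideals {I \<in> nonzero_ideals. I \<subseteq> gauss_principal d}"
    and "I \<in> nonzero_ideals \<Longrightarrow> ideal_norm ((*) d ` I) = gauss_norm d * ideal_norm I"
proof -
  have sc: "(*) d ` I \<in> {I \<in> nonzero_ideals. I \<subseteq> gauss_principal d} \<and> ideal_norm ((*) d ` I) = gauss_norm d * ideal_norm I"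
    if I: "I \<in> nonzero_ideals" for I
  proof -
    obtain g where g: "g \<in> gauss_ints" "g \<noteq> 0" "I = gauss_principal g" "ideal_norm I = gauss_norm g"
      using nonzero_idealsE[OF I] .
    have dg: "d * g \<in> gauss_ints" "d * g \<noteq> 0" using d g gauss_mult_closed by auto
    have "(*) d ` I \<subseteq> gauss_principal d"
    proof
      fix a assume "a \<in> (*) d ` I"
      then obtain b where "b \<in> I" "a = b * d" by (auto simp: mult.commute)
      moreover have "I \<subseteq> gauss_ints" using I unfolding nonzero_ideals_def ideal_gauss_iff by blast
      ultimately show "a \<in> gauss_principal d" using gauss_principal_mem_iff by blast
    qed
    then show ?thesis
      using gauss_principal_nonzero[OF dg] ideal_norm_PIdl[OF dg(1)] g
      by (simp add: gauss_principal_scale gauss_norm_mult)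
  qed
  show "I \<in> nonzero_ideals \<Longrightarrow> ideal_norm ((*) d ` I) = gauss_norm d * ideal_norm I"
    using sc by blast
  show "bij_betw ((`) ((*) d)) nonzero_ideals {I \<in> nonzero_ideals. I \<subseteq> gauss_principal d}"
    unfolding bij_betw_def
  proof (intro conjI equalityI subsetI)
    have "inj ((*) d)" using d by (auto simp: inj_on_def)
    then show "inj_on ((`) ((*) d)) nonzero_ideals" by (auto simp: inj_on_def inj_image_eq_iff)
    show "J \<in> {I \<in> nonzero_ideals. I \<subseteq> gauss_principal d}" if "J \<in> (`) ((*) d) ` nonzero_ideals" for J
      using that sc by blast
    fix J assume J: "J \<in> {I \<in> nonzero_ideals. I \<subseteq> gauss_principal d}"
    then obtain g where g: "g \<in> gauss_ints" "g \<noteq> 0" "J = gauss_principal g"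
      using nonzero_idealsE by blast
    have "g \<in> gauss_principal d" using J g gauss_self_mem_PIdl by blast
    then obtain z where z: "z \<in> gauss_ints" "g = z * d" using gauss_principal_mem_iff by blast
    then have "J = (*) d ` gauss_principal z" using g(3) by (simp only: gauss_principal_scale mult.commute[of d z])
    moreover have "gauss_principal z \<in> nonzero_ideals" using z g by (intro gauss_principal_nonzero) auto
    ultimately show "J \<in> (`) ((*) d) ` nonzero_ideals" by blast
  qed
qed

lemma quadrant_bij_betw:
  "bij_betw (\<lambda>(a, b). gauss_principal (Complex (real a) (real b))) {(a, b). 1 \<le> (a::nat)} nonzero_ideals"
proof -
  let ?c = "\<lambda>(a, b). Complex (real a) (real b)"
  have c: "?c p \<in> gauss_ints" "?c p \<noteq> 0" if "p \<in> {(a, b). 1 \<le> (a::nat)}" for p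
    using that by (auto simp: complex_eq_iff split: prod.splits)
  have "inj_on (\<lambda>p. gauss_principal (?c p)) {(a, b). 1 \<le> (a::nat)}"
  proof (rule inj_onI, clarify)
    fix a b a' b' :: nat
    assume a: "1 \<le> a" "1 \<le> a'" and eq: "gauss_principal (Complex (real a) (real b)) = gauss_principal (Complex (real a') (real b'))"
    let ?g = "Complex (real a) (real b)" and ?h = "Complex (real a') (real b')"
    have g: "?g \<in> gauss_ints" "?h \<in> gauss_ints" "?h \<noteq> 0" using a by (auto simp: complex_eq_iff)
    have n: "gauss_norm ?g = gauss_norm ?h" using eq ideal_norm_PIdl g by metis
    have "?g \<in> gauss_principal ?h" using eq gauss_self_mem_PIdl by blast
    then obtain z where z: "z \<in> gauss_ints" "?g = z * ?h" using gauss_principal_mem_iff by blast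
    have "gauss_norm ?h \<noteq> 0" using g by simp
    then have "gauss_norm z = 1" using n by (simp add: z(2) gauss_norm_mult)
    then have "z \<in> {1, -1, \<i>, -\<i>}" using gauss_norm_eq_1_iff z by blast
    then show "a = a' \<and> b = b'" using z(2) a by (auto simp: complex_eq_iff)
  qed
  moreover have "(\<lambda>p. gauss_principal (?c p)) ` {(a, b). 1 \<le> (a::nat)} = nonzero_ideals"
  proof (intro equalityI subsetI)
    fix I assume "I \<in> (\<lambda>p. gauss_principal (?c p)) ` {(a, b). 1 \<le> (a::nat)}"
    then show "I \<in> nonzero_ideals" using c gauss_principal_nonzero by blast
  next
    fix I assume "I \<in> nonzero_ideals"
    then obtain g where g: "g \<in> gauss_ints" "g \<noteq> 0" "I = gauss_principal g" using nonzero_idealsE by blast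
    have assoc: "gauss_principal (w * g) = I" if "w \<in> {1, -1, \<i>, -\<i>}" for w
    proof -
      have w: "w \<in> gauss_ints" "gauss_norm w = 1" "w \<noteq> 0" using that by (auto simp: gauss_norm_def)
      have wg: "w * g \<in> gauss_ints" "w * g \<noteq> 0" using w g gauss_mult_closed by auto
      have "w * g \<in> I" using w(1) g(3) gauss_principal_mem_iff by blast
      then have "gauss_principal (w * g) \<subseteq> I"
        using g(1,3) ideal_gauss_principal[of g] unfolding ideal_gauss_iff gauss_principal_mem_iff[of _ "w * g"] subset_iff
        by blast
      then show ?thesis
        using ideal_subset_norm(2)[of "gauss_principal (w * g)" I] gauss_principal_nonzero wg g w
          ideal_norm_PIdl[OF wg(1)] ideal_norm_PIdl[OF g(1)] by (simp add: gauss_norm_mult)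
    qed
    obtain a b :: int where ab: "Re g = of_int a" "Im g = of_int b"
      using g(1) by (auto elim!: Ints_cases)
    have ne: "a \<noteq> 0 \<or> b \<noteq> 0" using ab g(2) by (auto simp: complex_eq_iff)
    \<comment> \<open>A suitable quarter turn moves \<open>g\<close> into the half-open quadrant;
      the generated ideal does not change by \<open>assoc\<close>.\<close>
    have "\<exists>w\<in>{1, -1, \<i>, -\<i>}. Re (w * g) > 0 \<and> Im (w * g) \<ge> 0"
      using ne by (cases "a > 0"; cases "b > 0"; cases "a = 0"; cases "b = 0") (auto simp: ab)
    then obtain w where w: "w \<in> {1, -1, \<i>, -\<i>}" "Re (w * g) > 0" "Im (w * g) \<ge> 0" by blast
    have "w * g \<in> gauss_ints" using w(1) g(1) by auto
    then obtain a' b' :: int where ab': "Re (w * g) = of_int a'" "Im (w * g) = of_int b'"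
      by (auto elim!: Ints_cases simp del: times_complex.sel)
    then have pos: "a' > 0" "b' \<ge> 0" using w(2,3) by (simp_all only: of_int_0_less_iff of_int_0_le_iff)
    have "w * g = ?c (nat a', nat b')" using ab' pos by (auto simp: complex_eq_iff simp del: times_complex.sel)
    moreover have "(nat a', nat b') \<in> {(a, b). 1 \<le> a}" using pos by simp
    ultimately show "I \<in> (\<lambda>p. gauss_principal (?c p)) ` {(a, b). 1 \<le> (a::nat)}"
      using assoc[OF w(1)] by (metis (no_types, lifting) image_eqI)
  qed
  ultimately show ?thesis unfolding bij_betw_def by (simp add: case_prod_unfold)
qed

lemma ideal_norm_quadrant:
  "1 \<le> a \<Longrightarrow> ideal_norm (gauss_principal (Complex (real a) (real b))) = real a ^ 2 + real b ^ 2"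
  by (subst ideal_norm_PIdl) (auto simp: gauss_norm_def)

lemma card_nonzero_ideals_upto: "card (nonzero_ideals_upto x) = card (quadrant_points x)"
proof -
  let ?f = "\<lambda>(a, b). gauss_principal (Complex (real a) (real b))"
  have "bij_betw ?f (quadrant_points x) (nonzero_ideals_upto x)"
  proof (rule bij_betw_subset[OF quadrant_bij_betw])
    show "quadrant_points x \<subseteq> {(a, b). 1 \<le> a}" by (auto simp: quadrant_points_def)
    show "?f ` quadrant_points x = nonzero_ideals_upto x"
    proof (intro equalityI subsetI)
      fix I assume "I \<in> ?f ` quadrant_points x"
      then obtain a b where ab: "1 \<le> a" "real a ^ 2 + real b ^ 2 \<le> x" "I = gauss_principal (Complex (real a) (real b))"
        by (auto simp: quadrant_points_def)
      have "Complex (real a) (real b) \<noteq> 0" using ab(1) by (auto simp: complex_eq_iff)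
      then show "I \<in> nonzero_ideals_upto x"
        using ab ideal_norm_quadrant[OF ab(1)] gauss_principal_nonzero by (auto simp: nonzero_ideals_upto_def)
    next
      fix I assume I: "I \<in> nonzero_ideals_upto x"
      then have "I \<in> ?f ` {(a, b). 1 \<le> a}"
        using quadrant_bij_betw by (auto simp: bij_betw_def nonzero_ideals_upto_def)
      then obtain a b where ab: "1 \<le> a" "I = gauss_principal (Complex (real a) (real b))" by auto
      then have "(a, b) \<in> quadrant_points x"
        using I ideal_norm_quadrant[OF ab(1)] by (auto simp: quadrant_points_def nonzero_ideals_upto_def)
      then show "I \<in> ?f ` quadrant_points x" using ab by force
    qed
  qed
  then show ?thesis by (metis bij_betw_same_card)
qed

section \<open>A Moebius function built from maximal ideals\<close>

lemma sum_alternating_Pow: "finite A \<Longrightarrow> (\<Sum>S\<in>Pow A. (-1) ^ card S) = (if A = {} then 1 else 0 :: real)"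
proof (induction A rule: finite_induct)
  case (insert a A)
  have inj: "inj_on (insert a) (Pow A)" using insert by (auto simp: inj_on_def)
  have "(\<Sum>S\<in>Pow (insert a A). (-1) ^ card S) = (\<Sum>S\<in>Pow A. (-1) ^ card S) + (\<Sum>S\<in>insert a ` Pow A. (-1) ^ card S :: real)"
    unfolding Pow_insert using insert by (intro sum.union_disjoint) auto
  also have "(\<Sum>S\<in>insert a ` Pow A. (-1) ^ card S :: real) = (\<Sum>S\<in>Pow A. (-1) ^ card (insert a S))"
    by (subst sum.reindex[OF inj]) simp
  also have "\<dots> = (\<Sum>S\<in>Pow A. - ((-1) ^ card S))"
    using insert by (intro sum.cong refl) (subst card_insert_disjoint; auto intro: finite_subset)
  finally show ?case by (simp add: sum_negf)
qed simp

text \<open>Maximality is tested among nonzero ideals only. Every ideal above a nonzero one is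
  nonzero, so this agrees with ordinary maximality, as used in
  \<open>max_ideals_prime\<close>.\<close>

definition max_ideals :: "complex set set" where
  "max_ideals = {M \<in> nonzero_ideals. M \<noteq> gauss_ints \<and> (\<forall>A\<in>nonzero_ideals. M \<subseteq> A \<longrightarrow> A = M \<or> A = gauss_ints)}"

definition max_ideals_above :: "complex set \<Rightarrow> complex set set" where
  "max_ideals_above X = {M \<in> max_ideals. X \<subseteq> M}"

lemma max_ideals_prime:
  assumes M: "M \<in> max_ideals" and ab: "a \<in> gauss_ints" "b \<in> gauss_ints" "a * b \<in> M" "a \<notin> M"
  shows "b \<in> M"
proof -
  have MN: "M \<in> nonzero_ideals" using M by (simp add: max_ideals_def)
  have "maximalideal M gauss_ring"
  proof (rule maximalidealI)
    show "ideal M gauss_ring" using MN nonzero_ideals_ideal by blast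
    show "gauss_ints \<noteq> M" using M by (auto simp: max_ideals_def)
    fix J assume J: "ideal J gauss_ring" "M \<subseteq> J" "J \<subseteq> gauss_ints"
    then show "J = M \<or> J = gauss_ints"
      using nonzero_ideals_mono[OF MN J(1,2)] M by (auto simp: max_ideals_def)
  qed
  then have "primeideal M gauss_ring" by (rule cring.maximalideal_prime[OF cring_gauss_ring])
  from primeideal.I_prime[OF this ab(1,2)] ab(3,4) show ?thesis by auto
qed

lemma nonzero_ideals_subset: "I \<in> nonzero_ideals \<Longrightarrow> I \<subseteq> gauss_ints"
  unfolding nonzero_ideals_def ideal_gauss_iff by blast

lemma finite_ideals_above: "I \<in> nonzero_ideals \<Longrightarrow> finite {D \<in> nonzero_ideals. I \<subseteq> D}"
  by (rule finite_subset[OF _ finite_nonzero_ideals_upto[of "ideal_norm I"]])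
    (auto simp: nonzero_ideals_upto_def ideal_subset_norm)

lemma finite_max_ideals_above: "I \<in> nonzero_ideals \<Longrightarrow> I \<subseteq> X \<Longrightarrow> finite (max_ideals_above X)"
  by (rule finite_subset[OF _ finite_ideals_above]) (auto simp: max_ideals_above_def max_ideals_def)

text \<open>Only finitely many ideals lie above a nonzero ideal, since norms do not grow upwards. A
  maximal element among the proper ones thus exists without Zorn's lemma.\<close>

lemma ex_max_ideal_above:
  assumes "I \<in> nonzero_ideals" "I \<noteq> gauss_ints"
  shows "max_ideals_above I \<noteq> {}"
proof -
  let ?S = "{D \<in> nonzero_ideals. I \<subseteq> D} - {gauss_ints}"
  have "finite ?S" "?S \<noteq> {}" using assms finite_ideals_above by auto
  from finite_has_maximal[OF this] obtain M where M: "M \<in> ?S" "\<forall>A\<in>?S. M \<subseteq> A \<longrightarrow> M = A" by blast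
  then have "M \<in> max_ideals" by (auto simp: max_ideals_def)
  then show ?thesis using M(1) by (auto simp: max_ideals_above_def)
qed

lemma max_ideals_above_gauss_ints [simp]: "max_ideals_above gauss_ints = {}"
  using nonzero_ideals_subset by (auto simp: max_ideals_above_def max_ideals_def simp del: gauss_ring_simps(1))

text \<open>The intersection with \<open>gauss_ints\<close> only matters for the empty family, whose \<open>\<Inter>\<close> is \<open>UNIV\<close>.\<close>

definition max_inter :: "complex set set \<Rightarrow> complex set" where
  "max_inter S = gauss_ints \<inter> \<Inter>S"

lemma nonzero_ideals_Int:
  assumes "I \<in> nonzero_ideals" "J \<in> nonzero_ideals"
  shows "I \<inter> J \<in> nonzero_ideals"
proof -
  obtain g h where g: "g \<in> gauss_ints" "g \<noteq> 0" "g \<in> I" and h: "h \<in> gauss_ints" "h \<noteq> 0" "h \<in> J"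
    using assms by (metis nonzero_idealsE gauss_self_mem_PIdl)
  have IJ: "ideal I gauss_ring" "ideal J gauss_ring" using assms nonzero_ideals_ideal by auto
  have "h * g \<in> I" "g * h \<in> J" using IJ g h unfolding ideal_gauss_iff by blast+
  then have "g * h \<in> I \<inter> J" "g * h \<noteq> 0" using g h by (auto simp: mult.commute)
  moreover have "ideal (I \<inter> J) gauss_ring"
    by (rule ring.i_intersect[OF cring.axioms(1)[OF cring_gauss_ring] IJ])
  ultimately show ?thesis unfolding nonzero_ideals_def by blast
qed

lemma max_inter_nonzero:
  assumes "finite S" "S \<subseteq> max_ideals"
  shows "max_inter S \<in> nonzero_ideals"
  using assms
proof (induction S rule: finite_induct)
  case empty then show ?case by (simp add: max_inter_def gauss_ints_nonzero_ideal)
next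
  case (insert M S)
  have "max_inter (insert M S) = M \<inter> max_inter S" by (auto simp: max_inter_def)
  then show ?case using insert by (auto intro!: nonzero_ideals_Int simp: max_ideals_def)
qed

lemma max_ideals_above_max_inter:
  assumes "finite S" "S \<subseteq> max_ideals"
  shows "max_ideals_above (max_inter S) = S"
proof
  show "S \<subseteq> max_ideals_above (max_inter S)"
    using assms by (auto simp: max_ideals_above_def max_inter_def)
  show "max_ideals_above (max_inter S) \<subseteq> S"
  proof
    fix M assume "M \<in> max_ideals_above (max_inter S)"
    then have M: "M \<in> max_ideals" "max_inter S \<subseteq> M" by (auto simp: max_ideals_above_def)
    have "M \<in> T" if "finite T" "T \<subseteq> max_ideals" "max_inter T \<subseteq> M" for T
      using that
    proof (induction T rule: finite_induct)
      case empty
      then show ?case using M(1) nonzero_ideals_subset[of M] by (auto simp: max_inter_def max_ideals_def)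
    next
      case (insert M' T)
      show ?case
      proof (cases "M' \<subseteq> M")
        case True
        then show ?thesis using insert.prems(1) M(1) by (auto simp: max_ideals_def)
      next
        case False
        then obtain a where a: "a \<in> M'" "a \<notin> M" by blast
        have M': "ideal M' gauss_ring" using insert.prems by (auto simp: max_ideals_def nonzero_ideals_def)
        have T: "ideal (max_inter T) gauss_ring"
          using max_inter_nonzero insert by (auto simp: nonzero_ideals_def)
        have aG: "a \<in> gauss_ints" using a M' unfolding ideal_gauss_iff by blast
        have "max_inter T \<subseteq> M"
        proof
          fix b assume b: "b \<in> max_inter T"
          then have bG: "b \<in> gauss_ints" by (simp add: max_inter_def)
          have "b * a \<in> M'" "a * b \<in> max_inter T" using a b aG bG M' T unfolding ideal_gauss_iff by blast+
          then have "a * b \<in> max_inter (insert M' T)" by (auto simp: max_inter_def mult.commute)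
          then show "b \<in> M" using max_ideals_prime[OF M(1) aG bG _ a(2)] insert.prems by blast
        qed
        then show ?thesis using insert by blast
      qed
    qed
    then show "M \<in> S" using assms M by blast
  qed
qed

text \<open>Distinct maximal ideals are comaximal, so the intersections of finitely many of them are the
  squarefree ideals. A finite set of maximal ideals is recovered from its intersection by
  \<open>max_ideals_above_max_inter\<close>; hence the divisor sum of the Moebius function becomes an alternating
  sum over subsets, and no unique factorisation is needed.\<close>

definition ideal_moebius :: "complex set \<Rightarrow> real" where
  "ideal_moebius D = (if D = max_inter (max_ideals_above D) then (-1) ^ card (max_ideals_above D) else 0)"

lemma abs_ideal_moebius_le: "\<bar>ideal_moebius D\<bar> \<le> 1"
  by (simp add: ideal_moebius_def power_abs)

text \<open>\<open>X\<close> need not be an ideal: the lemma is used for a union of two ideals,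
  which detects coprimality, and for a single ideal, which inverts the zeta function. The nonzero
  ideal inside \<open>X\<close> makes the sum finite.\<close>

lemma sum_ideal_moebius:
  assumes "I \<in> nonzero_ideals" "I \<subseteq> X" "X \<subseteq> gauss_ints"
  shows "(\<Sum>D | D \<in> nonzero_ideals \<and> X \<subseteq> D. ideal_moebius D) = (if max_ideals_above X = {} then 1 else 0)"
proof -
  let ?P = "max_ideals_above X"
  have finP: "finite ?P" using finite_max_ideals_above assms by blast
  have sub: "finite S" "S \<subseteq> max_ideals" if "S \<in> Pow ?P" for S
    using that finP by (auto intro: finite_subset simp: max_ideals_above_def)
  have fin: "finite {D \<in> nonzero_ideals. X \<subseteq> D}"
    by (rule finite_subset[OF _ finite_ideals_above[OF assms(1)]]) (use assms in auto)
  have inj: "inj_on max_inter (Pow ?P)"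
    by (rule inj_on_inverseI[of _ max_ideals_above]) (use sub max_ideals_above_max_inter in auto)
  \<comment> \<open>Only intersections of subfamilies of \<open>?P\<close> contribute: any other
    \<open>D\<close> differs from \<open>max_inter (max_ideals_above D)\<close> and has Moebius
    value 0.\<close>
  have "(\<Sum>D | D \<in> nonzero_ideals \<and> X \<subseteq> D. ideal_moebius D) = (\<Sum>D\<in>max_inter ` Pow ?P. ideal_moebius D)"
  proof (rule sum.mono_neutral_right[OF fin])
    show "max_inter ` Pow ?P \<subseteq> {D \<in> nonzero_ideals. X \<subseteq> D}"
    proof
      fix D assume "D \<in> max_inter ` Pow ?P"
      then obtain S where S: "S \<in> Pow ?P" "D = max_inter S" by blast
      then have "X \<subseteq> D" using assms(3) by (auto simp: max_inter_def max_ideals_above_def simp del: gauss_ring_simps(1))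
      then show "D \<in> {D \<in> nonzero_ideals. X \<subseteq> D}" using max_inter_nonzero sub S by auto
    qed
    show "\<forall>D\<in>{D \<in> nonzero_ideals. X \<subseteq> D} - max_inter ` Pow ?P. ideal_moebius D = 0"
    proof
      fix D assume D: "D \<in> {D \<in> nonzero_ideals. X \<subseteq> D} - max_inter ` Pow ?P"
      then have "max_ideals_above D \<in> Pow ?P" by (auto simp: max_ideals_above_def)
      then show "ideal_moebius D = 0" using D by (auto simp: ideal_moebius_def)
    qed
  qed
  also have "\<dots> = (\<Sum>S\<in>Pow ?P. ideal_moebius (max_inter S))"
    by (simp add: sum.reindex[OF inj])
  also have "\<dots> = (\<Sum>S\<in>Pow ?P. (-1) ^ card S)"
    by (intro sum.cong refl) (simp add: ideal_moebius_def max_ideals_above_max_inter[OF sub])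
  also have "\<dots> = (if ?P = {} then 1 else 0)" by (rule sum_alternating_Pow[OF finP])
  finally show ?thesis .
qed

text \<open>A proper ideal containing both lies in some maximal ideal, so maximal ideals alone
  detect a nontrivial common divisor.\<close>

lemma ideal_gcd_eq_gauss_ints_iff:
  assumes "I \<in> nonzero_ideals" "J \<in> nonzero_ideals"
  shows "ideal_gcd I J = gauss_ints \<longleftrightarrow> max_ideals_above (I \<union> J) = {}"
proof -
  have ids: "ideal I gauss_ring" "ideal J gauss_ring" using assms nonzero_ideals_ideal by auto
  have G: "ideal gauss_ints gauss_ring" using gauss_ints_nonzero_ideal nonzero_ideals_ideal by blast
  have "(\<forall>A. ideal A gauss_ring \<and> I \<subseteq> A \<and> J \<subseteq> A \<longrightarrow> gauss_ints \<subseteq> A) \<longleftrightarrow> max_ideals_above (I \<union> J) = {}"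
  proof
    assume *: "\<forall>A. ideal A gauss_ring \<and> I \<subseteq> A \<and> J \<subseteq> A \<longrightarrow> gauss_ints \<subseteq> A"
    show "max_ideals_above (I \<union> J) = {}"
    proof (rule ccontr)
      assume "max_ideals_above (I \<union> J) \<noteq> {}"
      then obtain M where M: "M \<in> max_ideals" "I \<subseteq> M" "J \<subseteq> M" by (auto simp: max_ideals_above_def)
      then have MN: "M \<in> nonzero_ideals" by (simp add: max_ideals_def)
      then have "gauss_ints \<subseteq> M" using * M nonzero_ideals_ideal by blast
      then show False using M(1) nonzero_ideals_subset[OF MN] by (auto simp: max_ideals_def)
    qed
  next
    assume P: "max_ideals_above (I \<union> J) = {}"
    show "\<forall>A. ideal A gauss_ring \<and> I \<subseteq> A \<and> J \<subseteq> A \<longrightarrow> gauss_ints \<subseteq> A"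
    proof (intro allI impI, elim conjE)
      fix A assume A: "ideal A gauss_ring" "I \<subseteq> A" "J \<subseteq> A"
      then have AN: "A \<in> nonzero_ideals" using nonzero_ideals_mono assms by blast
      have "max_ideals_above A = {}" using P A by (auto simp: max_ideals_above_def)
      then show "gauss_ints \<subseteq> A" using ex_max_ideal_above[OF AN] by auto
    qed
  qed
  then show ?thesis
    unfolding ideal_gcd_eq_iff[OF ids]
    by (simp only: G nonzero_ideals_subset[OF assms(1)] nonzero_ideals_subset[OF assms(2)] simp_thms)
qed

text \<open>The universal properties are compared, since scaling preserves and reflects inclusions.
  An ideal \<open>A\<close> above the scaled pair need not be a multiple of \<open>k\<close>;
  intersecting it with \<open>gauss_principal k\<close> makes it the scaled copy of some ideal
  \<open>B\<close>.\<close>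

lemma ideal_gcd_scale_iff:
  assumes k: "k \<in> gauss_ints" "k \<noteq> 0" and IJ: "I \<in> nonzero_ideals" "J \<in> nonzero_ideals"
  shows "ideal_gcd ((*) k ` I) ((*) k ` J) = gauss_principal k \<longleftrightarrow> ideal_gcd I J = gauss_ints"
proof -
  have scI: "(*) k ` A \<in> nonzero_ideals" "(*) k ` A \<subseteq> gauss_principal k" if "A \<in> nonzero_ideals" for A
    using bij_betwE[OF scale_nonzero_ideals(1)[OF k]] that by simp_all
  have subset_iff: "(*) k ` A \<subseteq> (*) k ` B \<longleftrightarrow> A \<subseteq> B" for A B
    using k by (auto simp: subset_iff image_iff)
  have kG: "gauss_principal k = (*) k ` gauss_ints"
    unfolding gauss_ints_principal gauss_principal_scale by simp
  have ids: "ideal I gauss_ring" "ideal J gauss_ring"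
    "ideal ((*) k ` I) gauss_ring" "ideal ((*) k ` J) gauss_ring" "ideal gauss_ints gauss_ring"
    "ideal (gauss_principal k) gauss_ring"
    using IJ scI gauss_ints_nonzero_ideal nonzero_ideals_ideal ideal_gauss_principal[OF k(1)] by auto
  have "(\<forall>A. ideal A gauss_ring \<and> (*) k ` I \<subseteq> A \<and> (*) k ` J \<subseteq> A \<longrightarrow> gauss_principal k \<subseteq> A)
     \<longleftrightarrow> (\<forall>A. ideal A gauss_ring \<and> I \<subseteq> A \<and> J \<subseteq> A \<longrightarrow> gauss_ints \<subseteq> A)" (is "?L \<longleftrightarrow> ?R")
  proof
    assume L: ?L
    show ?R
    proof (intro allI impI, elim conjE)
      fix A assume A: "ideal A gauss_ring" "I \<subseteq> A" "J \<subseteq> A"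
      then have "A \<in> nonzero_ideals" using nonzero_ideals_mono IJ by blast
      then have "ideal ((*) k ` A) gauss_ring" using scI nonzero_ideals_ideal by blast
      then have "gauss_principal k \<subseteq> (*) k ` A" using L A by (meson image_mono)
      then show "gauss_ints \<subseteq> A" unfolding kG subset_iff .
    qed
  next
    assume R: ?R
    show ?L
    proof (intro allI impI, elim conjE)
      fix A assume A: "ideal A gauss_ring" "(*) k ` I \<subseteq> A" "(*) k ` J \<subseteq> A"
      let ?B = "A \<inter> gauss_principal k"
      have "A \<in> nonzero_ideals" using nonzero_ideals_mono scI(1)[OF IJ(1)] A by blast
      then have "?B \<in> nonzero_ideals" using nonzero_ideals_Int gauss_principal_nonzero k by blast
      then have "?B \<in> (`) ((*) k) ` nonzero_ideals"
        unfolding bij_betw_imp_surj_on[OF scale_nonzero_ideals(1)[OF k]] by simp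
      then obtain B where B: "B \<in> nonzero_ideals" "?B = (*) k ` B" by (elim imageE)
      have "(*) k ` I \<subseteq> (*) k ` B" "(*) k ` J \<subseteq> (*) k ` B"
        using A scI(2) IJ unfolding B(2)[symmetric] by auto
      then have "gauss_ints \<subseteq> B" using R B(1) nonzero_ideals_ideal unfolding subset_iff by blast
      then have "(*) k ` gauss_ints \<subseteq> (*) k ` B" unfolding subset_iff .
      then have "gauss_principal k \<subseteq> ?B" by (simp only: B(2) flip: kG)
      then show "gauss_principal k \<subseteq> A" by blast
    qed
  qed
  then show ?thesis
    unfolding ideal_gcd_eq_iff[OF ids(3,4)] ideal_gcd_eq_iff[OF ids(1,2)]
    by (simp only: ids scI(2)[OF IJ(1)] scI(2)[OF IJ(2)]
      nonzero_ideals_subset[OF IJ(1)] nonzero_ideals_subset[OF IJ(2)] simp_thms)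
qed

section \<open>Counting pairs by their gcd\<close>

abbreviation ideal_count :: "real \<Rightarrow> real" where
  "ideal_count x \<equiv> real (card (nonzero_ideals_upto x))"

lemma scale_nonzero_ideals_upto:
  assumes k: "k \<in> gauss_ints" "k \<noteq> 0"
  shows "bij_betw ((`) ((*) k)) (nonzero_ideals_upto (x / gauss_norm k))
           {I \<in> nonzero_ideals_upto x. I \<subseteq> gauss_principal k}"
proof (rule bij_betw_subset[OF scale_nonzero_ideals(1)[OF k]])
  have kn: "gauss_norm k > 0" using gauss_norm_ge_1[OF k] by simp
  have iff: "ideal_norm ((*) k ` I) \<le> x \<longleftrightarrow> ideal_norm I \<le> x / gauss_norm k" if "I \<in> nonzero_ideals" for I
    using scale_nonzero_ideals(2)[OF k that] kn by (simp add: field_simps)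
  show "nonzero_ideals_upto (x / gauss_norm k) \<subseteq> nonzero_ideals" by (auto simp: nonzero_ideals_upto_def)
  show "(`) ((*) k) ` nonzero_ideals_upto (x / gauss_norm k) = {I \<in> nonzero_ideals_upto x. I \<subseteq> gauss_principal k}"
  proof (intro equalityI subsetI)
    fix J assume "J \<in> (`) ((*) k) ` nonzero_ideals_upto (x / gauss_norm k)"
    then obtain I where I: "J = (*) k ` I" "I \<in> nonzero_ideals" "ideal_norm I \<le> x / gauss_norm k"
      unfolding nonzero_ideals_upto_def by (elim imageE CollectE conjE)
    then show "J \<in> {I \<in> nonzero_ideals_upto x. I \<subseteq> gauss_principal k}"
      using bij_betwE[OF scale_nonzero_ideals(1)[OF k]] iff[OF I(2)] by (simp add: nonzero_ideals_upto_def)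
  next
    fix J assume J: "J \<in> {I \<in> nonzero_ideals_upto x. I \<subseteq> gauss_principal k}"
    then have "J \<in> (`) ((*) k) ` nonzero_ideals"
      unfolding bij_betw_imp_surj_on[OF scale_nonzero_ideals(1)[OF k]] by (simp add: nonzero_ideals_upto_def)
    then obtain I where I: "J = (*) k ` I" "I \<in> nonzero_ideals" by (elim imageE)
    then have "I \<in> nonzero_ideals_upto (x / gauss_norm k)"
      using iff[OF I(2)] J by (simp add: nonzero_ideals_upto_def)
    then show "J \<in> (`) ((*) k) ` nonzero_ideals_upto (x / gauss_norm k)" unfolding I(1) by (rule imageI)
  qed
qed

lemma card_multiples:
  assumes "D \<in> nonzero_ideals"
  shows "real (card {I \<in> nonzero_ideals_upto x. I \<subseteq> D}) = ideal_count (x / ideal_norm D)"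
proof -
  obtain d where d: "d \<in> gauss_ints" "d \<noteq> 0" "D = gauss_principal d" "ideal_norm D = gauss_norm d"
    using nonzero_idealsE[OF assms] .
  show ?thesis using bij_betw_same_card[OF scale_nonzero_ideals_upto[OF d(1,2), of x]] d by simp
qed

definition coprime_pairs :: "real \<Rightarrow> (complex set \<times> complex set) set" where
  "coprime_pairs y = {(I, J) \<in> nonzero_ideals_upto y \<times> nonzero_ideals_upto y. ideal_gcd I J = gauss_ints}"

lemma card_gcd_eq:
  assumes "K \<in> nonzero_ideals"
  shows "card {(I, J) \<in> nonzero_ideals_upto x \<times> nonzero_ideals_upto x. ideal_gcd I J = K}
         = card (coprime_pairs (x / ideal_norm K))"
proof -
  obtain k where k: "k \<in> gauss_ints" "k \<noteq> 0" "K = gauss_principal k" "ideal_norm K = gauss_norm k"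
    using nonzero_idealsE[OF assms] .
  let ?U = "nonzero_ideals_upto (x / gauss_norm k)"
  let ?V = "{I \<in> nonzero_ideals_upto x. I \<subseteq> gauss_principal k}"
  let ?s = "(`) ((*) k)"
  have b: "bij_betw (map_prod ?s ?s) (?U \<times> ?U) (?V \<times> ?V)"
    by (intro bij_betw_map_prod scale_nonzero_ideals_upto k)
  have "bij_betw (map_prod ?s ?s) (coprime_pairs (x / gauss_norm k))
      {(I, J) \<in> nonzero_ideals_upto x \<times> nonzero_ideals_upto x. ideal_gcd I J = K}"
  proof (rule bij_betw_subset[OF b])
    show "coprime_pairs (x / gauss_norm k) \<subseteq> ?U \<times> ?U" by (auto simp: coprime_pairs_def)
    have inK: "I \<subseteq> gauss_principal k \<and> J \<subseteq> gauss_principal k"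
      if "I \<in> nonzero_ideals" "J \<in> nonzero_ideals" "ideal_gcd I J = K" for I J
      using that(3) k(3) ideal_gcd_eq_iff[OF nonzero_ideals_ideal[OF that(1)] nonzero_ideals_ideal[OF that(2)], of K]
      by (simp only: simp_thms)
    have N: "I \<in> nonzero_ideals" if "I \<in> nonzero_ideals_upto z" for I z
      using that by (simp add: nonzero_ideals_upto_def)
    show "map_prod ?s ?s ` coprime_pairs (x / gauss_norm k)
      = {(I, J) \<in> nonzero_ideals_upto x \<times> nonzero_ideals_upto x. ideal_gcd I J = K}"
    proof (intro equalityI subsetI)
      fix p assume "p \<in> map_prod ?s ?s ` coprime_pairs (x / gauss_norm k)"
      then obtain q where q: "p = map_prod ?s ?s q" "q \<in> coprime_pairs (x / gauss_norm k)" by (elim imageE)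
      obtain I J where qIJ: "q = (I, J)" by (cases q)
      have IJ: "I \<in> ?U" "J \<in> ?U" "ideal_gcd I J = gauss_ints" and p: "p = (?s I, ?s J)"
        using q unfolding qIJ by (simp_all add: coprime_pairs_def)
      have "?s I \<in> nonzero_ideals_upto x" "?s J \<in> nonzero_ideals_upto x"
        using bij_betwE[OF scale_nonzero_ideals_upto[OF k(1,2)]] IJ by simp_all
      then show "p \<in> {(I, J) \<in> nonzero_ideals_upto x \<times> nonzero_ideals_upto x. ideal_gcd I J = K}"
        using ideal_gcd_scale_iff[OF k(1,2) N[OF IJ(1)] N[OF IJ(2)]] IJ(3) unfolding p k(3) by simp
    next
      fix p assume p: "p \<in> {(I, J) \<in> nonzero_ideals_upto x \<times> nonzero_ideals_upto x. ideal_gcd I J = K}"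
      obtain I' J' where pIJ: "p = (I', J')" by (cases p)
      have I'J': "I' \<in> nonzero_ideals_upto x" "J' \<in> nonzero_ideals_upto x" "ideal_gcd I' J' = K"
        using p unfolding pIJ by simp_all
      then have "I' \<in> ?V" "J' \<in> ?V" using inK[OF N N I'J'(3)] by simp_all
      then obtain I J where IJ: "I \<in> ?U" "J \<in> ?U" "I' = ?s I" "J' = ?s J"
        unfolding bij_betw_imp_surj_on[OF scale_nonzero_ideals_upto[OF k(1,2), of x], symmetric] by (elim imageE)
      then have "ideal_gcd I J = gauss_ints"
        using I'J'(3) ideal_gcd_scale_iff[OF k(1,2) N[OF IJ(1)] N[OF IJ(2)]] unfolding IJ(3,4) k(3) by simp
      then have "(I, J) \<in> coprime_pairs (x / gauss_norm k)" using IJ by (simp add: coprime_pairs_def)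
      moreover have "p = map_prod ?s ?s (I, J)" by (simp add: pIJ IJ)
      ultimately show "p \<in> map_prod ?s ?s ` coprime_pairs (x / gauss_norm k)" by (rule rev_image_eqI)
    qed
  qed
  from bij_betw_same_card[OF this] show ?thesis by (simp only: k(4))
qed

text \<open>The indicator of coprimality is expanded by the Moebius sum. Divisors of an ideal of
  norm at most \<open>y\<close> have norm at most \<open>y\<close>, so all sums share one finite
  range and may be interchanged; the conditions on \<open>I\<close> and \<open>J\<close> then
  separate into a square.\<close>

lemma card_coprime_pairs:
  "real (card (coprime_pairs y)) = (\<Sum>D\<in>nonzero_ideals_upto y. ideal_moebius D * (ideal_count (y / ideal_norm D))\<^sup>2)"
proof -
  let ?U = "nonzero_ideals_upto y"
  have fU: "finite ?U" by (rule finite_nonzero_ideals_upto)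
  have U: "I \<in> nonzero_ideals" if "I \<in> ?U" for I using that by (simp add: nonzero_ideals_upto_def)
  have ind: "(if ideal_gcd I J = gauss_ints then 1 else 0 :: real) = (\<Sum>D\<in>?U. ideal_moebius D * (of_bool (I \<subseteq> D) * of_bool (J \<subseteq> D)))"
    if IJ: "I \<in> ?U" "J \<in> ?U" for I J
  proof -
    have "(if ideal_gcd I J = gauss_ints then 1 else 0 :: real) = (\<Sum>D | D \<in> nonzero_ideals \<and> I \<union> J \<subseteq> D. ideal_moebius D)"
      using ideal_gcd_eq_gauss_ints_iff[OF U[OF IJ(1)] U[OF IJ(2)]]
        sum_ideal_moebius[OF U[OF IJ(1)], of "I \<union> J"] nonzero_ideals_subset[OF U[OF IJ(1)]] nonzero_ideals_subset[OF U[OF IJ(2)]]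
      by simp
    also have "{D. D \<in> nonzero_ideals \<and> I \<union> J \<subseteq> D} = {D \<in> ?U. I \<subseteq> D \<and> J \<subseteq> D}"
      using ideal_subset_norm(1)[OF U[OF IJ(1)]] IJ(1) by (auto simp: nonzero_ideals_upto_def intro: order_trans)
    also have "(\<Sum>D\<in>\<dots>. ideal_moebius D) = (\<Sum>D\<in>?U. if I \<subseteq> D \<and> J \<subseteq> D then ideal_moebius D else 0)"
      by (rule sum.inter_filter[OF fU])
    also have "\<dots> = (\<Sum>D\<in>?U. ideal_moebius D * (of_bool (I \<subseteq> D) * of_bool (J \<subseteq> D)))"
      by (intro sum.cong) auto
    finally show ?thesis .
  qed
  have "real (card (coprime_pairs y)) = (\<Sum>p\<in>?U \<times> ?U. if ideal_gcd (fst p) (snd p) = gauss_ints then 1 else 0)"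
  proof -
    have "coprime_pairs y = {p \<in> ?U \<times> ?U. ideal_gcd (fst p) (snd p) = gauss_ints}"
      unfolding coprime_pairs_def by (intro Collect_cong) (simp add: case_prod_unfold mem_Times_iff)
    moreover have "finite (?U \<times> ?U)" using fU by simp
    ultimately show ?thesis
      by (simp only: real_of_card sum.inter_filter)
  qed
  also have "\<dots> = (\<Sum>I\<in>?U. \<Sum>J\<in>?U. if ideal_gcd I J = gauss_ints then 1 else 0)"
    by (simp add: sum.cartesian_product case_prod_unfold)
  also have "\<dots> = (\<Sum>I\<in>?U. \<Sum>J\<in>?U. \<Sum>D\<in>?U. ideal_moebius D * (of_bool (I \<subseteq> D) * of_bool (J \<subseteq> D)))"
    by (intro sum.cong refl ind)
  also have "\<dots> = (\<Sum>I\<in>?U. \<Sum>D\<in>?U. \<Sum>J\<in>?U. ideal_moebius D * (of_bool (I \<subseteq> D) * of_bool (J \<subseteq> D)))"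
    by (intro sum.cong refl sum.swap)
  also have "\<dots> = (\<Sum>D\<in>?U. \<Sum>I\<in>?U. \<Sum>J\<in>?U. ideal_moebius D * (of_bool (I \<subseteq> D) * of_bool (J \<subseteq> D)))"
    by (rule sum.swap)
  also have "\<dots> = (\<Sum>D\<in>?U. ideal_moebius D * ((\<Sum>I\<in>?U. of_bool (I \<subseteq> D)) * (\<Sum>J\<in>?U. of_bool (J \<subseteq> D))))"
    by (simp only: sum_product) (simp only: sum_distrib_left)
  also have "\<dots> = (\<Sum>D\<in>?U. ideal_moebius D * (ideal_count (y / ideal_norm D))\<^sup>2)"
  proof (intro sum.cong refl)
    fix D assume "D \<in> ?U"
    have "(\<Sum>I\<in>?U. of_bool (I \<subseteq> D)) = real (card {I \<in> ?U. I \<subseteq> D})"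
      using fU by (simp add: sum_of_bool_eq Int_def)
    then show "ideal_moebius D * ((\<Sum>I\<in>?U. of_bool (I \<subseteq> D)) * (\<Sum>J\<in>?U. of_bool (J \<subseteq> D))) = ideal_moebius D * (ideal_count (y / ideal_norm D))\<^sup>2"
      using card_multiples[OF U[OF \<open>D \<in> ?U\<close>], of y] by (simp add: power2_eq_square)
  qed
  finally show ?thesis .
qed

section \<open>Coprime pairs of ideals\<close>

lemma summable_ideal_norm_powr: "(\<lambda>I. ideal_norm I powr (-4/3)) summable_on nonzero_ideals"
proof -
  let ?f = "\<lambda>(a, b). gauss_principal (Complex (real a) (real b))"
  let ?A = "{(a, b). 1 \<le> (a::nat)} :: (nat \<times> nat) set"
  define h where "h n = real (Suc n) powr (-4/3)" for n
  have h0: "h n \<ge> 0" for n by (simp add: h_def)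
  have "summable (\<lambda>n. real n powr (-4/3))" by (subst summable_real_powr_iff) simp
  then have "summable h" unfolding h_def by (subst (asm) summable_Suc_iff[symmetric])
  then have hs: "h summable_on UNIV"
    using h0 by (intro norm_summable_imp_summable_on) simp
  have "(\<lambda>(a, b). h a * h b) summable_on UNIV \<times> UNIV"
  proof (rule summable_on_SigmaI)
    show "((\<lambda>b. case (a, b) of (a, b) \<Rightarrow> h a * h b) has_sum (h a * infsum h UNIV)) UNIV" for a
      using hs by (auto intro: has_sum_cmult_right)
    show "(\<lambda>a. h a * infsum h UNIV) summable_on UNIV" using hs by (rule summable_on_cmult_left)
  qed (use h0 in auto)
  then have "(\<lambda>(a, b). h a * h b) summable_on ?A"
    by (rule summable_on_subset_banach) auto
  then have "(\<lambda>p. 4 powr (4/3) * (case p of (a, b) \<Rightarrow> h a * h b)) summable_on ?A"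
    by (rule summable_on_cmult_right)
  then have "(\<lambda>p. ideal_norm (?f p) powr (-4/3)) summable_on ?A"
  proof (rule summable_on_comparison_test)
    fix p assume "p \<in> ?A"
    then obtain a b where p: "p = (a, b)" "1 \<le> a" by blast
    \<comment> \<open>This comparison majorises the double series by a product of two one-variable
      series with exponent 4/3 > 1.\<close>
    have "real (Suc a) * real (Suc b) \<le> 4 * (real a ^ 2 + real b ^ 2)"
    proof -
      have aux: "1 + u + v + r \<le> 4 * (p + q)"
        if "1 \<le> u" "u \<le> p" "v \<le> q" "2 * r \<le> p + q" "0 \<le> q" for u v r p q :: real
        using that by (simp add: distrib_left)
      have 1: "1 \<le> real a" using p by simp
      have "real a \<le> real a ^ 2" using 1 by (simp add: power2_eq_square mult_le_cancel_left1)
      moreover have "real b \<le> real b ^ 2"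
        by (cases b) (auto simp: power2_eq_square mult_le_cancel_left1)
      moreover have "2 * (real a * real b) \<le> real a ^ 2 + real b ^ 2"
        using sum_squares_bound[of "real a" "real b"] by (simp add: mult.assoc)
      ultimately have "1 + real a + real b + real a * real b \<le> 4 * (real a ^ 2 + real b ^ 2)"
        using 1 by (intro aux) auto
      then show ?thesis by (simp add: algebra_simps)
    qed
    then have le: "(real (Suc a) * real (Suc b)) / 4 \<le> real a ^ 2 + real b ^ 2" by simp
    have "ideal_norm (?f p) powr (-4/3) = (real a ^ 2 + real b ^ 2) powr (-4/3)"
      using p ideal_norm_quadrant[of a b] by simp
    also have "\<dots> \<le> ((real (Suc a) * real (Suc b)) / 4) powr (-4/3)"
      using le by (intro powr_mono2') auto
    also have "\<dots> = 4 powr (4/3) * (h a * h b)"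
      by (simp add: h_def powr_divide powr_mult powr_minus_divide)
    finally show "ideal_norm (?f p) powr (-4/3) \<le> 4 powr (4/3) * (case p of (a, b) \<Rightarrow> h a * h b)"
      using p by simp
  qed simp
  then show ?thesis using summable_on_reindex_bij_betw[OF quadrant_bij_betw] by blast
qed

lemma summable_ideal_norm_square: "(\<lambda>I. 1 / (ideal_norm I)\<^sup>2) summable_on nonzero_ideals"
  using summable_ideal_norm_powr
proof (rule summable_on_comparison_test)
  fix I assume "I \<in> nonzero_ideals"
  then have n: "ideal_norm I \<ge> 1" by (rule ideal_norm_ge_1)
  have "1 / (ideal_norm I)\<^sup>2 = ideal_norm I powr (-2)" using n by (simp add: powr_minus_divide)
  also have "\<dots> \<le> ideal_norm I powr (-4/3)" using n by (intro powr_mono) auto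
  finally show "1 / (ideal_norm I)\<^sup>2 \<le> ideal_norm I powr (-4/3)" .
qed simp

definition ideal_zeta2 :: real where "ideal_zeta2 = (\<Sum>\<^sub>\<infinity>I\<in>nonzero_ideals. 1 / (ideal_norm I)\<^sup>2)"

lemma zeta_Qi_2: "zeta_Qi 2 = complex_of_real ideal_zeta2"
proof -
  have "((\<lambda>I. complex_of_real (1 / (ideal_norm I)\<^sup>2)) has_sum complex_of_real ideal_zeta2) nonzero_ideals"
    unfolding ideal_zeta2_def by (intro has_sum_of_real has_sum_infsum summable_ideal_norm_square)
  then have "complex_of_real ideal_zeta2 = (\<Sum>\<^sub>\<infinity>I\<in>nonzero_ideals. complex_of_real (1 / (ideal_norm I)\<^sup>2))"
    by (simp only: infsumI)
  also have "\<dots> = zeta_Qi 2" unfolding zeta_Qi_def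
  proof (rule infsum_cong)
    fix I assume "I \<in> nonzero_ideals"
    then have n: "ideal_norm I \<ge> 1" by (rule ideal_norm_ge_1)
    have "complex_of_real (1 / (ideal_norm I)\<^sup>2) = complex_of_real (ideal_norm I powr (-2))"
      using n by (simp add: powr_minus_divide)
    also have "\<dots> = complex_of_real (ideal_norm I) powr complex_of_real (-2)"
      using n by (intro powr_of_real[symmetric]) auto
    finally show "complex_of_real (1 / (ideal_norm I)\<^sup>2) = complex_of_real (ideal_norm I) powr - 2" by simp
  qed
  finally show ?thesis ..
qed

text \<open>The double sum of \<open>ideal_moebius D * w J\<close> over
  \<open>J \<subseteq> D\<close> is evaluated twice. For fixed \<open>D\<close> the multiples
  \<open>J\<close> are scaled copies of all ideals and give \<open>w D * ideal_zeta2\<close>; for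
  fixed \<open>J\<close> the divisor sum vanishes unless \<open>J\<close> is the whole ring.\<close>

lemma moebius_zeta2_inverse:
  shows "(\<lambda>D. ideal_moebius D / (ideal_norm D)\<^sup>2) summable_on nonzero_ideals"
    and "(\<Sum>\<^sub>\<infinity>D\<in>nonzero_ideals. ideal_moebius D / (ideal_norm D)\<^sup>2) * ideal_zeta2 = 1"
proof -
  let ?N = nonzero_ideals
  define w where "w I = 1 / (ideal_norm I)\<^sup>2" for I
  have ws: "w summable_on ?N" unfolding w_def by (rule summable_ideal_norm_square)
  have w0: "w I \<ge> 0" for I by (simp add: w_def)
  have abs_mw: "\<bar>ideal_moebius D * c\<bar> \<le> c" if "c \<ge> 0" for D c
    using mult_right_mono[OF abs_ideal_moebius_le that] that by (simp add: abs_mult)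
  have ms: "(\<lambda>D. ideal_moebius D * w D) summable_on ?N"
    by (rule abs_summable_summable, rule summable_on_comparison_test[OF ws]) (use abs_mw w0 in auto)
  then show "(\<lambda>D. ideal_moebius D / (ideal_norm D)\<^sup>2) summable_on ?N" by (simp add: w_def)
  define F where "F D J = ideal_moebius D * (of_bool (J \<subseteq> D) * w J)" for D J
  have row: "((\<lambda>J. of_bool (J \<subseteq> D) * w J) has_sum (w D * ideal_zeta2)) ?N" if D: "D \<in> ?N" for D
  proof -
    obtain d where d: "d \<in> gauss_ints" "d \<noteq> 0" "D = gauss_principal d" "ideal_norm D = gauss_norm d"
      using nonzero_idealsE[OF D] .
    have "((\<lambda>I. w D * w I) has_sum (w D * ideal_zeta2)) ?N"
      using has_sum_cmult_right[OF has_sum_infsum[OF ws]] unfolding ideal_zeta2_def w_def .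
    moreover have "w D * w I = w ((*) d ` I)" if "I \<in> ?N" for I
      using scale_nonzero_ideals(2)[OF d(1,2) that] d(4) by (simp add: w_def power_mult_distrib)
    ultimately have "((\<lambda>I. w ((*) d ` I)) has_sum (w D * ideal_zeta2)) ?N"
      by (simp cong: has_sum_cong)
    then have "(w has_sum (w D * ideal_zeta2)) {I \<in> ?N. I \<subseteq> D}"
      unfolding d(3) using has_sum_reindex_bij_betw[OF scale_nonzero_ideals(1)[OF d(1,2)], of w] by simp
    then show ?thesis
      by (rule has_sum_cong_neutral[THEN iffD1, rotated -1]) auto
  qed
  \<comment> \<open>Absolute summability over pairs licenses the interchange: the row of
    \<open>D\<close> is dominated by \<open>w D * ideal_zeta2\<close>, itself summable.\<close>
  have abs_sum: "(\<lambda>p. norm (case p of (D, J) \<Rightarrow> F D J)) summable_on (?N \<times> ?N)"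
    unfolding Infinite_Sum.abs_summable_on_Sigma_iff
  proof (intro conjI ballI)
    fix D assume D: "D \<in> ?N"
    show "(\<lambda>J. norm (case (D, J) of (D, J) \<Rightarrow> F D J)) summable_on ?N"
      by (rule summable_on_comparison_test[OF ws]) (use abs_mw w0 in \<open>auto simp: F_def\<close>)
  next
    have le: "norm (F D J) \<le> of_bool (J \<subseteq> D) * w J" for D J
      unfolding F_def real_norm_def by (intro abs_mw mult_nonneg_nonneg w0) auto
    have "(\<Sum>\<^sub>\<infinity>J\<in>?N. norm (F D J)) \<le> w D * ideal_zeta2" if D: "D \<in> ?N" for D
    proof -
      have "(\<lambda>J. norm (F D J)) summable_on ?N"
        by (rule summable_on_comparison_test[OF has_sum_imp_summable[OF row[OF D]]]) (use le in auto)
      then show ?thesis using le row[OF D]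
        by (intro has_sum_mono[OF has_sum_infsum row[OF D]]) auto
    qed
    then show "(\<lambda>D. norm (\<Sum>\<^sub>\<infinity>J\<in>?N. norm (case (D, J) of (D, J) \<Rightarrow> F D J))) summable_on ?N"
      by (intro summable_on_comparison_test[OF summable_on_cmult_left[OF ws, of ideal_zeta2]])
        (auto simp: abs_of_nonneg infsum_nonneg)
  qed
  have "(\<Sum>\<^sub>\<infinity>D\<in>?N. \<Sum>\<^sub>\<infinity>J\<in>?N. F D J) = (\<Sum>\<^sub>\<infinity>J\<in>?N. \<Sum>\<^sub>\<infinity>D\<in>?N. F D J)"
    by (rule infsum_swap_banach) (rule abs_summable_summable[OF abs_sum])
  also have "(\<Sum>\<^sub>\<infinity>D\<in>?N. \<Sum>\<^sub>\<infinity>J\<in>?N. F D J) = (\<Sum>\<^sub>\<infinity>D\<in>?N. ideal_moebius D * w D * ideal_zeta2)"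
  proof (rule infsum_cong)
    fix D assume "D \<in> ?N"
    from has_sum_cmult_right[OF row[OF this], of "ideal_moebius D"]
    show "(\<Sum>\<^sub>\<infinity>J\<in>?N. F D J) = ideal_moebius D * w D * ideal_zeta2"
      unfolding F_def by (simp only: infsumI mult.assoc)
  qed
  also have "\<dots> = (\<Sum>\<^sub>\<infinity>D\<in>?N. ideal_moebius D * w D) * ideal_zeta2"
    by (rule infsum_cmult_left) (use ms in simp)
  also have "(\<Sum>\<^sub>\<infinity>J\<in>?N. \<Sum>\<^sub>\<infinity>D\<in>?N. F D J) = (\<Sum>\<^sub>\<infinity>J\<in>?N. of_bool (J = gauss_ints) * w J)"
  proof (rule infsum_cong)
    fix J assume J: "J \<in> ?N"
    have "(\<Sum>\<^sub>\<infinity>D\<in>?N. F D J) = (\<Sum>\<^sub>\<infinity>D\<in>{D \<in> ?N. J \<subseteq> D}. ideal_moebius D * w J)"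
      by (rule infsum_cong_neutral) (auto simp: F_def)
    also have "\<dots> = (\<Sum>D | D \<in> ?N \<and> J \<subseteq> D. ideal_moebius D) * w J"
      using finite_ideals_above[OF J] by (simp add: sum_distrib_right)
    also have "(\<Sum>D | D \<in> ?N \<and> J \<subseteq> D. ideal_moebius D) = of_bool (J = gauss_ints)"
      using sum_ideal_moebius[OF J order.refl nonzero_ideals_subset[OF J]] ex_max_ideal_above[OF J] by auto
    finally show "(\<Sum>\<^sub>\<infinity>D\<in>?N. F D J) = of_bool (J = gauss_ints) * w J" .
  qed
  also have "\<dots> = (\<Sum>\<^sub>\<infinity>J\<in>{gauss_ints}. w J)"
    by (rule infsum_cong_neutral) (use gauss_ints_nonzero_ideal in auto)
  also have "\<dots> = 1" using ideal_norm_gauss_ints by (simp add: w_def)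
  finally show "(\<Sum>\<^sub>\<infinity>D\<in>?N. ideal_moebius D / (ideal_norm D)\<^sup>2) * ideal_zeta2 = 1"
    by (simp add: w_def)
qed

text \<open>The number is pi/4. It cancels from the final probability, so its value is never
  computed and positivity suffices.\<close>

abbreviation ideal_density :: real where "ideal_density \<equiv> arcsin (sqrt (1/2))"

lemma ideal_density_pos: "ideal_density > 0"
  using arcsin_less_arcsin[of 0 "sqrt (1/2)"] by simp

text \<open>The difference of squares factors into an error of order t^(1/3) and a sum of order t.
  Below \<open>t = 1\<close> there are no ideals, and t^2 is at most t^(4/3).\<close>

lemma ideal_count_square_error:
  obtains C where "C > 0"
    "\<And>t. t > 0 \<Longrightarrow> \<bar>(ideal_count t)\<^sup>2 - (ideal_density * t)\<^sup>2\<bar> \<le> C * t powr (4/3)"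
proof -
  let ?c = ideal_density
  have c: "?c > 0" by (rule ideal_density_pos)
  define C where "C = 160 * (2 * ?c + 160) + ?c\<^sup>2"
  have "\<bar>(ideal_count t)\<^sup>2 - (?c * t)\<^sup>2\<bar> \<le> C * t powr (4/3)" if t: "t > 0" for t
  proof (cases "t \<ge> 1")
    case True
    have E: "\<bar>ideal_count t - ?c * t\<bar> \<le> 160 * t powr (1/3)"
      using quadrant_points_asymptotic[OF True] by (simp add: card_nonzero_ideals_upto)
    have "t powr (1/3) \<le> t powr 1" using True by (intro powr_mono) auto
    then have "ideal_count t + ?c * t \<le> (2 * ?c + 160) * t" using E True by (simp add: algebra_simps)
    moreover have "ideal_count t + ?c * t \<ge> 0" using c t by simp
    ultimately have S: "\<bar>ideal_count t + ?c * t\<bar> \<le> (2 * ?c + 160) * t" by simp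
    have "\<bar>(ideal_count t)\<^sup>2 - (?c * t)\<^sup>2\<bar> = \<bar>ideal_count t - ?c * t\<bar> * \<bar>ideal_count t + ?c * t\<bar>"
      by (simp add: abs_mult[symmetric] power2_eq_square algebra_simps)
    also have "\<dots> \<le> (160 * t powr (1/3)) * ((2 * ?c + 160) * t)"
      using E S by (intro mult_mono) auto
    also have "\<dots> = 160 * (2 * ?c + 160) * (t powr (1/3) * t powr 1)" using t by simp
    also have "t powr (1/3) * t powr 1 = t powr (4/3)" by (simp only: powr_add[symmetric]) simp
    also have "160 * (2 * ?c + 160) * t powr (4/3) \<le> C * t powr (4/3)"
      unfolding C_def by (intro mult_right_mono) auto
    finally show ?thesis .
  next
    case False
    have "nonzero_ideals_upto t = {}"
      using False ideal_norm_ge_1 by (force simp: nonzero_ideals_upto_def)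
    then have "\<bar>(ideal_count t)\<^sup>2 - (?c * t)\<^sup>2\<bar> = ?c\<^sup>2 * t powr 2" using t by (simp add: power_mult_distrib)
    also have "\<dots> \<le> ?c\<^sup>2 * t powr (4/3)" using False t by (intro mult_left_mono powr_mono') auto
    also have "\<dots> \<le> C * t powr (4/3)" unfolding C_def using c by (intro mult_right_mono) auto
    finally show ?thesis .
  qed
  moreover have "C > 0" unfolding C_def using c by (intro add_pos_nonneg mult_pos_pos) auto
  ultimately show ?thesis using that by blast
qed

lemma ideal_zeta2_ge_1: "ideal_zeta2 \<ge> 1"
proof -
  have "(\<Sum>I\<in>{gauss_ints}. 1 / (ideal_norm I)\<^sup>2) \<le> ideal_zeta2"
    unfolding ideal_zeta2_def
    by (intro finite_sum_le_infsum summable_ideal_norm_square) (auto simp: gauss_ints_nonzero_ideal)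
  then show ?thesis by (simp add: ideal_norm_gauss_ints)
qed

text \<open>The finite Moebius sum extends by zeros to all nonzero ideals, since beyond norm
  \<open>y\<close> the inner count is 0. The difference from the series for 1 / zeta(2) is then
  bounded term by term.\<close>

lemma coprime_pairs_asymptotic:
  obtains C where "C > 0"
    "\<And>y. y > 0 \<Longrightarrow> \<bar>real (card (coprime_pairs y)) - (ideal_density * y)\<^sup>2 / ideal_zeta2\<bar> \<le> C * y powr (4/3)"
proof -
  let ?N = nonzero_ideals and ?c = ideal_density
  obtain C where C: "C > 0"
    "\<And>t. t > 0 \<Longrightarrow> \<bar>(ideal_count t)\<^sup>2 - (?c * t)\<^sup>2\<bar> \<le> C * t powr (4/3)"
    by (rule ideal_count_square_error, rule that)
  define A where "A = (\<Sum>\<^sub>\<infinity>D\<in>?N. ideal_norm D powr (-4/3))"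
  have A: "A \<ge> 0" unfolding A_def by (intro infsum_nonneg) auto
  have "\<bar>real (card (coprime_pairs y)) - (?c * y)\<^sup>2 / ideal_zeta2\<bar> \<le> (C * A + 1) * y powr (4/3)" if y: "y > 0" for y
  proof -
    let ?a = "\<lambda>D. ideal_moebius D * (ideal_count (y / ideal_norm D))\<^sup>2"
    let ?b = "\<lambda>D. (?c * y)\<^sup>2 * (ideal_moebius D / (ideal_norm D)\<^sup>2)"
    have ha: "(?a has_sum real (card (coprime_pairs y))) ?N"
      unfolding card_coprime_pairs
    proof (rule has_sum_finite_neutralI)
      show "finite (nonzero_ideals_upto y)" by (rule finite_nonzero_ideals_upto)
      show "nonzero_ideals_upto y \<subseteq> ?N" by (auto simp: nonzero_ideals_upto_def)
      fix D assume D: "D \<in> ?N - nonzero_ideals_upto y"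
      then have n: "ideal_norm D > y" "ideal_norm D \<ge> 1" using ideal_norm_ge_1 by (auto simp: nonzero_ideals_upto_def)
      then have "y / ideal_norm D < 1" using y by simp
      then have "nonzero_ideals_upto (y / ideal_norm D) = {}"
        using ideal_norm_ge_1 by (force simp: nonzero_ideals_upto_def)
      then show "?a D = 0" by simp
    qed auto
    have hb: "(?b has_sum ((?c * y)\<^sup>2 * (1 / ideal_zeta2))) ?N"
    proof -
      have "(\<Sum>\<^sub>\<infinity>D\<in>?N. ideal_moebius D / (ideal_norm D)\<^sup>2) = 1 / ideal_zeta2"
        using moebius_zeta2_inverse(2) ideal_zeta2_ge_1 by (simp add: field_simps)
      then show ?thesis using has_sum_cmult_right[OF has_sum_infsum[OF moebius_zeta2_inverse(1)]] by metis
    qed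
    have 1: "((\<lambda>D. ?a D - ?b D) has_sum (real (card (coprime_pairs y)) - (?c * y)\<^sup>2 * (1 / ideal_zeta2))) ?N"
      using has_sum_add[OF ha has_sum_uminusI[OF hb]] by simp
    have 2: "((\<lambda>D. C * y powr (4/3) * ideal_norm D powr (-4/3)) has_sum (C * y powr (4/3) * A)) ?N"
      unfolding A_def by (intro has_sum_cmult_right has_sum_infsum summable_ideal_norm_powr)
    have "norm (real (card (coprime_pairs y)) - (?c * y)\<^sup>2 * (1 / ideal_zeta2)) \<le> C * y powr (4/3) * A"
    proof (rule norm_infsum_le[OF 1 2])
      fix D assume "D \<in> ?N"
      then have n: "ideal_norm D \<ge> 1" by (rule ideal_norm_ge_1)
      let ?t = "y / ideal_norm D"
      have "?a D - ?b D = ideal_moebius D * ((ideal_count ?t)\<^sup>2 - (?c * ?t)\<^sup>2)"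
        by (simp add: power_mult_distrib power_divide algebra_simps)
      then have "norm (?a D - ?b D) \<le> 1 * \<bar>(ideal_count ?t)\<^sup>2 - (?c * ?t)\<^sup>2\<bar>"
        using mult_right_mono[OF abs_ideal_moebius_le abs_ge_zero] by (simp add: abs_mult)
      also have "\<dots> \<le> C * ?t powr (4/3)" using C(2)[of ?t] y n by simp
      also have "\<dots> = C * y powr (4/3) * ideal_norm D powr (-4/3)"
        using y n by (simp add: powr_divide powr_minus_divide)
      finally show "norm (?a D - ?b D) \<le> C * y powr (4/3) * ideal_norm D powr (-4/3)" .
    qed
    also have "\<dots> \<le> (C * A + 1) * y powr (4/3)" by (simp add: algebra_simps)
    finally show ?thesis by simp
  qed
  moreover have "C * A + 1 > 0" using A C(1) by (intro add_nonneg_pos) auto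
  ultimately show ?thesis using that by blast
qed

text \<open>The squared count is the denominator of the probability and must be at least a fixed
  multiple of \<open>x\<^sup>2\<close> for every \<open>x \<ge> 1\<close>, not only for large
  \<open>x\<close>.\<close>

lemma ideal_count_lower_bound:
  obtains b where "b > 0" "\<And>x. x \<ge> 1 \<Longrightarrow> b * x \<le> ideal_count x"
proof -
  let ?c = ideal_density
  have c: "?c > 0" by (rule ideal_density_pos)
  \<comment> \<open>From this point on the error \<open>160 * x powr (1/3)\<close> is at most half
    of the main term. For smaller \<open>x\<close> the unit ideal alone suffices.\<close>
  define X where "X = (320 / ?c) powr (3/2)"
  have X: "X > 0" using c by (simp add: X_def)
  define b where "b = min (?c / 2) (1 / X)"
  have "b * x \<le> ideal_count x" if x: "x \<ge> 1" for x
  proof (cases "x \<ge> X")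
    case True
    have "160 * x powr (1/3) \<le> ?c / 2 * x"
    proof -
      have "320 / ?c = X powr (2/3)" using c by (simp add: X_def powr_powr)
      also have "\<dots> \<le> x powr (2/3)" using True X by (intro powr_mono2) auto
      finally have "320 / ?c * x powr (1/3) \<le> x powr (2/3) * x powr (1/3)" by (intro mult_right_mono) auto
      also have "\<dots> = x" using x by (simp add: powr_add[symmetric])
      finally show ?thesis using c by (simp add: field_simps)
    qed
    then have "?c / 2 * x \<le> ideal_count x"
      using quadrant_points_asymptotic[OF x] by (simp add: card_nonzero_ideals_upto abs_le_iff)
    moreover have "b * x \<le> ?c / 2 * x" using x by (intro mult_right_mono) (auto simp: b_def)
    ultimately show ?thesis by simp
  next
    case False
    have "b * x \<le> 1 / X * x" using x by (intro mult_right_mono) (auto simp: b_def)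
    also have "\<dots> \<le> 1" using False X by simp
    also have "1 \<le> ideal_count x"
      using nonzero_ideals_upto_nonempty[OF x] finite_nonzero_ideals_upto[of x]
      by (simp add: Suc_le_eq card_gt_0_iff)
    finally show ?thesis .
  qed
  moreover have "b > 0" using c X by (simp add: b_def)
  ultimately show ?thesis using that by blast
qed

lemma prob_gcd_eq:
  assumes "x \<ge> 1" "K \<in> nonzero_ideals"
  shows "measure_pmf.prob (random_ideal_pair x) {(I, J). ideal_gcd I J = K}
       = real (card (coprime_pairs (x / ideal_norm K))) / (ideal_count x)\<^sup>2"
proof -
  let ?U = "nonzero_ideals_upto x"
  have U: "finite ?U" "?U \<noteq> {}" using finite_nonzero_ideals_upto nonzero_ideals_upto_nonempty[OF assms(1)] by auto
  have "random_ideal_pair x = pmf_of_set (?U \<times> ?U)"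
    unfolding random_ideal_pair_def
  proof (rule pmf_eqI)
    fix p :: "complex set \<times> complex set"
    obtain a b where p: "p = (a, b)" by (cases p)
    show "pmf (pair_pmf (pmf_of_set ?U) (pmf_of_set ?U)) p = pmf (pmf_of_set (?U \<times> ?U)) p"
      using pmf_of_set[OF U(2,1)] pmf_of_set[of "?U \<times> ?U"] U
      by (simp add: p pmf_pair indicator_times card_cartesian_product)
  qed
  then have "measure_pmf.prob (random_ideal_pair x) {(I, J). ideal_gcd I J = K}
      = real (card (?U \<times> ?U \<inter> {(I, J). ideal_gcd I J = K})) / real (card (?U \<times> ?U))"
    using U by (simp only:) (subst measure_pmf_of_set; simp)
  moreover have "?U \<times> ?U \<inter> {(I, J). ideal_gcd I J = K} = {(I, J) \<in> ?U \<times> ?U. ideal_gcd I J = K}"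
    by blast
  ultimately show ?thesis
    using card_gcd_eq[OF assms(2), of x] by (simp only:) (simp add: card_cartesian_product power2_eq_square)
qed

theorem theorem1:
  shows "\<exists>C::real. \<forall>x::real. \<forall>K::complex set. x \<ge> 1 \<and> K \<in> nonzero_ideals \<longrightarrow>
    cmod (complex_of_real (measure_pmf.prob (random_ideal_pair x) {(I, J). ideal_gcd I J = K})
          - 1 / (zeta_Qi 2 * complex_of_real ((ideal_norm K)^2)))
      \<le> C * (1 / (x powr (2/3) * ideal_norm K powr (4/3)))"
proof -
  let ?c = ideal_density
  obtain A where A: "A > 0"
    "\<And>t. t > 0 \<Longrightarrow> \<bar>(ideal_count t)\<^sup>2 - (?c * t)\<^sup>2\<bar> \<le> A * t powr (4/3)"
    by (rule ideal_count_square_error, rule that)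
  obtain B where B: "B > 0"
    "\<And>y. y > 0 \<Longrightarrow> \<bar>real (card (coprime_pairs y)) - (?c * y)\<^sup>2 / ideal_zeta2\<bar> \<le> B * y powr (4/3)"
    by (rule coprime_pairs_asymptotic, rule that)
  obtain b where b: "b > 0" "\<And>x. x \<ge> 1 \<Longrightarrow> b * x \<le> ideal_count x"
    by (rule ideal_count_lower_bound, rule that)
  have z: "ideal_zeta2 \<ge> 1" by (rule ideal_zeta2_ge_1)
  have "\<bar>real (card (coprime_pairs (x / n))) / (ideal_count x)\<^sup>2 - 1 / (ideal_zeta2 * n\<^sup>2)\<bar>
      \<le> ((A + B) / b\<^sup>2) * (1 / (x powr (2/3) * n powr (4/3)))"
    if x: "x \<ge> 1" and n: "n \<ge> 1" for x n
  proof -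
    let ?P = "real (card (coprime_pairs (x / n)))"
    define H where "H = (ideal_count x)\<^sup>2"
    have "0 < b * x" using b x by simp
    then have Hlow: "b\<^sup>2 * x\<^sup>2 \<le> H" "H > 0"
      using power_mono[OF b(2)[OF x], of 2] b(2)[OF x] by (auto simp: H_def power_mult_distrib)
    \<comment> \<open>The multiples of the squared density cancel on the right, leaving the error of
      the coprime count and a rescaled error of \<open>H\<close>, both of order x^(4/3) before
      division by \<open>H\<close>.\<close>
    have e: "?P / H - 1 / (ideal_zeta2 * n\<^sup>2)
       = ((?P - (?c * (x / n))\<^sup>2 / ideal_zeta2) - (H - (?c * x)\<^sup>2) / (ideal_zeta2 * n\<^sup>2)) / H"
      using Hlow(2) z n by (simp add: field_simps power_mult_distrib power_divide)
    have 1: "\<bar>?P - (?c * (x / n))\<^sup>2 / ideal_zeta2\<bar> \<le> B * (x powr (4/3) / n powr (4/3))"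
      using B(2)[of "x / n"] x n by (simp add: powr_divide)
    have 2: "\<bar>(H - (?c * x)\<^sup>2) / (ideal_zeta2 * n\<^sup>2)\<bar> \<le> A * (x powr (4/3) / n powr (4/3))"
    proof -
      \<comment> \<open>The error of \<open>H\<close> carries the stronger factor 1 / n^2; weakening
        it to n^(-4/3) matches the other term.\<close>
      have "n powr (4/3) \<le> n powr 2" using n by (intro powr_mono) auto
      then have nn: "n powr (4/3) \<le> n\<^sup>2" using n by simp
      also have "\<dots> \<le> ideal_zeta2 * n\<^sup>2" using z mult_right_mono[of 1 ideal_zeta2 "n\<^sup>2"] by simp
      finally have "n powr (4/3) \<le> ideal_zeta2 * n\<^sup>2" .
      then have "\<bar>H - (?c * x)\<^sup>2\<bar> / (ideal_zeta2 * n\<^sup>2) \<le> A * x powr (4/3) / n powr (4/3)"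
        using A(2)[of x] x n by (intro frac_le) (auto simp: H_def)
      moreover have "\<bar>(H - (?c * x)\<^sup>2) / (ideal_zeta2 * n\<^sup>2)\<bar> = \<bar>H - (?c * x)\<^sup>2\<bar> / (ideal_zeta2 * n\<^sup>2)"
        using z by (simp only: abs_divide) simp
      ultimately show ?thesis by (simp only: times_divide_eq_right)
    qed
    have "\<bar>?P / H - 1 / (ideal_zeta2 * n\<^sup>2)\<bar>
       = \<bar>(?P - (?c * (x / n))\<^sup>2 / ideal_zeta2) - (H - (?c * x)\<^sup>2) / (ideal_zeta2 * n\<^sup>2)\<bar> / H"
      unfolding e using Hlow(2) by (simp only: abs_divide abs_of_pos)
    also have "\<dots> \<le> (A + B) * (x powr (4/3) / n powr (4/3)) / (b\<^sup>2 * x\<^sup>2)"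
    proof (rule frac_le)
      show "\<bar>(?P - (?c * (x / n))\<^sup>2 / ideal_zeta2) - (H - (?c * x)\<^sup>2) / (ideal_zeta2 * n\<^sup>2)\<bar>
          \<le> (A + B) * (x powr (4/3) / n powr (4/3))"
        unfolding distrib_right using order.trans[OF abs_triangle_ineq4 add_mono[OF 1 2]] by (simp only: add.commute)
    qed (use A B b x Hlow in auto)
    also have "\<dots> = ((A + B) / b\<^sup>2) * (1 / (x powr (2/3) * n powr (4/3)))"
    proof -
      have "x\<^sup>2 = x powr (4/3) * x powr (2/3)" using x by (simp add: powr_add[symmetric])
      then show ?thesis using x by simp
    qed
    finally show ?thesis by (simp only: H_def)
  qed
  moreover have "cmod (complex_of_real p - 1 / (zeta_Qi 2 * complex_of_real q)) = \<bar>p - 1 / (ideal_zeta2 * q)\<bar>" for p q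
  proof -
    have "complex_of_real p - 1 / (zeta_Qi 2 * complex_of_real q) = complex_of_real (p - 1 / (ideal_zeta2 * q))"
      by (simp add: zeta_Qi_2)
    then show ?thesis by (simp only: norm_of_real)
  qed
  ultimately show ?thesis
    by (intro exI[of _ "(A + B) / b\<^sup>2"] allI impI) (simp only: prob_gcd_eq ideal_norm_ge_1)
qed

end
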